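(* Consider the problem $\min f(x)$ subject to $x\in\Omega$ and the projected Newton-CG algorithm (PNCG) described in the context, under the assumptions listed there, and run PNCG with $\epsilon_k\equiv\epsilon_H<1$. Let $$c_{\rm nc}=\eta\min\Big\{\frac{(3-6\eta)^2\theta^2}{L_H^2},\theta^2\Big\},$$ $$c_{\rm sol}=\eta\min\Big\{\frac{4}{25+8L_H},\ \theta^2,\ \frac{9(1-\zeta-2\eta)^2\theta^2}{L_H^2},\ \frac{(1-\zeta)^2\theta^2}{(L_H/3+2\eta)^2}\Big\}.$$ Then PNCG stops within $$K_{\rm pncg}=\left\lfloor\frac{16\,(f(x_0)-f_{\rm low})}{\min\{c_{\rm nc},\,8c_{\rm sol},\,2\theta/L_g,\,\eta\}}\max\{\epsilon_g^{-2}\epsilon_H,\ \epsilon_H^{-3}\}\right\rfloor+2$$ iterations and outputs a vector $x\in\Omega$ such that, with probability $1$, $$x^i\ge 0\ \ (i\in\mathcal I),\qquad \|S\nabla f(x)\|\le\epsilon_g+\epsilon_H^2,\qquad \nabla_i f(x)\ge-\epsilon_H^{3/2}\ \ \text{for all } i\in J^+:=\{i\in\mathcal I\mid 0\le x^i\le\epsilon_H\},$$ where $S=\mathrm{diag}(s)$ with $s^i=x^i$ for $i\in J^+$ and $s^i=1$ otherwise. Moreover, $S\nabla^2 f(x)S\succeq-\epsilon_H I$ with probability at least $(1-\delta)^{K_{\rm pncg}}$, where $\delta\in[0,1)$ is the failure probability of the minimum eigenvalue oracle. In particular, if $\epsilon_g=\epsilon$ and $\epsilon_H=\sqrt\epsilon$,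 then PNCG outputs an $(\epsilon,1/2)$-2o point (as defined in the context) with probability at least $(1-\delta)^{K_{\rm pncg}}$ within $O(\epsilon^{-3/2})$ iterations.
   Context: **Problem and notation.** $f:\mathbb R^n\to\mathbb R$ is twice continuously differentiable and bounded below by $f_{\rm low}>-\infty$ on $\Omega=\{x\in\mathbb R^n\mid x^i\ge0,\ i\in\mathcal I\}$, where $\mathcal I\subseteq\{1,\dots,n\}$, $\mathcal I^c$ is its complement, and superscripts denote components. $P$ is Euclidean projection onto $\Omega$: $[P(z)]^i=\max\{z^i,0\}$ for $i\in\mathcal I$, $[P(z)]^i=z^i$ otherwise. $g_k=\nabla f(x_k)$, $H_k=\nabla^2 f(x_k)$; $\|\cdot\|$ is the 2-norm; $\mathrm{sgn}(z)=1$ if $z\ge0$ and $-1$ otherwise. **Assumptions.** (i) The level set $\mathcal L_f(x_0)=\{x\in\Omega\mid f(x)\le f(x_0)\}$ is compact. (ii) $f$ is twice Lipschitz continuously differentiable on an open convex set containing $\mathcal L_f(x_0)$ and all trial points generated by PNCG; $L_f,L_g,L_H>0$ are Lipschitz constants of $f,\nabla f,\nabla^2 f$ on this set. **$(\epsilon,p)$-2o point.** $x$ is an $(\epsilon,p)$-2o point if $x\in\Omega$ and, with $J^+=\{i\in\mathcal I\mid 0\le x^i\le\sqrt\epsilon\}$, $J^-=\{1,\dots,n\}\setminus J^+$, $S=\mathrm{diag}(s)$, $s^i=1$ for $i\in J^-$, $s^i=x^i$ for $i\in J^+$: $\|S\nabla f(x)\|\le2\epsilon$, $\nabla_if(x)\ge-\epsilon^{3/4}$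 for all $i\in J^+$, and $S\nabla^2f(x)S\succeq-\epsilon^pI$. **Algorithm PNCG.** Inputs: $x_0\ge0$, $\epsilon_g>0$, scalars $\epsilon_k\in(0,1)$, $\theta\in(0,1)$, $\zeta\in(0,1)$, $\eta\in(0,\frac{1-\zeta}2)$. At iteration $k$ let $J_k^+=\{i\in\mathcal I\mid0\le x_k^i\le\epsilon_k\}$, $J_k^-=\{1,\dots,n\}\setminus J_k^+$; let $g_k^\pm,d_k^\pm$ be the subvectors of $g_k,d_k$ and $H_k^\pm$ the square submatrices of $H_k$ indexed by $J_k^\pm$; let $S_k=\mathrm{diag}(s_k)$ with $s_k^i=x_k^i$ for $i\in J_k^+$, $s_k^i=1$ for $i\in J_k^-$, and $S_k^+$ its $J_k^+$ submatrix. (1) *Gradient projection step.* If $J_k^+\ne\emptyset$ and ($g_k^i<-\epsilon_k^{3/2}$ for some $i\in J_k^+$ or $\|S_k^+g_k^+\|>\epsilon_k^2$): set $d_k=-g_k$, let $\tilde m_k$ be the smallest nonnegative integer $m$ with $f(P(x_k+\theta^md_k))<f(x_k)-\frac12(x_k-P(x_k+\theta^md_k))^Tg_k$, and set $x_{k+1}=P(x_k+\theta^{\tilde m_k}d_k)$. (2) *Newton-CG step.* Else if $J_k^-\ne\emptyset$ and $\|g_k^-\|>\epsilon_g$: call Capped CG (below) with $H=H_k^-$, $g=g_k^-$, $\epsilon=\epsilon_k$, $\zeta$, and an upper bound $M$ on the Hessian norm if provided, obtaining $t$ and a type. If the type is NC, set $d_k^-=-\mathrm{sgn}(t^Tg_k^-)\frac{|t^TH_k^-t|}{\|t\|^2}\frac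 t{\|t\|}$; if SOL, set $d_k^-=t$. Set $d_k^+=0$. Let $m_k$ be the smallest nonnegative integer $m$ with $f(P(x_k+\theta^md_k))<f(x_k)-\eta\theta^{2m}\epsilon_k\|d_k\|^2$; set $\alpha_k=\theta^{m_k}$, $x_{k+1}=P(x_k+\alpha_kd_k)$. (3) *Otherwise:* call the minimum eigenvalue oracle (MEO) with $H=S_kH_kS_k$, $\epsilon=\epsilon_k$. If it certifies $S_kH_kS_k\succeq-\epsilon_kI$, stop and output $x_k$. Otherwise it returns a direction $d$; set $d_k=-\mathrm{sgn}(g_k^TS_kd)\,|d^TS_kH_kS_kd|\,d$, let $\bar m_k$ be the smallest nonnegative integer $m$ with $f(P(x_k+\theta^mS_kd_k))<f(x_k)-\eta\theta^{2m}\|d_k\|^3$, and set $x_{k+1}=P(x_k+\theta^{\bar m_k}S_kd_k)$. **MEO.** Given symmetric $H$, $\epsilon>0$ and $\delta\in[0,1)$, it returns either a unit vector $v$ with $v^THv\le-\epsilon/2$, or a certificate that $\lambda_{\min}(H)\ge-\epsilon$. The probability that a certificate is issued although $\lambda_{\min}(H)<-\epsilon$ is at most $\delta$ (at each call, conditionally on the history of the algorithm). **Capped CG.** Inputs: symmetric $H$, $g\ne0$, $\epsilon\in(0,1)$, $\zeta\in(0,1)$, $M$ ($M=0$ if not provided). Let $\bar H=H+2\epsilon I$, $\kappa=\frac{M+2\epsilon}\epsilon$, $\hat\zeta=\frac\zeta{3\kappa}$, $\tau=\frac{\sqrt\kappa}{\sqrt\kappa+1}$, $T=\frac{4\kappa^4}{(1-\sqrt\tau)^2}$;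 whenever $M$ changes, $\kappa,\hat\zeta,\tau,T$ are recomputed. Set $y_0=0$, $r_0=g$, $p_0=-g$, $j=0$. If $p_0^T\bar Hp_0<\epsilon\|p_0\|^2$, return $t=p_0$, type NC; else if $\|Hp_0\|>M\|p_0\|$ set $M=\|Hp_0\|/\|p_0\|$. Then repeat: $\alpha_j=r_j^Tr_j/p_j^T\bar Hp_j$, $y_{j+1}=y_j+\alpha_jp_j$, $r_{j+1}=r_j+\alpha_j\bar Hp_j$, $\beta_{j+1}=r_{j+1}^Tr_{j+1}/r_j^Tr_j$, $p_{j+1}=-r_{j+1}+\beta_{j+1}p_j$, $j\leftarrow j+1$; if $M<\max(\|Hp_j\|/\|p_j\|,\|Hy_j\|/\|y_j\|,\|Hr_j\|/\|r_j\|)$ set $M$ to this maximum; then apply the first applicable rule: if $y_j^T\bar Hy_j<\epsilon\|y_j\|^2$ return $t=y_j$, NC; else if $\|r_j\|\le\hat\zeta\|r_0\|$ return $t=y_j$, SOL; else if $p_j^T\bar Hp_j<\epsilon\|p_j\|^2$ return $t=p_j$, NC; else if $\|r_j\|>\sqrt T\tau^{j/2}\|r_0\|$, compute $\alpha_j=r_j^Tr_j/p_j^T\bar Hp_j$ and $y_{j+1}=y_j+\alpha_jp_j$, find $i\in\{0,\dots,j-1\}$ with $(y_{j+1}-y_i)^T\bar H(y_{j+1}-y_i)<\epsilon\|y_{j+1}-y_i\|^2$ (it is known that such $i$ exists) and return $t=y_{j+1}-y_i$, NC; otherwise continue. The constant in $O(\epsilon^{-3/2})$ depends only on $f(x_0)-f_{\rm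 low},L_g,L_H,\theta,\zeta,\eta$. *)

theory Defs
  imports "HOL-Probability.Probability"
begin

section \<open>Calculus and matrices\<close>

definition grad :: "(real ^ 'n \<Rightarrow> real) \<Rightarrow> real ^ 'n \<Rightarrow> real ^ 'n" where
  "grad f x = (\<chi> i. frechet_derivative f (at x) (axis i 1))"

definition hess :: "(real ^ 'n \<Rightarrow> real) \<Rightarrow> real ^ 'n \<Rightarrow> real ^ 'n ^ 'n" where
  "hess f x = jacobian (grad f) (at x)"

definition twice_cont_diff :: "(real ^ 'n \<Rightarrow> real) \<Rightarrow> bool" where
  "twice_cont_diff f \<longleftrightarrow>
     (\<forall>x. f differentiable (at x)) \<and> (\<forall>x. grad f differentiable (at x)) \<and>
     continuous_on UNIV (hess f)"

text \<open>The matrix norm is the operator norm induced by the 2-norm; \<open>norm\<close> on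
  \<open>real ^ 'n ^ 'n\<close> would be the Frobenius norm.\<close>

definition op_norm :: "real ^ 'n ^ 'n \<Rightarrow> real" where
  "op_norm A = onorm (\<lambda>v. A *v v)"

definition quad :: "real ^ 'n ^ 'n \<Rightarrow> real ^ 'n \<Rightarrow> real" where
  "quad A v = v \<bullet> (A *v v)"

definition loewner_ge :: "real ^ 'n ^ 'n \<Rightarrow> real ^ 'n ^ 'n \<Rightarrow> bool" where
  "loewner_ge A B \<longleftrightarrow> (\<forall>v. 0 \<le> quad (A - B) v)"

text \<open>Only meaningful for matrices whose set of real eigenvalues has a least element,
  in particular for symmetric ones.\<close>

definition lambda_min :: "real ^ 'n ^ 'n \<Rightarrow> real" where
  "lambda_min A = (LEAST l. \<exists>v. v \<noteq> 0 \<and> A *v v = l *\<^sub>R v)"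

definition diag_mat :: "real ^ 'n \<Rightarrow> real ^ 'n ^ 'n" where
  "diag_mat s = (\<chi> i j. if i = j then s $ i else 0)"

text \<open>The subvector \<open>v\<^sub>J\<close> and the principal submatrix \<open>A\<^sub>J\<^sub>J\<close> are represented by padding with
  zeros. All norms, inner products and matrix-vector products of vectors supported on \<open>J\<close> agree
  with those of the unpadded objects. Capped CG below, started with padded data, only forms
  vectors supported on \<open>J\<close>, so it performs exactly the computation on the subproblem.\<close>

definition subvec :: "'n set \<Rightarrow> real ^ 'n \<Rightarrow> real ^ 'n" where
  "subvec J v = (\<chi> i. if i \<in> J then v $ i else 0)"

definition submat :: "'n set \<Rightarrow> real ^ 'n ^ 'n \<Rightarrow> real ^ 'n ^ 'n" where
  "submat J A = (\<chi> i j. if i \<in> J \<and> j \<in> J then A $ i $ j else 0)"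

definition sgn1 :: "real \<Rightarrow> real" where
  "sgn1 z = (if z \<ge> 0 then 1 else - 1)"

section \<open>The bound-constrained problem\<close>

definition feas :: "'n set \<Rightarrow> (real ^ 'n) set" where
  "feas I = {x. \<forall>i\<in>I. 0 \<le> x $ i}"

definition proj :: "'n set \<Rightarrow> real ^ 'n \<Rightarrow> real ^ 'n" where
  "proj I z = (\<chi> i. if i \<in> I then max (z $ i) 0 else z $ i)"

definition level_set :: "(real ^ 'n \<Rightarrow> real) \<Rightarrow> 'n set \<Rightarrow> real ^ 'n \<Rightarrow> (real ^ 'n) set" where
  "level_set f I x0 = {x \<in> feas I. f x \<le> f x0}"

definition Jplus :: "'n set \<Rightarrow> real \<Rightarrow> real ^ 'n \<Rightarrow> 'n set" where
  "Jplus I e x = {i \<in> I. 0 \<le> x $ i \<and> x $ i \<le> e}"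

definition Jminus :: "'n set \<Rightarrow> real \<Rightarrow> real ^ 'n \<Rightarrow> 'n set" where
  "Jminus I e x = - Jplus I e x"

definition Smat :: "'n set \<Rightarrow> real \<Rightarrow> real ^ 'n \<Rightarrow> real ^ 'n ^ 'n" where
  "Smat I e x = diag_mat (\<chi> i. if i \<in> Jplus I e x then x $ i else 1)"

definition scaled_hess :: "(real ^ 'n \<Rightarrow> real) \<Rightarrow> 'n set \<Rightarrow> real \<Rightarrow> real ^ 'n \<Rightarrow> real ^ 'n ^ 'n" where
  "scaled_hess f I e x = Smat I e x ** hess f x ** Smat I e x"

definition so_point ::
  "(real ^ 'n \<Rightarrow> real) \<Rightarrow> 'n set \<Rightarrow> real \<Rightarrow> real \<Rightarrow> real ^ 'n \<Rightarrow> bool" where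
  "so_point f I \<epsilon> p x \<longleftrightarrow>
     x \<in> feas I \<and>
     norm (Smat I (sqrt \<epsilon>) x *v grad f x) \<le> 2 * \<epsilon> \<and>
     (\<forall>i \<in> Jplus I (sqrt \<epsilon>) x. grad f x $ i \<ge> - (\<epsilon> powr (3/4))) \<and>
     loewner_ge (scaled_hess f I (sqrt \<epsilon>) x) (- (\<epsilon> powr p) *\<^sub>R mat 1)"

section \<open>Capped CG\<close>

datatype cg_type = NC | SOL

record 'n cg_state =
  cgM :: real
  cgy :: "real ^ 'n"
  cgr :: "real ^ 'n"
  cgp :: "real ^ 'n"

definition Hbar :: "real ^ 'n ^ 'n \<Rightarrow> real \<Rightarrow> real ^ 'n ^ 'n" where
  "Hbar H \<epsilon> = H + (2 * \<epsilon>) *\<^sub>R mat 1"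

definition cg_alpha :: "real ^ 'n ^ 'n \<Rightarrow> real \<Rightarrow> 'n cg_state \<Rightarrow> real" where
  "cg_alpha H \<epsilon> s = (cgr s \<bullet> cgr s) / quad (Hbar H \<epsilon>) (cgp s)"

definition cg_next_y :: "real ^ 'n ^ 'n \<Rightarrow> real \<Rightarrow> 'n cg_state \<Rightarrow> real ^ 'n" where
  "cg_next_y H \<epsilon> s = cgy s + cg_alpha H \<epsilon> s *\<^sub>R cgp s"

text \<open>\<open>cg_iter H g \<epsilon> M j\<close> is the state \<open>(M, y\<^sub>j, r\<^sub>j, p\<^sub>j)\<close> after the updates of \<open>M\<close> in
  iteration \<open>j\<close>, computed without regard to the termination tests. The quantities depending on
  \<open>M\<close> are always evaluated at the current \<open>cgM\<close>.\<close>

primrec cg_iter :: "real ^ 'n ^ 'n \<Rightarrow> real ^ 'n \<Rightarrow> real \<Rightarrow> real \<Rightarrow> nat \<Rightarrow> 'n cg_state" where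
  "cg_iter H g \<epsilon> M 0 =
     \<lparr> cgM = (if norm (H *v (- g)) > M * norm (- g) then norm (H *v (- g)) / norm (- g) else M),
       cgy = 0, cgr = g, cgp = - g \<rparr>"
| "cg_iter H g \<epsilon> M (Suc j) =
     (let s = cg_iter H g \<epsilon> M j;
          y = cg_next_y H \<epsilon> s;
          r = cgr s + cg_alpha H \<epsilon> s *\<^sub>R (Hbar H \<epsilon> *v cgp s);
          \<beta> = (r \<bullet> r) / (cgr s \<bullet> cgr s);
          p = - r + \<beta> *\<^sub>R cgp s;
          m = Max {norm (H *v p) / norm p, norm (H *v y) / norm y, norm (H *v r) / norm r}
      in \<lparr> cgM = (if cgM s < m then m else cgM s), cgy = y, cgr = r, cgp = p \<rparr>)"

definition cg_kappa :: "real \<Rightarrow> real \<Rightarrow> real" where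
  "cg_kappa \<epsilon> M = (M + 2 * \<epsilon>) / \<epsilon>"

definition cg_zeta_hat :: "real \<Rightarrow> real \<Rightarrow> real \<Rightarrow> real" where
  "cg_zeta_hat \<epsilon> \<zeta> M = \<zeta> / (3 * cg_kappa \<epsilon> M)"

definition cg_tau :: "real \<Rightarrow> real \<Rightarrow> real" where
  "cg_tau \<epsilon> M = sqrt (cg_kappa \<epsilon> M) / (sqrt (cg_kappa \<epsilon> M) + 1)"

definition cg_T :: "real \<Rightarrow> real \<Rightarrow> real" where
  "cg_T \<epsilon> M = 4 * cg_kappa \<epsilon> M ^ 4 / (1 - sqrt (cg_tau \<epsilon> M))\<^sup>2"

definition neg_curv :: "real ^ 'n ^ 'n \<Rightarrow> real \<Rightarrow> real ^ 'n \<Rightarrow> bool" where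
  "neg_curv H \<epsilon> v \<longleftrightarrow> quad (Hbar H \<epsilon>) v < \<epsilon> * (norm v)\<^sup>2"

definition cg_solved :: "real ^ 'n \<Rightarrow> real \<Rightarrow> real \<Rightarrow> 'n cg_state \<Rightarrow> bool" where
  "cg_solved g \<epsilon> \<zeta> s \<longleftrightarrow> norm (cgr s) \<le> cg_zeta_hat \<epsilon> \<zeta> (cgM s) * norm g"

definition cg_slow :: "real ^ 'n \<Rightarrow> real \<Rightarrow> 'n cg_state \<Rightarrow> nat \<Rightarrow> bool" where
  "cg_slow g \<epsilon> s j \<longleftrightarrow>
     norm (cgr s) > sqrt (cg_T \<epsilon> (cgM s)) * cg_tau \<epsilon> (cgM s) powr (real j / 2) * norm g"

definition cg_reaches ::
  "real ^ 'n ^ 'n \<Rightarrow> real ^ 'n \<Rightarrow> real \<Rightarrow> real \<Rightarrow> real \<Rightarrow> nat \<Rightarrow> bool" where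
  "cg_reaches H g \<epsilon> \<zeta> M j \<longleftrightarrow>
     j \<ge> 1 \<and> \<not> neg_curv H \<epsilon> (- g) \<and>
     (\<forall>i. 1 \<le> i \<and> i < j \<longrightarrow>
        (let s = cg_iter H g \<epsilon> M i in
           \<not> neg_curv H \<epsilon> (cgy s) \<and> \<not> cg_solved g \<epsilon> \<zeta> s \<and>
           \<not> neg_curv H \<epsilon> (cgp s) \<and> \<not> cg_slow g \<epsilon> s i))"

text \<open>\<open>capped_cg H g \<epsilon> \<zeta> M t ty\<close>: the call may return direction \<open>t\<close> with type \<open>ty\<close>. The only
  freedom is the choice of the index \<open>i\<close> in the last rule.\<close>

inductive capped_cg ::
  "real ^ 'n ^ 'n \<Rightarrow> real ^ 'n \<Rightarrow> real \<Rightarrow> real \<Rightarrow> real \<Rightarrow> real ^ 'n \<Rightarrow> cg_type \<Rightarrow> bool"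
  for H :: "real ^ 'n ^ 'n" and g :: "real ^ 'n" and \<epsilon> \<zeta> M :: real
where
  start_nc: "neg_curv H \<epsilon> (- g) \<Longrightarrow> capped_cg H g \<epsilon> \<zeta> M (- g) NC"
| y_nc: "cg_reaches H g \<epsilon> \<zeta> M j \<Longrightarrow> s = cg_iter H g \<epsilon> M j \<Longrightarrow>
    neg_curv H \<epsilon> (cgy s) \<Longrightarrow> capped_cg H g \<epsilon> \<zeta> M (cgy s) NC"
| y_sol: "cg_reaches H g \<epsilon> \<zeta> M j \<Longrightarrow> s = cg_iter H g \<epsilon> M j \<Longrightarrow>
    \<not> neg_curv H \<epsilon> (cgy s) \<Longrightarrow> cg_solved g \<epsilon> \<zeta> s \<Longrightarrow> capped_cg H g \<epsilon> \<zeta> M (cgy s) SOL"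
| p_nc: "cg_reaches H g \<epsilon> \<zeta> M j \<Longrightarrow> s = cg_iter H g \<epsilon> M j \<Longrightarrow>
    \<not> neg_curv H \<epsilon> (cgy s) \<Longrightarrow> \<not> cg_solved g \<epsilon> \<zeta> s \<Longrightarrow>
    neg_curv H \<epsilon> (cgp s) \<Longrightarrow> capped_cg H g \<epsilon> \<zeta> M (cgp s) NC"
| slow_nc: "cg_reaches H g \<epsilon> \<zeta> M j \<Longrightarrow> s = cg_iter H g \<epsilon> M j \<Longrightarrow>
    \<not> neg_curv H \<epsilon> (cgy s) \<Longrightarrow> \<not> cg_solved g \<epsilon> \<zeta> s \<Longrightarrow>
    \<not> neg_curv H \<epsilon> (cgp s) \<Longrightarrow> cg_slow g \<epsilon> s j \<Longrightarrow>
    i < j \<Longrightarrow> t = cg_next_y H \<epsilon> s - cgy (cg_iter H g \<epsilon> M i) \<Longrightarrow>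
    neg_curv H \<epsilon> t \<Longrightarrow> capped_cg H g \<epsilon> \<zeta> M t NC"

section \<open>PNCG\<close>

definition gp_case :: "(real ^ 'n \<Rightarrow> real) \<Rightarrow> 'n set \<Rightarrow> real \<Rightarrow> real ^ 'n \<Rightarrow> bool" where
  "gp_case f I e x \<longleftrightarrow>
     Jplus I e x \<noteq> {} \<and>
     ((\<exists>i \<in> Jplus I e x. grad f x $ i < - (e powr (3/2))) \<or>
      norm (subvec (Jplus I e x) (Smat I e x *v grad f x)) > e\<^sup>2)"

definition ncg_case :: "(real ^ 'n \<Rightarrow> real) \<Rightarrow> 'n set \<Rightarrow> real \<Rightarrow> real \<Rightarrow> real ^ 'n \<Rightarrow> bool" where
  "ncg_case f I \<epsilon>g e x \<longleftrightarrow>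
     \<not> gp_case f I e x \<and> Jminus I e x \<noteq> {} \<and> norm (subvec (Jminus I e x) (grad f x)) > \<epsilon>g"

definition meo_case :: "(real ^ 'n \<Rightarrow> real) \<Rightarrow> 'n set \<Rightarrow> real \<Rightarrow> real \<Rightarrow> real ^ 'n \<Rightarrow> bool" where
  "meo_case f I \<epsilon>g e x \<longleftrightarrow> \<not> gp_case f I e x \<and> \<not> ncg_case f I \<epsilon>g e x"

definition ncg_dir ::
  "(real ^ 'n \<Rightarrow> real) \<Rightarrow> 'n set \<Rightarrow> real \<Rightarrow> real ^ 'n \<Rightarrow> (real ^ 'n) \<times> cg_type \<Rightarrow> real ^ 'n" where
  "ncg_dir f I e x c =
     (let J = Jminus I e x; t = fst c in
      subvec J (case snd c of
          NC \<Rightarrow> - (sgn1 (t \<bullet> subvec J (grad f x)) *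
                   (\<bar>quad (submat J (hess f x)) t\<bar> / (norm t)\<^sup>2)) *\<^sub>R ((1 / norm t) *\<^sub>R t)
        | SOL \<Rightarrow> t))"

definition meo_dir :: "(real ^ 'n \<Rightarrow> real) \<Rightarrow> 'n set \<Rightarrow> real \<Rightarrow> real ^ 'n \<Rightarrow> real ^ 'n \<Rightarrow> real ^ 'n" where
  "meo_dir f I e x v =
     - (sgn1 (grad f x \<bullet> (Smat I e x *v v)) * \<bar>quad (scaled_hess f I e x) v\<bar>) *\<^sub>R v"

text \<open>In the following, \<open>c\<close> is the result of Capped CG (used only in Newton-CG steps) and \<open>v\<close> the
  direction returned by the eigenvalue oracle (used only in oracle steps). \<open>pncg_move\<close> is the
  direction along which the projected search runs: \<open>d\<close>, or \<open>S d\<close> in oracle steps.\<close>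

definition pncg_dir ::
  "(real ^ 'n \<Rightarrow> real) \<Rightarrow> 'n set \<Rightarrow> real \<Rightarrow> real \<Rightarrow> real ^ 'n \<Rightarrow> (real ^ 'n) \<times> cg_type \<Rightarrow> real ^ 'n
    \<Rightarrow> real ^ 'n" where
  "pncg_dir f I \<epsilon>g e x c v =
     (if gp_case f I e x then - grad f x
      else if ncg_case f I \<epsilon>g e x then ncg_dir f I e x c
      else meo_dir f I e x v)"

definition pncg_move ::
  "(real ^ 'n \<Rightarrow> real) \<Rightarrow> 'n set \<Rightarrow> real \<Rightarrow> real \<Rightarrow> real ^ 'n \<Rightarrow> (real ^ 'n) \<times> cg_type \<Rightarrow> real ^ 'n
    \<Rightarrow> real ^ 'n" where
  "pncg_move f I \<epsilon>g e x c v =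
     (if meo_case f I \<epsilon>g e x then Smat I e x *v pncg_dir f I \<epsilon>g e x c v
      else pncg_dir f I \<epsilon>g e x c v)"

definition pncg_trial ::
  "(real ^ 'n \<Rightarrow> real) \<Rightarrow> 'n set \<Rightarrow> real \<Rightarrow> real \<Rightarrow> real \<Rightarrow> real ^ 'n \<Rightarrow> (real ^ 'n) \<times> cg_type
    \<Rightarrow> real ^ 'n \<Rightarrow> nat \<Rightarrow> real ^ 'n" where
  "pncg_trial f I \<epsilon>g e \<theta> x c v m = proj I (x + \<theta> ^ m *\<^sub>R pncg_move f I \<epsilon>g e x c v)"

definition pncg_accept ::
  "(real ^ 'n \<Rightarrow> real) \<Rightarrow> 'n set \<Rightarrow> real \<Rightarrow> real \<Rightarrow> real \<Rightarrow> real \<Rightarrow> real ^ 'n \<Rightarrow> (real ^ 'n) \<times> cg_type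
    \<Rightarrow> real ^ 'n \<Rightarrow> nat \<Rightarrow> bool" where
  "pncg_accept f I \<epsilon>g e \<theta> \<eta> x c v m \<longleftrightarrow>
     (let z = pncg_trial f I \<epsilon>g e \<theta> x c v m; d = pncg_dir f I \<epsilon>g e x c v in
      if gp_case f I e x then f z < f x - 1/2 * ((x - z) \<bullet> grad f x)
      else if ncg_case f I \<epsilon>g e x then f z < f x - \<eta> * \<theta> ^ (2 * m) * e * (norm d)\<^sup>2
      else f z < f x - \<eta> * \<theta> ^ (2 * m) * norm d ^ 3)"

text \<open>If no exponent is acceptable, \<open>LEAST\<close> yields an arbitrary number, so termination of the
  line search is not presupposed.\<close>

definition pncg_exponent ::
  "(real ^ 'n \<Rightarrow> real) \<Rightarrow> 'n set \<Rightarrow> real \<Rightarrow> real \<Rightarrow> real \<Rightarrow> real \<Rightarrow> real ^ 'n \<Rightarrow> (real ^ 'n) \<times> cg_type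
    \<Rightarrow> real ^ 'n \<Rightarrow> nat" where
  "pncg_exponent f I \<epsilon>g e \<theta> \<eta> x c v = (LEAST m. pncg_accept f I \<epsilon>g e \<theta> \<eta> x c v m)"

text \<open>A run consists of the iterates \<open>x k\<close>, the results \<open>c k\<close> of Capped CG, the bounds \<open>Mb k\<close>
  handed to Capped CG, and the oracle replies \<open>a k\<close>, where \<open>None\<close> is a certificate. Entries with
  no role in iteration \<open>k\<close> are irrelevant.\<close>

definition pncg_stops ::
  "(real ^ 'n \<Rightarrow> real) \<Rightarrow> 'n set \<Rightarrow> real \<Rightarrow> (nat \<Rightarrow> real) \<Rightarrow> (nat \<Rightarrow> real ^ 'n)
    \<Rightarrow> (nat \<Rightarrow> (real ^ 'n) option) \<Rightarrow> nat \<Rightarrow> bool" where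
  "pncg_stops f I \<epsilon>g \<epsilon> x a k \<longleftrightarrow>
     meo_case f I \<epsilon>g (\<epsilon> k) (x k) \<and> a k = None \<and>
     (\<forall>j<k. \<not> (meo_case f I \<epsilon>g (\<epsilon> j) (x j) \<and> a j = None))"

definition pncg_reaches ::
  "(real ^ 'n \<Rightarrow> real) \<Rightarrow> 'n set \<Rightarrow> real \<Rightarrow> (nat \<Rightarrow> real) \<Rightarrow> (nat \<Rightarrow> real ^ 'n)
    \<Rightarrow> (nat \<Rightarrow> (real ^ 'n) option) \<Rightarrow> nat \<Rightarrow> bool" where
  "pncg_reaches f I \<epsilon>g \<epsilon> x a k \<longleftrightarrow> (\<forall>j<k. \<not> pncg_stops f I \<epsilon>g \<epsilon> x a j)"

text \<open>The result of Capped CG is constrained only if the call can return at all, so its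
  termination is not presupposed either. \<open>Mb k = 0\<close> means that no bound is provided.\<close>

definition pncg_run ::
  "(real ^ 'n \<Rightarrow> real) \<Rightarrow> 'n set \<Rightarrow> real \<Rightarrow> (nat \<Rightarrow> real) \<Rightarrow> real \<Rightarrow> real \<Rightarrow> real \<Rightarrow> real ^ 'n
    \<Rightarrow> (nat \<Rightarrow> real ^ 'n) \<Rightarrow> (nat \<Rightarrow> real) \<Rightarrow> (nat \<Rightarrow> (real ^ 'n) \<times> cg_type)
    \<Rightarrow> (nat \<Rightarrow> (real ^ 'n) option) \<Rightarrow> bool" where
  "pncg_run f I \<epsilon>g \<epsilon> \<theta> \<zeta> \<eta> x0 x Mb c a \<longleftrightarrow>
     x 0 = x0 \<and>
     (\<forall>k. pncg_reaches f I \<epsilon>g \<epsilon> x a k \<longrightarrow>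
        (ncg_case f I \<epsilon>g (\<epsilon> k) (x k) \<longrightarrow>
           (let J = Jminus I (\<epsilon> k) (x k);
                H = submat J (hess f (x k));
                g = subvec J (grad f (x k))
            in (Mb k = 0 \<or> op_norm H \<le> Mb k) \<and>
               ((\<exists>t ty. capped_cg H g (\<epsilon> k) \<zeta> (Mb k) t ty) \<longrightarrow>
                  capped_cg H g (\<epsilon> k) \<zeta> (Mb k) (fst (c k)) (snd (c k))))) \<and>
        (meo_case f I \<epsilon>g (\<epsilon> k) (x k) \<longrightarrow>
           (\<forall>v. a k = Some v \<longrightarrow>
              norm v = 1 \<and> quad (scaled_hess f I (\<epsilon> k) (x k)) v \<le> - \<epsilon> k / 2)) \<and>
        (\<not> pncg_stops f I \<epsilon>g \<epsilon> x a k \<longrightarrow>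
           x (Suc k) = pncg_trial f I \<epsilon>g (\<epsilon> k) \<theta> (x k) (c k) (the (a k))
                         (pncg_exponent f I \<epsilon>g (\<epsilon> k) \<theta> \<eta> (x k) (c k) (the (a k)))))"

text \<open>All points at which a line search tests its acceptance condition.\<close>

definition pncg_trial_points ::
  "(real ^ 'n \<Rightarrow> real) \<Rightarrow> 'n set \<Rightarrow> real \<Rightarrow> (nat \<Rightarrow> real) \<Rightarrow> real \<Rightarrow> real
    \<Rightarrow> (nat \<Rightarrow> real ^ 'n) \<Rightarrow> (nat \<Rightarrow> (real ^ 'n) \<times> cg_type) \<Rightarrow> (nat \<Rightarrow> (real ^ 'n) option)
    \<Rightarrow> (real ^ 'n) set" where
  "pncg_trial_points f I \<epsilon>g \<epsilon> \<theta> \<eta> x c a =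
     {pncg_trial f I \<epsilon>g (\<epsilon> k) \<theta> (x k) (c k) (the (a k)) m | k m.
        pncg_reaches f I \<epsilon>g \<epsilon> x a k \<and> \<not> pncg_stops f I \<epsilon>g \<epsilon> x a k \<and>
        m \<le> pncg_exponent f I \<epsilon>g (\<epsilon> k) \<theta> \<eta> (x k) (c k) (the (a k))}"

definition meo_fails ::
  "(real ^ 'n \<Rightarrow> real) \<Rightarrow> 'n set \<Rightarrow> real \<Rightarrow> (nat \<Rightarrow> real) \<Rightarrow> (nat \<Rightarrow> real ^ 'n)
    \<Rightarrow> (nat \<Rightarrow> (real ^ 'n) option) \<Rightarrow> nat \<Rightarrow> bool" where
  "meo_fails f I \<epsilon>g \<epsilon> x a k \<longleftrightarrow>
     pncg_reaches f I \<epsilon>g \<epsilon> x a k \<and> meo_case f I \<epsilon>g (\<epsilon> k) (x k) \<and>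
     a k = None \<and> lambda_min (scaled_hess f I (\<epsilon> k) (x k)) < - \<epsilon> k"

text \<open>\<open>F k\<close> contains the history of the algorithm before the oracle call in iteration \<open>k\<close>. It may
  be any filtration with respect to which the iterates and the occurrence of certificates are
  observable.\<close>

definition pncg_random_run ::
  "'w measure \<Rightarrow> (nat \<Rightarrow> 'w measure) \<Rightarrow> real
    \<Rightarrow> (real ^ 'n \<Rightarrow> real) \<Rightarrow> 'n set \<Rightarrow> real \<Rightarrow> (nat \<Rightarrow> real) \<Rightarrow> real \<Rightarrow> real \<Rightarrow> real \<Rightarrow> real ^ 'n
    \<Rightarrow> ('w \<Rightarrow> nat \<Rightarrow> real ^ 'n) \<Rightarrow> ('w \<Rightarrow> nat \<Rightarrow> real) \<Rightarrow> ('w \<Rightarrow> nat \<Rightarrow> (real ^ 'n) \<times> cg_type)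
    \<Rightarrow> ('w \<Rightarrow> nat \<Rightarrow> (real ^ 'n) option) \<Rightarrow> bool" where
  "pncg_random_run P F \<delta> f I \<epsilon>g \<epsilon> \<theta> \<zeta> \<eta> x0 X Mb C A \<longleftrightarrow>
     prob_space P \<and> filtration (space P) F \<and> (\<forall>k. subalgebra P (F k)) \<and>
     (\<forall>k. (\<lambda>\<omega>. X \<omega> k) \<in> borel_measurable (F k)) \<and>
     (\<forall>k. {\<omega> \<in> space P. A \<omega> k = None} \<in> sets (F (Suc k))) \<and>
     (\<forall>\<omega> \<in> space P. pncg_run f I \<epsilon>g \<epsilon> \<theta> \<zeta> \<eta> x0 (X \<omega>) (Mb \<omega>) (C \<omega>) (A \<omega>)) \<and>
     (\<forall>k. AE \<omega> in P. real_cond_exp P (F k)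
        (indicator {\<omega>' \<in> space P. meo_fails f I \<epsilon>g \<epsilon> (X \<omega>') (A \<omega>') k}) \<omega> \<le> \<delta>)"

section \<open>The iteration bound\<close>

definition c_nc :: "real \<Rightarrow> real \<Rightarrow> real \<Rightarrow> real" where
  "c_nc L\<^sub>H \<theta> \<eta> = \<eta> * min ((3 - 6 * \<eta>)\<^sup>2 * \<theta>\<^sup>2 / L\<^sub>H\<^sup>2) (\<theta>\<^sup>2)"

definition c_sol :: "real \<Rightarrow> real \<Rightarrow> real \<Rightarrow> real \<Rightarrow> real" where
  "c_sol L\<^sub>H \<theta> \<zeta> \<eta> =
     \<eta> * Min {4 / (25 + 8 * L\<^sub>H), \<theta>\<^sup>2, 9 * (1 - \<zeta> - 2 * \<eta>)\<^sup>2 * \<theta>\<^sup>2 / L\<^sub>H\<^sup>2,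
              (1 - \<zeta>)\<^sup>2 * \<theta>\<^sup>2 / (L\<^sub>H / 3 + 2 * \<eta>)\<^sup>2}"

text \<open>\<open>\<Delta>\<close> stands for \<open>f x0 - f_low\<close>.\<close>

definition K_pncg :: "real \<Rightarrow> real \<Rightarrow> real \<Rightarrow> real \<Rightarrow> real \<Rightarrow> real \<Rightarrow> real \<Rightarrow> real \<Rightarrow> nat" where
  "K_pncg \<Delta> L\<^sub>g L\<^sub>H \<theta> \<zeta> \<eta> \<epsilon>g \<epsilon>H =
     nat \<lfloor>16 * \<Delta> / Min {c_nc L\<^sub>H \<theta> \<eta>, 8 * c_sol L\<^sub>H \<theta> \<zeta> \<eta>, 2 * \<theta> / L\<^sub>g, \<eta>}
            * max (\<epsilon>H / \<epsilon>g\<^sup>2) (1 / \<epsilon>H ^ 3)\<rfloor> + 2"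

end

theory Submission
  imports Defs
begin

text \<open>
  No iteration increases \<open>f\<close>, and two consecutive ones that do not stop together decrease it by
  at least the fixed amount \<open>progress\<close>. Since \<open>f\<close> is bounded below on the feasible set,
  \<open>run_terminates\<close> bounds the number of iterations by counting pairs.

  The decrease comes from Taylor bounds. If a trial step is rejected, the quadratic or cubic upper
  model of \<open>f\<close> forces its length to be at least an explicit constant, so the accepted length is 1
  or at least \<open>\<theta>\<close> times that constant. In the Newton-CG and eigenvector steps the projection is
  the identity on steps of length at most \<open>e\<close>, because the components that are close to a bound
  are frozen, or scaled by their distance to it. The three kinds of steps are treated in
  \<open>gp_step\<close>, \<open>meo_step\<close>, and \<open>ncg_nc_step\<close> together with \<open>ncg_sol_step\<close>. The single case
  without a fixed decrease is a short accepted full Newton step; then the reduced gradient at the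
  new point is small, so the following iteration is not a Newton-CG step and makes the progress
  instead. This is why pairs of iterations are counted.

  The Newton-CG step needs that Capped CG returns at all, in particular that slow decay of the
  residual exhibits negative curvature. Suppose all differences between the next iterate and
  earlier ones had curvature at least \<open>e\<close>. Then Nesterov's estimate sequence, applied to the CG
  iterates and tested only at that next iterate, gives the accelerated linear rate and
  contradicts slowness (\<open>estimate_sequence\<close>, \<open>residual_linear_convergence\<close>). If no test ever
  succeeded, nonzero orthogonal residuals would accumulate beyond the dimension
  (\<open>capped_cg_returns\<close>).

  At the stopping point the first-order conditions are just the failure of the tests for the two
  other kinds of steps. The second-order condition can fail only if some oracle call issues a wrong
  certificate. Conditioning on the history before each call, the first \<open>k\<close> iterations are free
  of wrong certificates with probability at least \<open>(1 - \<delta>) ^ k\<close>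
  (\<open>prob_no_conditional_failure\<close>). This needs the failure events to be measurable, and needs the
  smallest eigenvalue of the symmetric matrix \<open>S H S\<close> to detect violations of the semidefinite
  inequality (\<open>lambda_min_less_iff\<close>).
\<close>

section \<open>Taylor bounds and symmetry of the Hessian\<close>

lemma twice_cont_diff_has_derivative:
  assumes "twice_cont_diff f"
  shows "(f has_derivative (\<lambda>h. grad f x \<bullet> h)) (at x)"
proof -
  let ?D = "frechet_derivative f (at x)"
  have D: "(f has_derivative ?D) (at x)"
    using assms frechet_derivative_works[of f "at x"] unfolding twice_cont_diff_def by blast
  then have "linear ?D"
    by (rule has_derivative_linear)
  have "?D h = grad f x \<bullet> h" for h
  proof -
    have "(\<Sum>i\<in>UNIV. h $ i *\<^sub>R axis i 1) = h"
      using basis_expansion[of h] by (simp add: scalar_mult_eq_scaleR)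
    then have "?D h = ?D (\<Sum>i\<in>UNIV. h $ i *\<^sub>R axis i 1)" by simp
    also have "\<dots> = (\<Sum>i\<in>UNIV. h $ i * ?D (axis i 1))"
      using \<open>linear ?D\<close> by (simp add: linear_sum linear_cmul)
    also have "\<dots> = grad f x \<bullet> h" by (simp add: grad_def inner_vec_def mult.commute)
    finally show ?thesis .
  qed
  then have "?D = (\<lambda>h. grad f x \<bullet> h)" by (rule ext)
  then show ?thesis using D by metis
qed

lemma twice_cont_diff_has_derivative_grad:
  assumes "twice_cont_diff f"
  shows "(grad f has_derivative (\<lambda>h. hess f x *v h)) (at x)"
  using assms jacobian_works[of "grad f" "at x"] unfolding twice_cont_diff_def hess_def by blast

lemma DERIV_along_line:
  assumes "twice_cont_diff f"
  shows "((\<lambda>t. f (x + t *\<^sub>R d)) has_real_derivative grad f (x + t *\<^sub>R d) \<bullet> d) (at t)"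
  unfolding has_field_derivative_def
  by (rule has_derivative_eq_rhs[OF has_derivative_compose[OF _ twice_cont_diff_has_derivative[OF assms]]])
     (auto intro!: derivative_eq_intros simp: mult.commute)

lemma DERIV_grad_along_line:
  assumes "twice_cont_diff f"
  shows "((\<lambda>t. grad f (x + t *\<^sub>R d) \<bullet> u) has_real_derivative (hess f (x + t *\<^sub>R d) *v d) \<bullet> u) (at t)"
  unfolding has_field_derivative_def
  by (rule has_derivative_eq_rhs[OF has_derivative_inner_left[OF has_derivative_compose[OF _
        twice_cont_diff_has_derivative_grad[OF assms]]]])
     (auto intro!: derivative_eq_intros simp: mult.commute matrix_vector_mult_scaleR)

text \<open>The mean value theorem is used once along \<open>u\<close> for \<open>f\<close> and once along \<open>v\<close> for its gradient. The
  left-hand side is symmetric in \<open>u\<close> and \<open>v\<close> and the right-hand side is not, which is what makes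
  the Hessian symmetric.\<close>

lemma double_difference_mvt:
  assumes f: "twice_cont_diff f" and t: "0 < t"
  shows "\<exists>a b. 0 < a \<and> a < t \<and> 0 < b \<and> b < t \<and>
    f (x + t *\<^sub>R u + t *\<^sub>R v) - f (x + t *\<^sub>R u) - f (x + t *\<^sub>R v) + f x
      = t\<^sup>2 * ((hess f (x + a *\<^sub>R u + b *\<^sub>R v) *v v) \<bullet> u)"
proof -
  let ?p = "\<lambda>s. f ((x + t *\<^sub>R v) + s *\<^sub>R u) - f (x + s *\<^sub>R u)"
  have "\<exists>a. 0 < a \<and> a < t \<and>
      ?p t - ?p 0 = (t - 0) * (grad f ((x + t *\<^sub>R v) + a *\<^sub>R u) \<bullet> u - grad f (x + a *\<^sub>R u) \<bullet> u)"
    by (rule MVT2[OF t]) (intro DERIV_diff DERIV_along_line f)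
  then obtain a where a: "0 < a" "a < t"
    and pa: "?p t - ?p 0 = t * (grad f ((x + t *\<^sub>R v) + a *\<^sub>R u) \<bullet> u - grad f (x + a *\<^sub>R u) \<bullet> u)"
    by auto
  let ?q = "\<lambda>s. grad f ((x + a *\<^sub>R u) + s *\<^sub>R v) \<bullet> u"
  have "\<exists>b. 0 < b \<and> b < t \<and>
      ?q t - ?q 0 = (t - 0) * ((hess f ((x + a *\<^sub>R u) + b *\<^sub>R v) *v v) \<bullet> u)"
    by (rule MVT2[OF t]) (intro DERIV_grad_along_line f)
  then obtain b where b: "0 < b" "b < t"
    and qb: "?q t - ?q 0 = t * ((hess f ((x + a *\<^sub>R u) + b *\<^sub>R v) *v v) \<bullet> u)"
    by auto
  have "?p t - ?p 0 = t\<^sup>2 * ((hess f (x + a *\<^sub>R u + b *\<^sub>R v) *v v) \<bullet> u)"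
    using pa qb by (simp add: power2_eq_square algebra_simps)
  then show ?thesis using a b by (intro exI[of _ a] exI[of _ b]) (simp add: algebra_simps)
qed

text \<open>Both orders of differentiation compute the same double difference, at points
  arbitrarily close to \<open>x\<close>; continuity of the Hessian does the rest.\<close>

lemma hess_symmetric:
  assumes f: "twice_cont_diff f"
  shows "(hess f x *v u) \<bullet> v = u \<bullet> (hess f x *v v)"
proof (rule ccontr)
  let ?h = "\<lambda>u v y. (hess f y *v v) \<bullet> u"
  assume "(hess f x *v u) \<bullet> v \<noteq> u \<bullet> (hess f x *v v)"
  then have neq: "?h u v x \<noteq> ?h v u x" by (simp add: inner_commute)
  \<comment> \<open>half the gap, so that two approximations within \<open>e\<close> cannot coincide\<close>
  define e where "e = \<bar>?h u v x - ?h v u x\<bar> / 2"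
  have e: "0 < e" using neq by (simp add: e_def)
  have cont: "isCont (?h u v) x" for u v
  proof -
    have c: "isCont (hess f) x"
      using f by (simp add: twice_cont_diff_def continuous_on_eq_continuous_at)
    have bl: "bounded_linear (\<lambda>A :: real^'a^'a. A *v v)"
      by (intro linear_conv_bounded_linear[THEN iffD1] linearI)
         (simp_all add: matrix_vector_mult_add_rdistrib scaleR_matrix_vector_assoc)
    have "isCont (\<lambda>y. hess f y *v v) x"
      by (rule bounded_linear.isCont[OF bl c])
    then show ?thesis by (rule isCont_inner) (rule continuous_const)
  qed
  have "\<forall>\<^sub>F y in at x. dist (?h u v y) (?h u v x) < e \<and> dist (?h v u y) (?h v u x) < e"
    using eventually_conj[OF tendstoD[OF cont[of v u, unfolded isCont_def] e]
        tendstoD[OF cont[of u v, unfolded isCont_def] e]] .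
  then obtain r where r: "0 < r"
    and near: "\<And>y. y \<noteq> x \<Longrightarrow> dist y x < r \<Longrightarrow> dist (?h u v y) (?h u v x) < e \<and> dist (?h v u y) (?h v u x) < e"
    unfolding eventually_at by blast
  have near': "dist (?h u v y) (?h u v x) < e \<and> dist (?h v u y) (?h v u x) < e"
    if "dist y x < r" for y
    using near[OF _ that] e by (cases "y = x") simp_all
  define t where "t = r / (norm u + norm v + 1)"
  have pos: "0 < norm u + norm v + 1" by (smt (verit) norm_ge_zero)
  have t: "0 < t" using r pos by (simp add: t_def)
  have small: "norm (a *\<^sub>R u + b *\<^sub>R v) < r" if "0 < a" "a < t" "0 < b" "b < t" for a b
  proof -
    have "norm (a *\<^sub>R u + b *\<^sub>R v) \<le> a * norm u + b * norm v"
      using norm_triangle_ineq[of "a *\<^sub>R u" "b *\<^sub>R v"] that by simp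
    also have "\<dots> \<le> t * norm u + t * norm v" using that by (intro add_mono mult_right_mono) auto
    also have "\<dots> < t * (norm u + norm v + 1)" using t by (simp add: algebra_simps)
    also have "\<dots> = r" using pos by (simp add: t_def)
    finally show ?thesis .
  qed
  obtain a b where 1: "0 < a" "a < t" "0 < b" "b < t"
    "f (x + t *\<^sub>R u + t *\<^sub>R v) - f (x + t *\<^sub>R u) - f (x + t *\<^sub>R v) + f x
      = t\<^sup>2 * (?h u v (x + a *\<^sub>R u + b *\<^sub>R v))"
    using double_difference_mvt[OF f t, of x u v] by auto
  obtain a' b' where 2: "0 < a'" "a' < t" "0 < b'" "b' < t"
    "f (x + t *\<^sub>R v + t *\<^sub>R u) - f (x + t *\<^sub>R v) - f (x + t *\<^sub>R u) + f x
      = t\<^sup>2 * (?h v u (x + a' *\<^sub>R v + b' *\<^sub>R u))"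
    using double_difference_mvt[OF f t, of x v u] by auto
  have eq: "x + t *\<^sub>R v + t *\<^sub>R u = x + t *\<^sub>R u + t *\<^sub>R v" by simp
  have "t\<^sup>2 * ?h u v (x + a *\<^sub>R u + b *\<^sub>R v) = t\<^sup>2 * ?h v u (x + a' *\<^sub>R v + b' *\<^sub>R u)"
    using 1(5) 2(5)[unfolded eq] by linarith
  then have "?h u v (x + a *\<^sub>R u + b *\<^sub>R v) = ?h v u (x + a' *\<^sub>R v + b' *\<^sub>R u)" using t by simp
  moreover have "dist (?h u v (x + a *\<^sub>R u + b *\<^sub>R v)) (?h u v x) < e"
    using near'[of "x + a *\<^sub>R u + b *\<^sub>R v"] small[OF 1(1-4)] by (simp add: dist_norm add.assoc)
  moreover have "dist (?h v u (x + a' *\<^sub>R v + b' *\<^sub>R u)) (?h v u x) < e"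
    using near'[of "x + a' *\<^sub>R v + b' *\<^sub>R u"] small[OF 2(3,4,1,2)]
    by (simp add: dist_norm add.assoc add.commute)
  ultimately show False by (simp add: dist_real_def e_def abs_if split: if_splits)
qed

lemma op_norm_bound: "norm (A *v v) \<le> op_norm A * norm v"
  unfolding op_norm_def by (rule onorm) (rule matrix_vector_mul_bounded_linear)

lemma segment_in_convex:
  assumes "convex D" "x \<in> D" "x + d \<in> D" "0 \<le> t" "t \<le> (1::real)"
  shows "x + t *\<^sub>R d \<in> D"
proof -
  have "(1 - t) *\<^sub>R x + t *\<^sub>R (x + d) \<in> D"
    using assms by (intro convexD) auto
  then show ?thesis by (simp add: algebra_simps)
qed

text \<open>The difference of the two sides, restricted to the segment from \<open>x\<close> to \<open>x + d\<close>, is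
  monotone, because the Lipschitz condition bounds its derivative.\<close>

lemma descent_lemma:
  assumes f: "twice_cont_diff f" and D: "convex D" "x \<in> D" "x + d \<in> D"
    and L: "L-lipschitz_on D (grad f)"
  shows "f (x + d) \<le> f x + grad f x \<bullet> d + L / 2 * (norm d)\<^sup>2"
proof -
  let ?p = "\<lambda>t. f (x + t *\<^sub>R d) - t * (grad f x \<bullet> d) - L / 2 * t\<^sup>2 * (norm d)\<^sup>2"
  have "?p 1 \<le> ?p 0"
  proof (rule DERIV_nonpos_imp_nonincreasing[where f = ?p and a = 0 and b = 1])
    fix t :: real assume t: "0 \<le> t" "t \<le> 1"
    let ?y = "grad f (x + t *\<^sub>R d) \<bullet> d - grad f x \<bullet> d - L * t * (norm d)\<^sup>2"
    have "(?p has_real_derivative ?y) (at t)"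
      by (auto intro!: derivative_eq_intros DERIV_along_line[OF f])
    moreover have "(grad f (x + t *\<^sub>R d) - grad f x) \<bullet> d \<le> L * t * (norm d)\<^sup>2"
    proof -
      have "norm (grad f (x + t *\<^sub>R d) - grad f x) \<le> L * norm (t *\<^sub>R d)"
        using lipschitz_onD[OF L segment_in_convex[OF D t] D(2)] by (simp add: dist_norm)
      then have "norm (grad f (x + t *\<^sub>R d) - grad f x) * norm d \<le> L * norm (t *\<^sub>R d) * norm d"
        by (rule mult_right_mono) simp
      then show ?thesis
        using norm_cauchy_schwarz[of "grad f (x + t *\<^sub>R d) - grad f x" d] t
        by (simp add: power2_eq_square mult.assoc)
    qed
    ultimately show "\<exists>y. (?p has_real_derivative y) (at t) \<and> y \<le> 0"
      by (intro exI[of _ ?y]) (simp add: inner_diff_left)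
  qed simp
  then show ?thesis by simp
qed

text \<open>Testing the remainder against itself turns the vector estimate into a scalar
  monotonicity argument along the segment.\<close>

lemma grad_remainder:
  assumes f: "twice_cont_diff f" and D: "convex D" "x \<in> D" "x + d \<in> D"
    and L: "\<forall>x\<in>D. \<forall>y\<in>D. op_norm (hess f x - hess f y) \<le> L * norm (x - y)"
  shows "norm (grad f (x + d) - grad f x - hess f x *v d) \<le> L / 2 * (norm d)\<^sup>2"
proof -
  define u where "u = grad f (x + d) - grad f x - hess f x *v d"
  let ?p = "\<lambda>t. grad f (x + t *\<^sub>R d) \<bullet> u - t * ((hess f x *v d) \<bullet> u) - L / 2 * t\<^sup>2 * (norm d)\<^sup>2 * norm u"
  have "?p 1 \<le> ?p 0"
  proof (rule DERIV_nonpos_imp_nonincreasing[where f = ?p and a = 0 and b = 1])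
    fix t :: real assume t: "0 \<le> t" "t \<le> 1"
    let ?y = "(hess f (x + t *\<^sub>R d) *v d) \<bullet> u - (hess f x *v d) \<bullet> u - L * t * (norm d)\<^sup>2 * norm u"
    have "(?p has_real_derivative ?y) (at t)"
      by (auto intro!: derivative_eq_intros DERIV_grad_along_line[OF f])
    moreover have "((hess f (x + t *\<^sub>R d) - hess f x) *v d) \<bullet> u \<le> L * t * (norm d)\<^sup>2 * norm u"
    proof -
      have "op_norm (hess f (x + t *\<^sub>R d) - hess f x) \<le> L * norm (t *\<^sub>R d)"
        using L segment_in_convex[OF D t] D(2) by (metis add_diff_cancel_left')
      then have "op_norm (hess f (x + t *\<^sub>R d) - hess f x) * norm d \<le> L * norm (t *\<^sub>R d) * norm d"
        by (rule mult_right_mono) simp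
      with op_norm_bound have "norm ((hess f (x + t *\<^sub>R d) - hess f x) *v d) \<le> L * norm (t *\<^sub>R d) * norm d"
        by (rule order_trans)
      then have "norm ((hess f (x + t *\<^sub>R d) - hess f x) *v d) * norm u \<le> L * norm (t *\<^sub>R d) * norm d * norm u"
        by (rule mult_right_mono) simp
      then show ?thesis
        using norm_cauchy_schwarz[of "(hess f (x + t *\<^sub>R d) - hess f x) *v d" u] t
        by (simp add: power2_eq_square mult.assoc)
    qed
    ultimately show "\<exists>y. (?p has_real_derivative y) (at t) \<and> y \<le> 0"
      by (intro exI[of _ ?y]) (simp add: inner_diff_left matrix_vector_mult_diff_rdistrib)
  qed simp
  then have "u \<bullet> u \<le> L / 2 * (norm d)\<^sup>2 * norm u"
    by (simp add: inner_diff_left u_def algebra_simps)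
  then have "norm u * norm u \<le> L / 2 * (norm d)\<^sup>2 * norm u"
    by (simp add: power2_norm_eq_inner[symmetric] power2_eq_square)
  moreover have "0 \<le> L / 2 * (norm d)\<^sup>2" if "u = 0"
  proof -
    have "0 \<le> op_norm (hess f (x + d) - hess f x)"
      by (simp add: op_norm_def onorm_pos_le matrix_vector_mul_bounded_linear)
    also have "\<dots> \<le> L * norm d" using L D by (metis add_diff_cancel_left')
    finally show ?thesis by (simp add: zero_le_mult_iff)
  qed
  ultimately show ?thesis unfolding u_def[symmetric]
    by (cases "u = 0") (auto dest: mult_right_le_imp_le)
qed

text \<open>The same monotonicity argument once more, with \<open>grad_remainder\<close> bounding the
  derivative.\<close>

lemma cubic_taylor_bound:
  assumes f: "twice_cont_diff f" and D: "convex D" "x \<in> D" "x + d \<in> D"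
    and L: "\<forall>x\<in>D. \<forall>y\<in>D. op_norm (hess f x - hess f y) \<le> L * norm (x - y)"
  shows "f (x + d) \<le> f x + grad f x \<bullet> d + 1 / 2 * quad (hess f x) d + L / 6 * norm d ^ 3"
proof -
  let ?p = "\<lambda>t. f (x + t *\<^sub>R d) - t * (grad f x \<bullet> d) - t\<^sup>2 / 2 * quad (hess f x) d - L / 6 * t ^ 3 * norm d ^ 3"
  have "?p 1 \<le> ?p 0"
  proof (rule DERIV_nonpos_imp_nonincreasing[where f = ?p and a = 0 and b = 1])
    fix t :: real assume t: "0 \<le> t" "t \<le> 1"
    let ?y = "grad f (x + t *\<^sub>R d) \<bullet> d - grad f x \<bullet> d - t * quad (hess f x) d - L / 2 * t\<^sup>2 * norm d ^ 3"
    have "(?p has_real_derivative ?y) (at t)"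
      by (auto intro!: derivative_eq_intros DERIV_along_line[OF f])
    moreover have "?y \<le> 0"
    proof -
      let ?w = "grad f (x + t *\<^sub>R d) - grad f x - hess f x *v (t *\<^sub>R d)"
      have "norm ?w \<le> L / 2 * (norm (t *\<^sub>R d))\<^sup>2"
        by (rule grad_remainder[OF f D(1,2) segment_in_convex[OF D t] L])
      then have "norm ?w * norm d \<le> L / 2 * (norm (t *\<^sub>R d))\<^sup>2 * norm d"
        by (rule mult_right_mono) simp
      also have "L / 2 * (norm (t *\<^sub>R d))\<^sup>2 * norm d = L / 2 * t\<^sup>2 * norm d ^ 3"
        by (simp add: power_mult_distrib power2_eq_square power3_eq_cube)
      finally have "?w \<bullet> d \<le> L / 2 * t\<^sup>2 * norm d ^ 3"
        using norm_cauchy_schwarz[of ?w d] by linarith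
      then show ?thesis
        by (simp add: inner_diff_left inner_diff_right quad_def matrix_vector_mult_scaleR inner_commute)
    qed
    ultimately show "\<exists>y. (?p has_real_derivative y) (at t) \<and> y \<le> 0" by blast
  qed simp
  then show ?thesis by simp
qed

section \<open>Symmetric, scaled and reduced matrices\<close>

text \<open>A minimiser of the Rayleigh quotient over the compact unit sphere is an eigenvector: the shifted
  form is nonnegative and vanishes there, so its first variation vanishes as well.\<close>

lemma symmetric_matrix_least_eigenvector:
  fixes A :: "real ^ 'n ^ 'n"
  assumes sym: "\<And>u v. (A *v u) \<bullet> v = u \<bullet> (A *v v)"
  obtains m v where "norm v = 1" "A *v v = m *\<^sub>R v" "\<And>w. m * (norm w)\<^sup>2 \<le> quad A w"
proof -
  have "continuous_on (sphere 0 1) (quad A)"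
    unfolding quad_def by (intro continuous_intros)
  moreover have "sphere (0 :: real ^ 'n) 1 \<noteq> {}" by simp
  ultimately obtain v where v: "v \<in> sphere 0 1" and min: "\<And>w. w \<in> sphere 0 1 \<Longrightarrow> quad A v \<le> quad A w"
    using continuous_attains_inf[OF compact_sphere, of "0 :: real ^ 'n" 1 "quad A"] by blast
  define m where "m = quad A v"
  have nv: "norm v = 1" using v by simp
  have low: "m * (norm w)\<^sup>2 \<le> quad A w" for w
  proof (cases "w = 0")
    case False
    then have "m \<le> quad A ((1 / norm w) *\<^sub>R w)" unfolding m_def by (intro min) simp
    also have "\<dots> = quad A w / (norm w)\<^sup>2"
      by (simp add: quad_def matrix_vector_mult_scaleR power2_eq_square)
    finally show ?thesis using False by (simp add: field_simps)
  qed (simp add: quad_def)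
  \<comment> \<open>the first variation; moving from \<open>v\<close> along \<open>w\<close> keeps the shifted form nonnegative only if \<open>w\<close> is zero\<close>
  define w where "w = A *v v - m *\<^sub>R v"
  define a where "a = w \<bullet> w"
  define c where "c = quad A w - m * a"
  have par: "0 \<le> 2 * t * a + t\<^sup>2 * c" for t
  proof -
    have "0 \<le> quad A (v + t *\<^sub>R w) - m * (norm (v + t *\<^sub>R w))\<^sup>2" using low by simp
    also have "\<dots> = (quad A v - m * (v \<bullet> v)) + 2 * t * (w \<bullet> (A *v v) - m * (w \<bullet> v)) + t\<^sup>2 * c"
      unfolding power2_norm_eq_inner c_def a_def quad_def
      using sym[of v w]
      by (simp add: matrix_vector_right_distrib matrix_vector_mult_scaleR inner_add_left inner_add_right
          inner_commute power2_eq_square algebra_simps)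
    also have "quad A v - m * (v \<bullet> v) = 0"
      using nv by (simp add: m_def power2_norm_eq_inner[symmetric])
    also have "w \<bullet> (A *v v) - m * (w \<bullet> v) = a"
      unfolding a_def by (subst (4) w_def) (simp add: inner_diff_right)
    finally show ?thesis by simp
  qed
  have "a = 0"
  proof (rule ccontr)
    assume "a \<noteq> 0"
    then have a: "0 < a" by (simp add: a_def)
    show False
    proof (cases "c \<le> 0")
      case True
      then show False using par[of "- 1"] a by simp
    next
      case False
      \<comment> \<open>\<open>- a / c\<close> minimises the parabola in \<open>par\<close>\<close>
      then have "2 * (- a / c) * a + (- a / c)\<^sup>2 * c = - (a\<^sup>2 / c)"
        by (simp add: field_simps power2_eq_square)
      then show False using par[of "- a / c"] a False
        by (simp add: divide_le_0_iff)
    qed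
  qed
  then have "A *v v = m *\<^sub>R v" by (simp add: a_def w_def)
  then show thesis using that nv low by blast
qed

lemma quad_shift: "quad (A - (- e) *\<^sub>R mat 1) v = quad A v + e * (norm v)\<^sup>2"
  by (simp add: quad_def matrix_vector_mult_add_rdistrib scaleR_matrix_vector_assoc[symmetric]
      inner_add_right power2_norm_eq_inner)

text \<open>The least element in \<open>lambda_min\<close> exists for symmetric matrices, and it is the minimum of the
  Rayleigh quotient.\<close>

lemma lambda_min_less_iff:
  fixes A :: "real ^ 'n ^ 'n"
  assumes sym: "\<And>u v. (A *v u) \<bullet> v = u \<bullet> (A *v v)"
  shows "lambda_min A < - e \<longleftrightarrow> \<not> loewner_ge A ((- e) *\<^sub>R mat 1)"
proof -
  obtain m v where v: "norm v = 1" "A *v v = m *\<^sub>R v"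
    and low: "\<And>w. m * (norm w)\<^sup>2 \<le> quad A w"
    using symmetric_matrix_least_eigenvector[OF sym] by blast
  have "lambda_min A = m" unfolding lambda_min_def
  proof (rule Least_equality)
    show "\<exists>v. v \<noteq> 0 \<and> A *v v = m *\<^sub>R v" using v by (intro exI[of _ v]) auto
  next
    fix l assume "\<exists>v. v \<noteq> 0 \<and> A *v v = l *\<^sub>R v"
    then obtain w where w: "w \<noteq> 0" "A *v w = l *\<^sub>R w" by blast
    then have "m * (norm w)\<^sup>2 \<le> l * (norm w)\<^sup>2"
      using low[of w] by (simp add: quad_def power2_norm_eq_inner)
    then show "m \<le> l" using w by simp
  qed
  moreover have "loewner_ge A ((- e) *\<^sub>R mat 1) \<longleftrightarrow> - e \<le> m"
  proof
    assume "loewner_ge A ((- e) *\<^sub>R mat 1)"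
    then have "0 \<le> quad A v + e * (norm v)\<^sup>2" unfolding loewner_ge_def quad_shift by blast
    moreover have "quad A v = m" using v by (simp add: quad_def power2_norm_eq_inner[symmetric])
    ultimately show "- e \<le> m" using v by simp
  next
    assume m: "- e \<le> m"
    have "0 \<le> quad A w + e * (norm w)\<^sup>2" for w
      using low[of w] mult_right_mono[OF m, of "(norm w)\<^sup>2"] by simp
    then show "loewner_ge A ((- e) *\<^sub>R mat 1)" unfolding loewner_ge_def quad_shift by blast
  qed
  ultimately show ?thesis by auto
qed

lemma diag_mat_mult: "(diag_mat s *v v) $ i = s $ i * v $ i"
proof -
  have "(diag_mat s *v v) $ i = (\<Sum>j\<in>UNIV. (if i = j then s $ i else 0) * v $ j)"
    by (simp only: matrix_vector_mult_def diag_mat_def vec_lambda_beta)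
  also have "\<dots> = (\<Sum>j\<in>UNIV. if i = j then s $ i * v $ j else 0)"
    by (rule sum.cong) auto
  finally show ?thesis by simp
qed

lemma diag_mat_symmetric: "(diag_mat s *v u) \<bullet> v = u \<bullet> (diag_mat s *v v)"
  by (simp add: inner_vec_def diag_mat_mult mult_ac)

lemma Smat_component:
  "(Smat I e x *v v) $ i = (if i \<in> Jplus I e x then x $ i * v $ i else v $ i)"
  by (simp add: Smat_def diag_mat_mult)

lemma scaled_hess_mult:
  "scaled_hess f I e x *v v = Smat I e x *v (hess f x *v (Smat I e x *v v))"
  by (simp add: scaled_hess_def matrix_vector_mul_assoc matrix_mul_assoc)

lemma quad_scaled_hess: "quad (scaled_hess f I e x) v = quad (hess f x) (Smat I e x *v v)"
  unfolding quad_def scaled_hess_mult Smat_def by (rule diag_mat_symmetric[symmetric])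

lemma scaled_hess_symmetric:
  assumes "twice_cont_diff f"
  shows "(scaled_hess f I e x *v u) \<bullet> v = u \<bullet> (scaled_hess f I e x *v v)"
  unfolding scaled_hess_mult Smat_def by (simp add: diag_mat_symmetric hess_symmetric[OF assms])

lemma subvec_component [simp]: "subvec J v $ i = (if i \<in> J then v $ i else 0)"
  by (simp add: subvec_def)

lemma subvec_inner: "subvec J u \<bullet> v = u \<bullet> subvec J v"
  by (auto simp: inner_vec_def intro!: sum.cong)

lemma subvec_idem [simp]: "subvec J (subvec J v) = subvec J v"
  by (simp add: vec_eq_iff)

lemma subvec_linear: "linear (subvec J)"
  by (rule linearI) (simp_all add: vec_eq_iff)

lemma norm_subvec_mono:
  assumes "J \<subseteq> K"
  shows "norm (subvec J v) \<le> norm (subvec K v)"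
  by (rule norm_le_componentwise_cart) (use assms in auto)

lemma norm_subvec_le: "norm (subvec J v) \<le> norm v"
  by (rule norm_le_componentwise_cart) auto

text \<open>In this form it is visible that the padded submatrix maps into the vectors supported on \<open>J\<close>, so
  that CG never leaves them.\<close>

lemma submat_mult: "submat J A *v v = subvec J (A *v subvec J v)"
  by (auto simp: vec_eq_iff submat_def matrix_vector_mult_def if_distrib if_distribR
      cong: if_cong intro!: sum.cong)

lemma submat_symmetric:
  assumes "\<And>u v. (A *v u) \<bullet> v = u \<bullet> (A *v v)"
  shows "(submat J A *v u) \<bullet> v = u \<bullet> (submat J A *v v)"
  by (simp add: submat_mult subvec_inner assms)

section \<open>Conjugate gradients for indefinite matrices\<close>

text \<open>Convexity of the squared norm; the defect is a multiple of the squared distance.\<close>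

lemma norm_add_scaled_convex_le:
  fixes A B :: "'a :: real_inner"
  assumes "0 \<le> a" "a \<le> 1"
  shows "(norm ((1 - a) *\<^sub>R A + a *\<^sub>R B))\<^sup>2 \<le> (1 - a) * (norm A)\<^sup>2 + a * (norm B)\<^sup>2"
proof -
  have "(1 - a) * (norm A)\<^sup>2 + a * (norm B)\<^sup>2 - (norm ((1 - a) *\<^sub>R A + a *\<^sub>R B))\<^sup>2
    = (1 - a) * a * (norm (A - B))\<^sup>2"
    unfolding power2_norm_eq_inner
    by (simp add: inner_add_left inner_add_right inner_diff_left inner_diff_right inner_commute algebra_simps)
  also have "\<dots> \<ge> 0" using assms by simp
  finally show ?thesis by simp
qed

lemma Hbar_mult: "Hbar H e *v v = H *v v + (2 * e) *\<^sub>R v"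
  by (simp add: Hbar_def matrix_vector_mult_add_rdistrib scaleR_matrix_vector_assoc[symmetric])

lemma quad_Hbar: "quad (Hbar H e) v = quad H v + 2 * e * (norm v)\<^sup>2"
  by (simp add: quad_def Hbar_mult inner_add_right power2_norm_eq_inner)

text \<open>A call of Capped CG, together with the states that CG would produce if no test ever ended it.
  The matrix may be indefinite, so facts about the states are conditional on \<open>regular\<close> below.\<close>

locale cg_call =
  fixes H :: "real ^ 'n ^ 'n" and g :: "real ^ 'n" and e \<zeta> M0 :: real
  assumes H_symmetric: "\<And>u v. (H *v u) \<bullet> v = u \<bullet> (H *v v)"
    and g_nonzero: "g \<noteq> 0" and e_pos: "0 < e" and \<zeta>_pos: "0 < \<zeta>" and \<zeta>_less: "\<zeta> < 1"
    and M0_nonneg: "0 \<le> M0"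
begin

abbreviation "st \<equiv> cg_iter H g e M0"
abbreviation "B \<equiv> Hbar H e"
abbreviation "y j \<equiv> cgy (st j)"
abbreviation "r j \<equiv> cgr (st j)"
abbreviation "p j \<equiv> cgp (st j)"
abbreviation "Mx j \<equiv> cgM (st j)"
abbreviation "\<alpha> j \<equiv> cg_alpha H e (st j)"
abbreviation "\<beta> j \<equiv> (r (Suc j) \<bullet> r (Suc j)) / (r j \<bullet> r j)"

lemma B_symmetric: "(B *v u) \<bullet> v = u \<bullet> (B *v v)"
  by (simp add: Hbar_mult inner_add_left inner_add_right H_symmetric)

lemma cg_start: "y 0 = 0" "r 0 = g" "p 0 = - g"
  by simp_all

lemma cg_step:
  "y (Suc j) = y j + \<alpha> j *\<^sub>R p j"
  "r (Suc j) = r j + \<alpha> j *\<^sub>R (B *v p j)"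
  "p (Suc j) = - r (Suc j) + \<beta> j *\<^sub>R p j"
  by (simp_all add: Let_def cg_next_y_def)

declare cg_iter.simps [simp del]

lemma residual: "r j = B *v y j + g"
proof (induction j)
  case 0
  then show ?case by (simp add: cg_start)
next
  case (Suc j)
  then show ?case by (simp add: cg_step(1,2) matrix_vector_right_distrib matrix_vector_mult_scaleR)
qed

text \<open>The running bound plays the role of the spectral norm, but only on the vectors that CG has
  actually met; the convergence analysis never needs more.\<close>

lemma M_bounds:
  "0 \<le> Mx j" "norm (H *v r j) \<le> Mx j * norm (r j)" "norm (H *v y j) \<le> Mx j * norm (y j)"
proof -
  have div: "norm (H *v w) \<le> m * norm w" if "norm (H *v w) / norm w \<le> m" for w m
    using that by (cases "w = 0") (simp_all add: divide_le_eq)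
  have H_minus: "H *v (- g) = - (H *v g)"
    using matrix_vector_mult_diff_distrib[of H 0 g] by simp
  have "0 \<le> Mx j \<and> norm (H *v r j) \<le> Mx j * norm (r j) \<and> norm (H *v y j) \<le> Mx j * norm (y j)"
  proof (induction j)
    case 0
    show ?case using M0_nonneg g_nonzero by (simp add: cg_iter.simps(1) H_minus not_less)
  next
    case (Suc j)
    define m where "m = Max {norm (H *v p (Suc j)) / norm (p (Suc j)),
      norm (H *v y (Suc j)) / norm (y (Suc j)), norm (H *v r (Suc j)) / norm (r (Suc j))}"
    have Mx: "Mx (Suc j) = (if Mx j < m then m else Mx j)"
      unfolding m_def by (simp add: cg_iter.simps(2) Let_def cg_next_y_def)
    have "m \<le> Mx (Suc j)" "Mx j \<le> Mx (Suc j)" using Mx by auto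
    moreover have "norm (H *v r (Suc j)) / norm (r (Suc j)) \<le> m"
      "norm (H *v y (Suc j)) / norm (y (Suc j)) \<le> m"
      unfolding m_def by (rule Max_ge; simp)+
    ultimately show ?case using Suc.IH div by (meson order_trans)
  qed
  then show "0 \<le> Mx j" "norm (H *v r j) \<le> Mx j * norm (r j)" "norm (H *v y j) \<le> Mx j * norm (y j)"
    by auto
qed

lemma M_mono: "i \<le> j \<Longrightarrow> Mx i \<le> Mx j"
proof (induction j rule: dec_induct)
  case (step j)
  have "Mx j \<le> Mx (Suc j)" by (simp add: cg_iter.simps(2) Let_def)
  then show ?case using step.IH by linarith
qed simp

text \<open>Under this condition the first \<open>k\<close> updates of CG divide by positive numbers only.\<close>

definition regular :: "nat \<Rightarrow> bool" where
  "regular k \<longleftrightarrow> (\<forall>i<k. 0 < quad B (p i) \<and> r i \<noteq> 0)"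

text \<open>The classical relations of CG, proved in one simultaneous induction since each feeds the others.
  Positivity of the curvatures met so far replaces positive definiteness.\<close>

lemma cg_orthogonality:
  assumes "regular k"
  shows "(\<forall>i<k. p i \<bullet> r k = 0) \<and> (\<forall>i<k. p i \<bullet> (B *v p k) = 0) \<and>
    p k \<bullet> r k = - (r k \<bullet> r k) \<and> (\<forall>i<k. r i \<bullet> r k = 0)"
  using assms
proof (induction k rule: less_induct)
  case (less k)
  show ?case
  proof (cases k)
    case 0
    then show ?thesis by (simp add: cg_start)
  next
    case (Suc j)
    have IH: "(\<forall>l<i. p l \<bullet> r i = 0) \<and> (\<forall>l<i. p l \<bullet> (B *v p i) = 0) \<and>
        p i \<bullet> r i = - (r i \<bullet> r i) \<and> (\<forall>l<i. r l \<bullet> r i = 0)" if "i \<le> j" for i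
      using less.IH[of i] less.prems that Suc by (auto simp: regular_def)
    have curv: "0 < quad B (p i)" and rpos: "0 < r i \<bullet> r i" if "i \<le> j" for i
      using less.prems that Suc by (auto simp: regular_def)
    have a: "\<alpha> i * (p i \<bullet> (B *v p i)) = r i \<bullet> r i" "0 < \<alpha> i" if "i \<le> j" for i
      using curv[OF that] rpos[OF that] by (auto simp: cg_alpha_def quad_def)
    have pr: "p i \<bullet> r k = 0" if "i \<le> j" for i
    proof (cases "i = j")
      case True
      then show ?thesis using IH[of j] a[of j] by (simp add: Suc cg_step(2) inner_add_right)
    next
      case False
      then show ?thesis using IH[of j] that by (simp add: Suc cg_step(2) inner_add_right)
    qed
    have rr: "r i \<bullet> r k = 0" if "i \<le> j" for i
    proof (cases i)
      case 0
      then show ?thesis using pr[of 0] by (simp add: cg_start)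
    next
      case (Suc l)
      have "r i = - p i + \<beta> l *\<^sub>R p l" unfolding Suc cg_step(3) by simp
      then have "r i \<bullet> r k = - (p i \<bullet> r k) + \<beta> l * (p l \<bullet> r k)"
        using arg_cong[of "r i" _ "\<lambda>w. w \<bullet> r k"] by (metis inner_add_left inner_minus_left inner_scaleR_left)
      then show ?thesis using pr[of i] pr[of l] that Suc by simp
    qed
    have pk: "p k \<bullet> r k = - (r k \<bullet> r k)"
      using pr[of j] unfolding Suc cg_step(3) by (simp add: inner_diff_left inner_add_left)
    have pBp: "p i \<bullet> (B *v p k) = 0" if i: "i \<le> j" for i
    proof -
      \<comment> \<open>the image of a direction is a difference of residuals, which makes conjugacy a consequence of orthogonality\<close>
      have Bp: "B *v p i = (1 / \<alpha> i) *\<^sub>R (r (Suc i) - r i)"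
        using a(2)[OF i] by (simp add: cg_step(2))
      have "p i \<bullet> (B *v p k) = (B *v p i) \<bullet> p k" by (rule B_symmetric[symmetric])
      also have "\<dots> = - ((B *v p i) \<bullet> r k) + \<beta> j * ((B *v p i) \<bullet> p j)"
        unfolding Suc cg_step(3)[of j] by (simp add: inner_diff_right inner_add_right)
      also have "(B *v p i) \<bullet> r k = (1 / \<alpha> i) * (r (Suc i) \<bullet> r k - r i \<bullet> r k)"
        unfolding Bp by (simp add: inner_diff_left)
      finally have *: "p i \<bullet> (B *v p k) =
        - ((1 / \<alpha> i) * (r (Suc i) \<bullet> r k - r i \<bullet> r k)) + \<beta> j * (p i \<bullet> (B *v p j))"
        by (simp add: B_symmetric)
      show ?thesis
      proof (cases "i = j")
        case True
        have "\<beta> j * (p j \<bullet> (B *v p j)) = (r k \<bullet> r k) / \<alpha> j"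
          using a[of j] rpos[of j] by (simp add: Suc field_simps)
        then show ?thesis using * rr[of j] by (simp add: True Suc)
      next
        case False
        then show ?thesis using * rr[of i] rr[of "Suc i"] IH[of j] i by simp
      qed
    qed
    show ?thesis using pr rr pk pBp Suc by auto
  qed
qed

lemma regular_mono: "regular k \<Longrightarrow> i \<le> k \<Longrightarrow> regular i"
  by (auto simp: regular_def)

lemma residual_orthogonal:
  assumes "regular k" "i < k"
  shows "r i \<bullet> r k = 0" "p i \<bullet> r k = 0"
  using cg_orthogonality[OF assms(1)] assms(2) by auto

lemma iterate_orthogonal_residual:
  assumes "regular k" "i \<le> k"
  shows "y i \<bullet> r k = 0"
  using assms(2)
proof (induction i)
  case 0
  then show ?case by (simp add: cg_start)
next
  case (Suc i)
  then show ?case using residual_orthogonal(2)[OF assms(1), of i]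
    by (simp add: cg_step(1) inner_add_left)
qed

text \<open>The quadratic that CG minimises; its gradient at \<open>y j\<close> is the residual \<open>r j\<close>.\<close>

definition \<Phi> :: "real ^ 'n \<Rightarrow> real" where
  "\<Phi> z = 1 / 2 * quad B z + g \<bullet> z"

lemma quad_B_add: "quad B (u + v) = quad B u + 2 * (v \<bullet> (B *v u)) + quad B v"
  using B_symmetric[of u v]
  by (simp add: quad_def matrix_vector_right_distrib inner_add_left inner_add_right inner_commute)

lemma \<Phi>_expand: "\<Phi> z = \<Phi> (y j) + r j \<bullet> (z - y j) + 1 / 2 * quad B (z - y j)"
  using quad_B_add[of "y j" "z - y j"]
  by (simp add: \<Phi>_def residual inner_add_left inner_diff_right inner_commute algebra_simps)

lemma quad_B_residual_le: "quad B (r i) \<le> (Mx i + 2 * e) * (norm (r i))\<^sup>2"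
proof -
  have "quad H (r i) \<le> norm (r i) * norm (H *v r i)"
    unfolding quad_def by (rule norm_cauchy_schwarz)
  also have "\<dots> \<le> norm (r i) * (Mx i * norm (r i))" by (intro mult_left_mono M_bounds) simp
  finally show ?thesis by (simp add: quad_Hbar algebra_simps power2_eq_square)
qed

text \<open>A CG step is at least as good as a gradient step of length \<open>1 / L\<close>: subtracting the
  previous conjugate direction only lowers the curvature, so \<open>p j\<close> has at most the curvature of
  \<open>r j\<close>, and the latter is controlled by the running bound.\<close>

lemma \<Phi>_decrease:
  assumes reg: "regular (Suc j)" and L: "Mx j + 2 * e \<le> L"
  shows "\<Phi> (y (Suc j)) \<le> \<Phi> (y j) - (norm (r j))\<^sup>2 / (2 * L)"
proof -
  have curv: "0 < quad B (p j)" and rj: "0 < (norm (r j))\<^sup>2" using reg by (auto simp: regular_def)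
  have orth: "(\<forall>i<j. p i \<bullet> (B *v p j) = 0) \<and> p j \<bullet> r j = - (r j \<bullet> r j)"
    using cg_orthogonality[OF regular_mono[OF reg, of j]] by simp
  have Lpos: "0 < L" using L M_bounds(1)[of j] e_pos by linarith
  have "quad B (p j) \<le> quad B (r j)"
  proof (cases j)
    case 0
    then show ?thesis
      using matrix_vector_mult_diff_distrib[of B 0 g] by (simp add: cg_start quad_def)
  next
    case (Suc l)
    let ?b = "\<beta> l"
    have "r j = - p j + ?b *\<^sub>R p l" unfolding Suc cg_step(3) by simp
    then have "r j = ?b *\<^sub>R p l + (-1) *\<^sub>R p j" by simp
    then have "quad B (r j) = quad B (?b *\<^sub>R p l) + 2 * (((-1) *\<^sub>R p j) \<bullet> (B *v (?b *\<^sub>R p l))) + quad B ((-1) *\<^sub>R p j)"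
      by (simp only: quad_B_add)
    also have "quad B ((-1) *\<^sub>R p j) = quad B (p j)"
      unfolding quad_def matrix_vector_mult_scaleR by simp
    also have "((-1) *\<^sub>R p j) \<bullet> (B *v (?b *\<^sub>R p l)) = 0"
      using orth Suc B_symmetric[of "p j" "p l"]
      by (simp add: matrix_vector_mult_scaleR inner_commute)
    also have "quad B (?b *\<^sub>R p l) = ?b\<^sup>2 * quad B (p l)"
      by (simp add: quad_def matrix_vector_mult_scaleR power2_eq_square)
    finally have "quad B (r j) = ?b\<^sup>2 * quad B (p l) + quad B (p j)" by simp
    moreover have "0 \<le> ?b\<^sup>2 * quad B (p l)"
      using reg Suc by (auto simp: regular_def intro!: mult_nonneg_nonneg less_imp_le)
    ultimately show ?thesis by linarith
  qed
  also have "\<dots> \<le> L * (norm (r j))\<^sup>2"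
    using quad_B_residual_le[of j] mult_right_mono[OF L, of "(norm (r j))\<^sup>2"] by simp
  finally have pBp: "quad B (p j) \<le> L * (norm (r j))\<^sup>2" .
  have al: "\<alpha> j = (norm (r j))\<^sup>2 / quad B (p j)" by (simp add: cg_alpha_def power2_norm_eq_inner)
  have "1 / L \<le> \<alpha> j"
    unfolding al using pBp curv Lpos by (simp add: field_simps)
  then have "(norm (r j))\<^sup>2 / L \<le> \<alpha> j * (norm (r j))\<^sup>2"
    using mult_right_mono[of "1 / L" "\<alpha> j" "(norm (r j))\<^sup>2"] by simp
  moreover have "\<Phi> (y (Suc j)) = \<Phi> (y j) - 1 / 2 * (\<alpha> j * (norm (r j))\<^sup>2)"
  proof -
    have "\<Phi> (y (Suc j)) = \<Phi> (y j) + \<alpha> j * (p j \<bullet> r j) + 1 / 2 * ((\<alpha> j)\<^sup>2 * quad B (p j))"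
      using \<Phi>_expand[of "y (Suc j)" j] cg_step(1)[of j]
      by (simp add: quad_def matrix_vector_mult_scaleR power2_eq_square inner_commute)
    moreover have "(\<alpha> j)\<^sup>2 * quad B (p j) = \<alpha> j * (norm (r j))\<^sup>2"
      using curv by (simp add: al power2_eq_square)
    ultimately show ?thesis using orth by (simp add: power2_norm_eq_inner)
  qed
  ultimately show ?thesis by simp
qed

text \<open>Nesterov's estimate sequence with the CG iterates as query points. Writing the \<open>j\<close>-th estimate
  function as a minimum value plus \<open>e / 2\<close> times the squared distance to its centre \<open>v\<close>, the claim
  combines the upper bound on its value at \<open>z\<close> with the lower bound \<open>\<Phi> (y j)\<close> on its minimum.
  In CG both \<open>v\<close> and \<open>y j\<close> lie in the span of the earlier residuals, hence are orthogonal to the current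
  one, and this removes the extrapolation step of the accelerated method. Strong convexity is
  used only between \<open>z\<close> and the iterates; this weak form is what the algorithm can
  test.\<close>

lemma estimate_sequence:
  assumes reg: "regular (Suc J)" and L: "Mx J + 2 * e \<le> L"
    and a: "0 \<le> a" "a \<le> 1" "a\<^sup>2 * L \<le> e"
    and curv: "\<And>i. i < J \<Longrightarrow> e * (norm (z - y i))\<^sup>2 \<le> quad B (z - y i)"
    and "j \<le> J"
  shows "\<exists>v. (\<forall>k. j \<le> k \<and> k \<le> J \<longrightarrow> v \<bullet> r k = 0) \<and>
    \<Phi> (y j) - \<Phi> z + e / 2 * (norm (z - v))\<^sup>2 \<le> (1 - a) ^ j * (e / 2 * (norm z)\<^sup>2 - \<Phi> z)"
  using \<open>j \<le> J\<close>
proof (induction j)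
  case 0
  show ?case by (intro exI[of _ 0]) (simp add: cg_start \<Phi>_def quad_def)
next
  case (Suc j)
  then obtain v where v: "\<And>k. j \<le> k \<Longrightarrow> k \<le> J \<Longrightarrow> v \<bullet> r k = 0"
    and IH: "\<Phi> (y j) - \<Phi> z + e / 2 * (norm (z - v))\<^sup>2 \<le> (1 - a) ^ j * (e / 2 * (norm z)\<^sup>2 - \<Phi> z)"
    by auto
  have jJ: "j < J" using Suc.prems by simp
  have regk: "regular k" if "k \<le> J" for k using regular_mono[OF reg, of k] that by simp
  have Lpos: "0 < L" using L M_bounds(1)[of J] e_pos by linarith
  \<comment> \<open>the centre of the averaged quadratics\<close>
  define v' where "v' = (1 - a) *\<^sub>R v + a *\<^sub>R y j - (a / e) *\<^sub>R r j"
  have "v' \<bullet> r k = 0" if "Suc j \<le> k" "k \<le> J" for k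
    using v[of k] iterate_orthogonal_residual[OF regk, of k j] residual_orthogonal(1)[OF regk, of k j] that
    by (simp add: v'_def inner_add_left inner_diff_left)
  moreover have "\<Phi> (y (Suc j)) - \<Phi> z + e / 2 * (norm (z - v'))\<^sup>2
      \<le> (1 - a) ^ Suc j * (e / 2 * (norm z)\<^sup>2 - \<Phi> z)"
  proof -
    define w where "w = (1 - a) *\<^sub>R (z - v) + a *\<^sub>R (z - y j)"
    define R where "R = (norm (r j))\<^sup>2"
    have "w \<bullet> r j = z \<bullet> r j"
      using v[of j] iterate_orthogonal_residual[OF regk, of j j] jJ
      by (simp add: w_def inner_add_left inner_diff_left algebra_simps)
    moreover have "z - v' = w + (a / e) *\<^sub>R r j" by (simp add: w_def v'_def algebra_simps)
    moreover have "(norm (w + (a / e) *\<^sub>R r j))\<^sup>2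
        = (norm w)\<^sup>2 + 2 * (a / e) * (w \<bullet> r j) + (a / e)\<^sup>2 * R"
      unfolding power2_norm_eq_inner R_def
      by (simp add: inner_add_left inner_add_right inner_commute power2_eq_square)
    ultimately have "(norm (z - v'))\<^sup>2 = (norm w)\<^sup>2 + 2 * (a / e) * (z \<bullet> r j) + (a / e)\<^sup>2 * R"
      by simp
    then have "e / 2 * (norm (z - v'))\<^sup>2 = e / 2 * (norm w)\<^sup>2 + a * (z \<bullet> r j) + a\<^sup>2 / (2 * e) * R"
      using e_pos by (simp add: field_simps power2_eq_square)
    also have "e / 2 * (norm w)\<^sup>2 \<le> e / 2 * ((1 - a) * (norm (z - v))\<^sup>2 + a * (norm (z - y j))\<^sup>2)"
      unfolding w_def using e_pos a by (intro mult_left_mono norm_add_scaled_convex_le) auto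
    also have "e / 2 * ((1 - a) * (norm (z - v))\<^sup>2 + a * (norm (z - y j))\<^sup>2) + a * (z \<bullet> r j)
        = (1 - a) * (e / 2 * (norm (z - v))\<^sup>2) + a * (e / 2 * (norm (z - y j))\<^sup>2 + z \<bullet> r j)"
      by algebra
    finally have 1: "e / 2 * (norm (z - v'))\<^sup>2
        \<le> (1 - a) * (e / 2 * (norm (z - v))\<^sup>2) + a * (e / 2 * (norm (z - y j))\<^sup>2 + z \<bullet> r j) + a\<^sup>2 / (2 * e) * R"
      by simp
    have "e / 2 * (norm (z - y j))\<^sup>2 + z \<bullet> r j \<le> \<Phi> z - \<Phi> (y j)"
      using \<Phi>_expand[of z j] curv[OF jJ] iterate_orthogonal_residual[OF regk, of j j] jJ
      by (simp add: inner_diff_right inner_commute)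
    then have 2: "a * (e / 2 * (norm (z - y j))\<^sup>2 + z \<bullet> r j) \<le> a * (\<Phi> z - \<Phi> (y j))"
      using a by (intro mult_left_mono) auto
    have "regular (Suc j)" using regk[of "Suc j"] jJ by simp
    moreover have "Mx j + 2 * e \<le> L" using L M_mono[of j J] jJ by simp
    ultimately have 3: "\<Phi> (y (Suc j)) \<le> \<Phi> (y j) - R / (2 * L)"
      unfolding R_def by (rule \<Phi>_decrease)
    have "a\<^sup>2 / (2 * e) \<le> 1 / (2 * L)" using a(3) e_pos Lpos by (simp add: field_simps)
    then have 4: "a\<^sup>2 / (2 * e) * R \<le> R / (2 * L)"
      using mult_right_mono[of "a\<^sup>2 / (2 * e)" "1 / (2 * L)" R] by (simp add: R_def)
    have "\<Phi> (y (Suc j)) - \<Phi> z + e / 2 * (norm (z - v'))\<^sup>2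
        \<le> (1 - a) * (\<Phi> (y j) - \<Phi> z + e / 2 * (norm (z - v))\<^sup>2)"
    proof -
      have "(1 - a) * (s - t + u) = (s - t) + a * (t - s) + (1 - a) * u" for s t u :: real
        by algebra
      note this[of "\<Phi> (y j)" "\<Phi> z" "e / 2 * (norm (z - v))\<^sup>2"]
      then show ?thesis using 1 2 3 4 by linarith
    qed
    also have "\<dots> \<le> (1 - a) * ((1 - a) ^ j * (e / 2 * (norm z)\<^sup>2 - \<Phi> z))"
      using a by (intro mult_left_mono IH) simp
    finally show ?thesis by (simp add: mult.assoc)
  qed
  ultimately show ?case by blast
qed

text \<open>The final decrease \<open>\<Phi>_decrease\<close> bounds the residual by the remaining gap to \<open>y (Suc J)\<close>, and the
  estimate sequence bounds that gap. With \<open>\<kappa>\<close> the running condition number, the choice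
  \<open>a = 1 / (sqrt \<kappa> + 1)\<close> makes \<open>1 - a\<close> the rate \<open>cg_tau\<close>.\<close>

lemma residual_linear_convergence:
  assumes reg: "regular (Suc J)"
    and curv: "\<And>i. i \<le> J \<Longrightarrow> e * (norm (y (Suc J) - y i))\<^sup>2 \<le> quad B (y (Suc J) - y i)"
  shows "(norm (r J))\<^sup>2 \<le> 4 * cg_kappa e (Mx J) * cg_tau e (Mx J) ^ J * (norm g)\<^sup>2"
proof -
  define z where "z = y (Suc J)"
  define k where "k = cg_kappa e (Mx J)"
  define L where "L = Mx J + 2 * e"
  define a where "a = 1 / (sqrt k + 1)"
  define C where "C = e / 2 * (norm z)\<^sup>2 - \<Phi> z"
  have L: "0 < L" "L = k * e" using M_bounds(1)[of J] e_pos by (auto simp: L_def k_def cg_kappa_def)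
  have k: "0 < k" using L e_pos by (simp add: zero_less_mult_iff)
  have den: "1 \<le> sqrt k + 1" using k by simp
  then have "sqrt k + 1 \<noteq> 0" by linarith
  then have tau: "cg_tau e (Mx J) = 1 - a"
    unfolding cg_tau_def a_def k_def[symmetric]
    by (subst eq_diff_eq, subst add_divide_distrib[symmetric]) (rule divide_self)
  have a: "0 \<le> a" "a \<le> 1"
  proof -
    have "0 < sqrt k + 1" using den by linarith
    then show "0 \<le> a" "a \<le> 1" unfolding a_def using den by (simp_all only: divide_le_eq_1_pos zero_le_divide_1_iff)
  qed
  have "a\<^sup>2 * k \<le> 1"
  proof -
    have "k = (sqrt k)\<^sup>2" using k by simp
    also have "\<dots> \<le> (sqrt k + 1)\<^sup>2" using k by (intro power_mono) auto
    finally show ?thesis using den by (simp add: a_def power_divide divide_le_eq)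
  qed
  then have aL: "a\<^sup>2 * L \<le> e" using mult_right_mono[of "a\<^sup>2 * k" 1 e] e_pos by (simp add: L(2) mult.assoc)
  obtain v where "\<Phi> (y J) - \<Phi> z + e / 2 * (norm (z - v))\<^sup>2 \<le> (1 - a) ^ J * C"
    using estimate_sequence[OF reg _ a aL, of z J] curv unfolding z_def C_def L_def by auto
  moreover have "0 \<le> e / 2 * (norm (z - v))\<^sup>2" using e_pos by simp
  ultimately have up: "\<Phi> (y J) - \<Phi> z \<le> (1 - a) ^ J * C" by linarith
  have down: "(norm (r J))\<^sup>2 / (2 * L) \<le> \<Phi> (y J) - \<Phi> z"
    using \<Phi>_decrease[OF reg, of L] by (simp add: z_def L_def)
  \<comment> \<open>monotonicity from \<open>\<Phi> 0 = 0\<close>, which bounds the norm of \<open>z\<close> by \<open>2 * norm g / e\<close>\<close>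
  have "\<Phi> (y j) \<le> 0" if "j \<le> Suc J" for j using that
  proof (induction j)
    case 0
    show ?case by (simp add: cg_start \<Phi>_def quad_def)
  next
    case (Suc j)
    have "0 \<le> (norm (r j))\<^sup>2 / (2 * (Mx j + 2 * e))"
      using M_bounds(1)[of j] e_pos by simp
    then show ?case
      using \<Phi>_decrease[OF regular_mono[OF reg Suc.prems] order_refl] Suc by simp
  qed
  then have neg: "\<Phi> z \<le> 0" by (simp add: z_def)
  have zz: "e * (norm z)\<^sup>2 \<le> quad B z" using curv[of 0] by (simp add: z_def cg_start)
  have gz: "- (g \<bullet> z) \<le> norm g * norm z" using norm_cauchy_schwarz[of "- g" z] by simp
  have "e / 2 * (norm z)\<^sup>2 \<le> norm g * norm z" using neg zz gz by (simp add: \<Phi>_def)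
  then have nz: "norm z \<le> 2 * norm g / e"
    using e_pos by (cases "z = 0") (auto simp: field_simps power2_eq_square)
  have "C \<le> norm g * norm z" using zz gz by (simp add: C_def \<Phi>_def)
  also have "\<dots> \<le> norm g * (2 * norm g / e)" using nz by (intro mult_left_mono) auto
  finally have C: "C \<le> 2 * (norm g)\<^sup>2 / e" by (simp add: power2_eq_square mult_ac)
  have "(norm (r J))\<^sup>2 / (2 * L) \<le> (1 - a) ^ J * (2 * (norm g)\<^sup>2 / e)"
    using up down C a mult_left_mono[OF C, of "(1 - a) ^ J"] by auto
  then have "(norm (r J))\<^sup>2 \<le> 2 * L * ((1 - a) ^ J * (2 * (norm g)\<^sup>2 / e))"
    using L by (simp add: field_simps)
  then show ?thesis using e_pos by (simp add: tau k_def[symmetric] L(2))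
qed

section \<open>Termination and results of Capped CG\<close>

lemma kappa_ge_2: "2 \<le> cg_kappa e (Mx j)"
  using M_bounds(1)[of j] e_pos by (simp add: cg_kappa_def field_simps)

text \<open>The contrapositive of \<open>residual_linear_convergence\<close>, since \<open>4 * \<kappa> \<le> cg_T\<close>. The index \<open>J\<close> itself is
  excluded from the search because \<open>y (Suc J) - y J\<close> is a multiple of \<open>p J\<close>, whose
  curvature has passed the preceding test.\<close>

lemma slow_imp_negative_curvature:
  assumes reg: "regular (Suc J)" and J: "1 \<le> J"
    and slow: "cg_slow g e (st J) J" and p: "\<not> neg_curv H e (p J)"
  shows "\<exists>i<J. neg_curv H e (cg_next_y H e (st J) - y i)"
proof (rule ccontr)
  assume "\<not> ?thesis"
  then have "e * (norm (y (Suc J) - y i))\<^sup>2 \<le> quad B (y (Suc J) - y i)" if "i < J" for i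
    using that unfolding neg_curv_def cg_next_y_def cg_step(1) by (meson not_less)
  moreover have "e * (norm (y (Suc J) - y J))\<^sup>2 \<le> quad B (y (Suc J) - y J)"
  proof -
    have "quad B (\<alpha> J *\<^sub>R p J) = (\<alpha> J)\<^sup>2 * quad B (p J)"
      by (simp add: quad_def matrix_vector_mult_scaleR power2_eq_square)
    also have "\<dots> \<ge> (\<alpha> J)\<^sup>2 * (e * (norm (p J))\<^sup>2)"
      using p by (intro mult_left_mono) (auto simp: neg_curv_def)
    finally show ?thesis by (simp add: cg_step(1) power_mult_distrib algebra_simps)
  qed
  ultimately have "e * (norm (y (Suc J) - y i))\<^sup>2 \<le> quad B (y (Suc J) - y i)" if "i \<le> J" for i
    using that by (cases "i = J") auto
  note conv = residual_linear_convergence[OF reg this]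
  define k where "k = cg_kappa e (Mx J)"
  define \<tau> where "\<tau> = cg_tau e (Mx J)"
  define T where "T = cg_T e (Mx J)"
  have k: "2 \<le> k" unfolding k_def by (rule kappa_ge_2)
  have tau: "0 < \<tau>" "\<tau> < 1"
  proof -
    have "0 < sqrt k" using k by simp
    then have "0 < sqrt k + 1" by linarith
    with \<open>0 < sqrt k\<close> have "0 < sqrt k / (sqrt k + 1)" "sqrt k / (sqrt k + 1) < 1"
      by (auto intro: divide_pos_pos simp only: divide_less_eq_1_pos)
    then show "0 < \<tau>" "\<tau> < 1" by (simp_all add: \<tau>_def cg_tau_def k_def)
  qed
  have "4 * k \<le> T"
  proof -
    have s: "0 < 1 - sqrt \<tau>" "1 - sqrt \<tau> \<le> 1" using tau by auto
    have "k * 1 \<le> k * k ^ 3" using k by (intro mult_left_mono) auto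
    then have "4 * k \<le> 4 * k ^ 4" by (simp add: power_numeral_reduce)
    also have "\<dots> \<le> 4 * k ^ 4 / (1 - sqrt \<tau>)\<^sup>2"
    proof -
      have "(1 - sqrt \<tau>)\<^sup>2 \<le> 1" using s by (simp add: power_le_one)
      then have "4 * k ^ 4 * (1 - sqrt \<tau>)\<^sup>2 \<le> 4 * k ^ 4 * 1"
        using k by (intro mult_left_mono) auto
      then show ?thesis using s by (simp add: le_divide_eq)
    qed
    finally show ?thesis by (simp add: T_def cg_T_def k_def \<tau>_def)
  qed
  have Tpos: "0 \<le> T" using \<open>4 * k \<le> T\<close> k by linarith
  have "sqrt T * \<tau> powr (real J / 2) * norm g < norm (r J)"
    using slow by (simp add: cg_slow_def T_def \<tau>_def)
  then have "(sqrt T * \<tau> powr (real J / 2) * norm g)\<^sup>2 < (norm (r J))\<^sup>2"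
    using Tpos by (intro power_strict_mono) auto
  also have "(sqrt T * \<tau> powr (real J / 2) * norm g)\<^sup>2 = T * \<tau> ^ J * (norm g)\<^sup>2"
  proof -
    have "(\<tau> powr (real J / 2))\<^sup>2 = \<tau> powr real J"
      unfolding power2_eq_square powr_add[symmetric] by simp
    then show ?thesis using Tpos tau by (simp add: power_mult_distrib powr_realpow)
  qed
  also have "(norm (r J))\<^sup>2 \<le> 4 * k * \<tau> ^ J * (norm g)\<^sup>2" using conv by (simp add: k_def \<tau>_def)
  also have "\<dots> \<le> T * \<tau> ^ J * (norm g)\<^sup>2"
    using \<open>4 * k \<le> T\<close> tau by (intro mult_right_mono) auto
  finally show False by simp
qed

lemma regular_Suc:
  assumes "regular k" "r k \<noteq> 0" "\<not> neg_curv H e (p k)"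
  shows "regular (Suc k)"
proof -
  have "p k \<bullet> r k \<noteq> 0" using cg_orthogonality[OF assms(1)] assms(2) by simp
  then have "p k \<noteq> 0" by auto
  then have "0 < e * (norm (p k))\<^sup>2" using e_pos by simp
  also have "\<dots> \<le> quad B (p k)" using assms(3) by (simp add: neg_curv_def)
  finally show ?thesis using assms by (auto simp: regular_def less_Suc_eq)
qed

lemma not_solved_nonzero:
  assumes "\<not> cg_solved g e \<zeta> (st k)"
  shows "r k \<noteq> 0"
proof
  assume "r k = 0"
  moreover have "0 \<le> cg_zeta_hat e \<zeta> (Mx k)"
    using \<zeta>_pos kappa_ge_2[of k] by (simp add: cg_zeta_hat_def)
  ultimately show False using assms by (simp add: cg_solved_def)
qed

lemma regularI:
  assumes "\<not> neg_curv H e (- g)"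
    and "\<And>i. 1 \<le> i \<Longrightarrow> i < k \<Longrightarrow> \<not> cg_solved g e \<zeta> (st i) \<and> \<not> neg_curv H e (p i)"
  shows "regular k"
  using assms(2)
proof (induction k)
  case 0
  show ?case by (simp add: regular_def)
next
  case (Suc k)
  show ?case
  proof (cases "k = 0")
    case True
    then show ?thesis using assms(1) g_nonzero by (intro regular_Suc) (auto simp: regular_def cg_start)
  next
    case False
    then show ?thesis using Suc.prems[of k] Suc.IH Suc.prems not_solved_nonzero
      by (intro regular_Suc) auto
  qed
qed

lemma reaches_regular:
  assumes "cg_reaches H g e \<zeta> M0 j"
  shows "regular j"
  using assms by (intro regularI) (auto simp: cg_reaches_def Let_def)

text \<open>Nonzero orthogonal residuals are linearly independent. This bounds the number of iterations
  of Capped CG.\<close>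

lemma regular_bounded:
  assumes "regular k"
  shows "k \<le> CARD('n)"
proof -
  have rne: "r i \<noteq> 0" if "i < k" for i using assms that by (auto simp: regular_def)
  have orth: "r i \<bullet> r j = 0" if "i < j" "j < k" for i j
    using residual_orthogonal(1)[OF regular_mono[OF assms, of j]] that by simp
  have "inj_on r {..<k}"
  proof (rule inj_onI)
    fix i j assume ij: "i \<in> {..<k}" "j \<in> {..<k}" "r i = r j"
    show "i = j"
    proof (rule ccontr)
      assume "i \<noteq> j"
      then have "r i \<bullet> r j = 0" using orth[of i j] orth[of j i] ij(1,2)
        by (auto simp: neq_iff inner_commute)
      then show False using ij rne[of i] by simp
    qed
  qed
  moreover have "independent (r ` {..<k})"
  proof (rule pairwise_orthogonal_independent)
    show "pairwise orthogonal (r ` {..<k})"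
    proof (rule pairwiseI)
      fix u v assume "u \<in> r ` {..<k}" "v \<in> r ` {..<k}" "u \<noteq> v"
      then obtain i j where "i < k" "j < k" "u = r i" "v = r j" "i \<noteq> j" by auto
      then show "orthogonal u v" using orth[of i j] orth[of j i]
        by (auto simp: orthogonal_def neq_iff inner_commute)
    qed
    show "0 \<notin> r ` {..<k}" using rne by auto
  qed
  ultimately show ?thesis using independent_bound[of "r ` {..<k}"] by (simp add: card_image)
qed

text \<open>Some test must succeed by the dimension bound, and at the first one that does, every
  rule can deliver a direction; only the last rule needs an argument, given above.\<close>

theorem capped_cg_returns: "\<exists>t ty. capped_cg H g e \<zeta> M0 t ty"
proof (cases "neg_curv H e (- g)")
  case True
  then show ?thesis using capped_cg.start_nc by blast
next
  case False
  let ?stop = "\<lambda>i. 1 \<le> i \<and> (neg_curv H e (y i) \<or> cg_solved g e \<zeta> (st i) \<or>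
    neg_curv H e (p i) \<or> cg_slow g e (st i) i)"
  have "\<exists>i. ?stop i"
  proof (rule ccontr)
    assume "\<not> ?thesis"
    then have "regular (Suc CARD('n))" using False by (intro regularI) auto
    then show False using regular_bounded by fastforce
  qed
  then obtain j where j: "?stop j" and below: "\<And>i. i < j \<Longrightarrow> \<not> ?stop i"
    using exists_least_iff[of ?stop] by blast
  have reach: "cg_reaches H g e \<zeta> M0 j"
    using False j below by (auto simp: cg_reaches_def Let_def)
  show ?thesis
  proof (cases "neg_curv H e (y j) \<or> cg_solved g e \<zeta> (st j) \<or> neg_curv H e (p j)")
    case True
    then show ?thesis
      using capped_cg.y_nc[OF reach refl] capped_cg.y_sol[OF reach refl] capped_cg.p_nc[OF reach refl]
      by blast
  next
    case False
    then have slow: "cg_slow g e (st j) j" and nc: "\<not> neg_curv H e (y j)"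
      "\<not> cg_solved g e \<zeta> (st j)" "\<not> neg_curv H e (p j)" using j by auto
    have "regular (Suc j)"
      using regular_Suc[OF reaches_regular[OF reach] not_solved_nonzero[OF nc(2)] nc(3)] .
    then obtain i where "i < j" "neg_curv H e (cg_next_y H e (st j) - y i)"
      using slow_imp_negative_curvature[OF _ _ slow nc(3)] j by blast
    then show ?thesis using capped_cg.slow_nc[OF reach refl nc slow _ refl] by blast
  qed
qed

theorem capped_cg_NC:
  assumes "capped_cg H g e \<zeta> M0 t NC"
  shows "t \<noteq> 0" "quad H t < - e * (norm t)\<^sup>2"
proof -
  have nc: "neg_curv H e t" using assms by (cases rule: capped_cg.cases) auto
  then show "quad H t < - e * (norm t)\<^sup>2" by (simp add: neg_curv_def quad_Hbar)
  show "t \<noteq> 0" using nc by (auto simp: neg_curv_def quad_def)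
qed

text \<open>Orthogonality of iterate and residual removes the residual from the Newton equation tested
  against \<open>t\<close>. The relative
  residual test in \<open>norm g\<close> turns into one in \<open>e * norm t\<close>, because \<open>norm g\<close> is at most
  \<open>\<kappa> * e * norm t\<close> plus the residual, and the factor 3 in \<open>cg_zeta_hat\<close> absorbs the latter.\<close>

theorem capped_cg_SOL:
  assumes "capped_cg H g e \<zeta> M0 t SOL"
  shows "e * (norm t)\<^sup>2 \<le> quad B t" "g \<bullet> t = - quad B t"
    "norm (B *v t + g) \<le> \<zeta> / 2 * e * norm t" "t \<noteq> 0"
proof -
  obtain j where reach: "cg_reaches H g e \<zeta> M0 j" and t: "t = y j"
    and nc: "\<not> neg_curv H e (y j)" and sol: "cg_solved g e \<zeta> (st j)"
    using assms by (cases rule: capped_cg.cases) auto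
  define k where "k = cg_kappa e (Mx j)"
  define R where "R = norm (r j)"
  have k: "2 \<le> k" unfolding k_def by (rule kappa_ge_2)
  show "e * (norm t)\<^sup>2 \<le> quad B t" using nc by (simp add: t neg_curv_def)
  have "y j \<bullet> r j = 0" using iterate_orthogonal_residual[OF reaches_regular[OF reach]] by simp
  then show "g \<bullet> t = - quad B t" by (simp add: t residual quad_def inner_add_right inner_commute)
  have "norm (B *v y j) \<le> norm (H *v y j) + norm ((2 * e) *\<^sub>R y j)"
    unfolding Hbar_mult by (rule norm_triangle_ineq)
  also have "\<dots> \<le> Mx j * norm (y j) + 2 * e * norm (y j)"
    using M_bounds(3)[of j] e_pos by simp
  also have "\<dots> = k * e * norm (y j)"
  proof -
    have "k * e = Mx j + 2 * e" using e_pos by (simp add: k_def cg_kappa_def)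
    then show ?thesis by (simp add: algebra_simps)
  qed
  finally have By: "norm (B *v y j) \<le> k * e * norm (y j)" .
  have R: "3 * k * R \<le> \<zeta> * norm g"
    using sol k by (simp add: cg_solved_def cg_zeta_hat_def k_def R_def field_simps)
  have "g = r j - B *v y j" by (simp add: residual)
  then have "norm g \<le> R + norm (B *v y j)" unfolding R_def using norm_triangle_ineq4 by metis
  then have ng: "norm g \<le> R + k * e * norm (y j)" using By by linarith
  have "\<zeta> * norm g \<le> \<zeta> * (R + k * e * norm (y j))" using \<zeta>_pos ng by (intro mult_left_mono) auto
  with R have "(3 * k - \<zeta>) * R \<le> \<zeta> * (k * e * norm (y j))" by (simp add: algebra_simps)
  moreover have "2 * k * R \<le> (3 * k - \<zeta>) * R"
    using k \<zeta>_less by (intro mult_right_mono) (auto simp: R_def)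
  ultimately have "k * (2 * R) \<le> k * (\<zeta> * e * norm (y j))" by (simp add: mult_ac)
  then have "2 * R \<le> \<zeta> * e * norm (y j)" using k by simp
  then show "norm (B *v t + g) \<le> \<zeta> / 2 * e * norm t" by (simp add: R_def t residual)
  show "t \<noteq> 0"
  proof
    assume "t = 0"
    then have "y j = 0" by (simp add: t)
    then have "R \<le> 0" "norm g \<le> R" using \<open>2 * R \<le> \<zeta> * e * norm (y j)\<close> ng by auto
    then show False using g_nonzero by (metis norm_le_zero_iff order_trans)
  qed
qed

text \<open>For padded data the relevant subspace is that of the vectors supported on \<open>J\<close>.\<close>

theorem capped_cg_subspace:
  assumes V: "subspace V" "g \<in> V" "\<And>v. v \<in> V \<Longrightarrow> H *v v \<in> V"
    and "capped_cg H g e \<zeta> M0 t ty"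
  shows "t \<in> V"
proof -
  have BV: "B *v v \<in> V" if "v \<in> V" for v
    unfolding Hbar_mult using V that by (intro subspace_add subspace_scale) auto
  have "y j \<in> V \<and> r j \<in> V \<and> p j \<in> V" for j
  proof (induction j)
    case 0
    show ?case using V by (simp add: cg_start subspace_0 subspace_neg)
  next
    case (Suc j)
    have "y (Suc j) \<in> V" "r (Suc j) \<in> V"
      unfolding cg_step(1,2) using Suc V BV by (auto intro!: subspace_add subspace_scale)
    moreover from this(2) have "p (Suc j) \<in> V"
      unfolding cg_step(3)[of j] using Suc V by (intro subspace_add subspace_scale subspace_neg) auto
    ultimately show ?case by simp
  qed
  then have iter: "y j \<in> V" "p j \<in> V" for j by auto
  then have "cg_next_y H e (st j) \<in> V" for j
    unfolding cg_next_y_def using V by (intro subspace_add subspace_scale) auto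
  with assms(4) show ?thesis
    by cases (use V iter in \<open>auto intro: subspace_neg subspace_diff\<close>)
qed

end

section \<open>Projected line searches\<close>

lemma proj_component: "proj I z $ i = (if i \<in> I then max (z $ i) 0 else z $ i)"
  by (simp add: proj_def)

lemma proj_feas: "proj I z \<in> feas I"
  by (simp add: feas_def proj_component)

lemma proj_id: "x \<in> feas I \<Longrightarrow> proj I x = x"
  by (simp add: feas_def vec_eq_iff proj_component)

lemma Jplus_feas:
  assumes "x \<in> feas I"
  shows "i \<in> Jplus I e x \<longleftrightarrow> i \<in> I \<and> x $ i \<le> e"
  using assms by (auto simp: Jplus_def feas_def)

lemma projected_path_tendsto:
  assumes "x \<in> feas I" "0 \<le> \<theta>" "\<theta> < 1"
  shows "(\<lambda>m. proj I (x + \<theta> ^ m *\<^sub>R d)) \<longlonglongrightarrow> x"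
proof (rule vec_tendstoI)
  fix i
  have "(\<lambda>m. x $ i + \<theta> ^ m * d $ i) \<longlonglongrightarrow> x $ i + 0 * d $ i"
    using assms by (intro tendsto_intros LIMSEQ_realpow_zero)
  then have lim: "(\<lambda>m. x $ i + \<theta> ^ m * d $ i) \<longlonglongrightarrow> x $ i" by simp
  show "(\<lambda>m. proj I (x + \<theta> ^ m *\<^sub>R d) $ i) \<longlonglongrightarrow> x $ i"
  proof (cases "i \<in> I")
    case True
    have "(\<lambda>m. max (x $ i + \<theta> ^ m * d $ i) 0) \<longlonglongrightarrow> max (x $ i) 0"
      using lim by (intro tendsto_max tendsto_const)
    then show ?thesis using True assms(1) by (simp add: proj_component feas_def)
  qed (use lim in \<open>simp add: proj_component\<close>)
qed

text \<open>Rejection forces the step to be long, while trial points approach \<open>x\<close> and hence enter the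
  open set \<open>D\<close>. So an acceptable exponent exists, and only then does \<open>LEAST\<close> have a meaning.
  The conclusion \<open>b \<le> 1\<close> records that the step length before the accepted one was at most 1.\<close>

lemma backtracking_step_bound:
  fixes \<theta> b :: real and acc :: "nat \<Rightarrow> bool" and tr :: "nat \<Rightarrow> 'a :: topological_space"
  assumes \<theta>: "0 < \<theta>" "\<theta> < 1" and b: "0 < b"
    and rejected: "\<And>m. tr m \<in> D \<Longrightarrow> \<not> acc m \<Longrightarrow> b \<le> \<theta> ^ m"
    and D: "open D" "x \<in> D" "tr \<longlonglongrightarrow> x"
    and visited: "\<And>m. m \<le> (LEAST m. acc m) \<Longrightarrow> tr m \<in> D"
  shows "acc (LEAST m. acc m)"
    and "(LEAST m. acc m) = 0 \<or> b \<le> 1 \<and> \<theta> * b \<le> \<theta> ^ (LEAST m. acc m)"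
proof -
  have "(\<lambda>m. \<theta> ^ m) \<longlonglongrightarrow> 0" using \<theta> by (intro LIMSEQ_realpow_zero) auto
  then have "\<forall>\<^sub>F m in sequentially. \<theta> ^ m < b" using b by (rule order_tendstoD)
  moreover have "\<forall>\<^sub>F m in sequentially. tr m \<in> D" using D(3,1,2) by (rule topological_tendstoD)
  ultimately have "\<forall>\<^sub>F m in sequentially. acc m"
    by eventually_elim (use rejected in fastforce)
  then have "\<exists>m. acc m" by (metis eventually_sequentially order_refl)
  then show "acc (LEAST m. acc m)" by (rule LeastI_ex)
  show "(LEAST m. acc m) = 0 \<or> b \<le> 1 \<and> \<theta> * b \<le> \<theta> ^ (LEAST m. acc m)"
  proof (cases "LEAST m. acc m")
    case (Suc k)
    then have "\<not> acc k" using not_less_Least[of k acc] by simp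
    then have bk: "b \<le> \<theta> ^ k" using visited[of k] Suc by (intro rejected) auto
    also have "\<theta> ^ k \<le> 1" using \<theta> by (intro power_le_one) auto
    finally show ?thesis using bk \<theta> Suc by simp
  qed simp
qed

lemma sgn1_mult_self: "sgn1 z * z = \<bar>z\<bar>"
  by (simp add: sgn1_def)

lemma abs_sgn1 [simp]: "\<bar>sgn1 z\<bar> = 1"
  by (simp add: sgn1_def)

lemma quad_scaleR: "quad A (c *\<^sub>R v) = c\<^sup>2 * quad A v"
  by (simp add: quad_def matrix_vector_mult_scaleR power2_eq_square)

text \<open>The scaling makes the length of \<open>d\<close> equal to the negative curvature along it, so
  that the quadratic and the cubic term of the Taylor bound have the same order.\<close>

lemma scaled_negative_curvature_direction:
  assumes t: "t \<noteq> 0" and neg: "quad A t < 0"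
    and d: "d = - (sgn1 s * (\<bar>quad A t\<bar> / (norm t)\<^sup>2)) *\<^sub>R ((1 / norm t) *\<^sub>R t)"
  shows "norm d = \<bar>quad A t\<bar> / (norm t)\<^sup>2" "quad A d = - (norm d ^ 3)"
proof -
  have n: "0 < norm t" using t by simp
  show nd: "norm d = \<bar>quad A t\<bar> / (norm t)\<^sup>2" using n by (simp add: d abs_mult)
  have "quad A d = (norm d)\<^sup>2 * (quad A t / (norm t)\<^sup>2)"
  proof -
    have "(sgn1 s)\<^sup>2 = 1" by (simp add: sgn1_def)
    then show ?thesis unfolding nd unfolding d quad_scaleR
      by (simp add: power_mult_distrib power_divide)
  qed
  also have "quad A t / (norm t)\<^sup>2 = - norm d" unfolding nd using neg by simp
  finally show "quad A d = - (norm d ^ 3)" by (simp add: power3_eq_cube power2_eq_square)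
qed

lemma projected_gradient_component:
  fixes x g a :: real
  assumes "z = x - a * g \<or> (z = 0 \<and> 0 \<le> x \<and> x - a * g \<le> 0)"
  shows "(x - z)\<^sup>2 \<le> a * ((x - z) * g)"
  using assms
proof
  assume "z = 0 \<and> 0 \<le> x \<and> x - a * g \<le> 0"
  then show ?thesis using mult_left_mono[of x "a * g" x] by (simp add: power2_eq_square mult_ac)
qed (simp add: power2_eq_square)

lemma norm_sq_sum: "(norm (v :: real ^ 'n))\<^sup>2 = (\<Sum>i\<in>UNIV. (v $ i)\<^sup>2)"
  unfolding power2_norm_eq_inner inner_vec_def by (simp add: power2_eq_square)

text \<open>The variational inequality of the projection, componentwise.\<close>

lemma projected_gradient_displacement:
  assumes x: "x \<in> feas I" and a: "0 < a" and z: "z = proj I (x - a *\<^sub>R g)"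
  shows "(x $ i - z $ i)\<^sup>2 \<le> a * ((x $ i - z $ i) * g $ i)"
    and "0 \<le> (x $ i - z $ i) * g $ i"
    and "(norm (x - z))\<^sup>2 \<le> a * ((x - z) \<bullet> g)"
proof -
  have *: "(x $ i - z $ i)\<^sup>2 \<le> a * ((x $ i - z $ i) * g $ i)" for i
    using x by (intro projected_gradient_component) (auto simp: z proj_component feas_def)
  then show "(x $ i - z $ i)\<^sup>2 \<le> a * ((x $ i - z $ i) * g $ i)" .
  have "0 \<le> a * ((x $ i - z $ i) * g $ i)" using * by (rule order_trans[OF zero_le_power2])
  then show "0 \<le> (x $ i - z $ i) * g $ i" using a by (simp add: zero_le_mult_iff)
  show "(norm (x - z))\<^sup>2 \<le> a * ((x - z) \<bullet> g)"
    using sum_mono[of UNIV, OF *] by (simp add: norm_sq_sum inner_vec_def sum_distrib_left)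
qed

text \<open>A component with a very negative gradient moves freely. Otherwise the scaled gradient is
  large: a free component contributes \<open>a\<close> times its squared gradient, which exceeds the squared scaled
  gradient divided by \<open>e\<^sup>2\<close> since the component is at most \<open>e\<close>; a component stopped at its bound
  contributes the scaled gradient itself, which is either large on its own or at least its
  square divided by \<open>e\<^sup>2\<close>.\<close>

lemma gp_case_displacement:
  fixes f :: "real ^ 'n \<Rightarrow> real"
  assumes gp: "gp_case f I e x" and x: "x \<in> feas I" and e: "0 < e" "e < 1"
    and a: "0 < a" "a \<le> 1" and z: "z = proj I (x - a *\<^sub>R grad f x)"
  shows "a * e ^ 3 \<le> (x - z) \<bullet> grad f x"
proof -
  let ?g = "grad f x"
  define t where "t i = (x $ i - z $ i) * ?g $ i" for i
  have t_nonneg: "0 \<le> t i" for i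
    unfolding t_def by (rule projected_gradient_displacement(2)[OF x a(1) z])
  have total: "(x - z) \<bullet> ?g = (\<Sum>i\<in>UNIV. t i)" by (simp add: inner_vec_def t_def)
  have single: "a * e ^ 3 \<le> (x - z) \<bullet> ?g" if "a * e ^ 3 \<le> t i" for i
    using that member_le_sum[of i UNIV t] t_nonneg total by simp
  have e32: "e ^ 3 \<le> e\<^sup>2" using e by (intro power_decreasing) auto
  have ae: "a * e ^ 3 \<le> e\<^sup>2" using mult_mono[OF a(2) e32] a e by simp
  consider (neg) i where "i \<in> Jplus I e x" "?g $ i < - (e powr (3/2))"
    | (scaled) "e\<^sup>2 < norm (subvec (Jplus I e x) (Smat I e x *v ?g))"
    using gp by (auto simp: gp_case_def)
  then show ?thesis
  proof cases
    case neg
    then have i: "i \<in> I" "0 \<le> x $ i" "?g $ i < 0"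
      by (auto simp: Jplus_def intro: less_le_trans[OF neg(2)])
    have "0 \<le> x $ i - a * ?g $ i" using i a mult_nonneg_nonpos[of a "?g $ i"] by simp
    then have "t i = a * (?g $ i)\<^sup>2"
      using i by (simp add: t_def z proj_component power2_eq_square)
    moreover have "e ^ 3 \<le> (?g $ i)\<^sup>2"
    proof -
      have "e ^ 3 = (e powr (3/2))\<^sup>2"
        using e powr_realpow[of e 3] unfolding power2_eq_square powr_add[symmetric] by simp
      also have "\<dots> \<le> (- ?g $ i)\<^sup>2" using neg(2) by (intro power_mono) auto
      finally show ?thesis by simp
    qed
    ultimately show ?thesis using a by (intro single[of i]) simp
  next
    case scaled
    let ?J = "Jplus I e x"
    show ?thesis
    proof (cases "\<exists>i\<in>?J. x $ i < a * ?g $ i \<and> e\<^sup>2 \<le> x $ i * ?g $ i")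
      case True
      then obtain i where i: "i \<in> ?J" "x $ i < a * ?g $ i" "e\<^sup>2 \<le> x $ i * ?g $ i" by blast
      then have "t i = x $ i * ?g $ i" by (simp add: t_def z proj_component Jplus_def)
      then show ?thesis using i ae by (intro single[of i]) simp
    next
      case False
      have "a / e\<^sup>2 * (x $ i * ?g $ i)\<^sup>2 \<le> t i" if i: "i \<in> ?J" for i
      proof (cases "x $ i < a * ?g $ i")
        case True
        define w where "w = x $ i * ?g $ i"
        have xi: "0 \<le> x $ i" "i \<in> I" using i by (auto simp: Jplus_def)
        have "0 < a * ?g $ i" using True xi by linarith
        then have "0 \<le> ?g $ i" using a by (simp add: zero_less_mult_iff)
        then have w: "0 \<le> w" "w < e\<^sup>2" using False True i xi by (auto simp: w_def not_le)
        have "a / e\<^sup>2 * w\<^sup>2 = a * (w / e\<^sup>2) * w" by (simp add: power2_eq_square)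
        also have "\<dots> \<le> 1 * 1 * w"
          using w a e by (intro mult_right_mono mult_mono) (auto simp: divide_le_eq_1)
        also have "1 * 1 * w = t i" using True xi by (simp add: w_def t_def z proj_component)
        finally show ?thesis by (simp add: w_def)
      next
        case False
        have xi: "0 \<le> x $ i" "x $ i \<le> e" using i by (auto simp: Jplus_def)
        have "a / e\<^sup>2 * (x $ i * ?g $ i)\<^sup>2 = a * (?g $ i)\<^sup>2 * ((x $ i)\<^sup>2 / e\<^sup>2)"
          by (simp add: power_mult_distrib)
        also have "\<dots> \<le> a * (?g $ i)\<^sup>2 * 1"
          using xi a e by (intro mult_left_mono) (auto simp: divide_le_eq_1 power_mono)
        also have "\<dots> = t i" using False i
          by (simp add: t_def z proj_component Jplus_def power2_eq_square)
        finally show ?thesis .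
      qed
      then have "(\<Sum>i\<in>?J. a / e\<^sup>2 * (x $ i * ?g $ i)\<^sup>2) \<le> (\<Sum>i\<in>?J. t i)" by (rule sum_mono)
      also have "\<dots> \<le> (\<Sum>i\<in>UNIV. t i)" using t_nonneg by (intro sum_mono2) auto
      finally have "a / e\<^sup>2 * (\<Sum>i\<in>?J. (x $ i * ?g $ i)\<^sup>2) \<le> (x - z) \<bullet> ?g"
        by (simp add: total sum_distrib_left)
      moreover have "(\<Sum>i\<in>?J. (x $ i * ?g $ i)\<^sup>2) = (norm (subvec ?J (Smat I e x *v ?g)))\<^sup>2"
        unfolding norm_sq_sum by (rule sum.mono_neutral_cong_left) (auto simp: Smat_component)
      moreover have "(e\<^sup>2)\<^sup>2 \<le> (norm (subvec ?J (Smat I e x *v ?g)))\<^sup>2"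
        using scaled by (intro power_mono) auto
      ultimately have "a / e\<^sup>2 * (e\<^sup>2)\<^sup>2 \<le> (x - z) \<bullet> ?g"
        using a e mult_left_mono[of "(e\<^sup>2)\<^sup>2" "(\<Sum>i\<in>?J. (x $ i * ?g $ i)\<^sup>2)" "a / e\<^sup>2"] by simp
      moreover have "a / e\<^sup>2 * (e\<^sup>2)\<^sup>2 = a * e\<^sup>2" using e by (simp add: power2_eq_square)
      moreover have "a * e ^ 3 \<le> a * e\<^sup>2" using e32 a by (intro mult_left_mono) auto
      ultimately show ?thesis by linarith
    qed
  qed
qed

text \<open>Along a direction of curvature \<open>- (n ^ 3)\<close> the model decreases by half of \<open>a\<^sup>2 * n ^ 3\<close>, more than the
  fraction \<open>\<eta>\<close> that is asked for, so only the cubic error can cause a rejection.\<close>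

lemma cubic_rejection_bound:
  assumes f: "twice_cont_diff f" and D: "convex D" "x \<in> D" "x + a *\<^sub>R w \<in> D"
    and L: "0 < L" "\<forall>x\<in>D. \<forall>y\<in>D. op_norm (hess f x - hess f y) \<le> L * norm (x - y)"
    and w: "grad f x \<bullet> w \<le> 0" "quad (hess f x) w \<le> - (n ^ 3)" "norm w \<le> n"
    and n: "0 < n" and a: "0 < a"
    and rejected: "f x - \<eta> * a\<^sup>2 * n ^ 3 \<le> f (x + a *\<^sub>R w)"
  shows "(3 - 6 * \<eta>) / L \<le> a"
proof -
  have "f (x + a *\<^sub>R w) \<le> f x + a * (grad f x \<bullet> w) + 1 / 2 * (a\<^sup>2 * quad (hess f x) w) + L / 6 * (a * norm w) ^ 3"
    using cubic_taylor_bound[OF f D L(2)] a by (simp add: quad_scaleR)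
  also have "\<dots> \<le> f x + 0 + 1 / 2 * (a\<^sup>2 * - (n ^ 3)) + L / 6 * (a * n) ^ 3"
    using w a L(1) by (intro add_mono mult_left_mono power_mono) (auto simp: mult_nonneg_nonpos)
  finally have "- \<eta> * a\<^sup>2 * n ^ 3 \<le> - (1 / 2) * (a\<^sup>2 * n ^ 3) + L / 6 * (a * n) ^ 3"
    using rejected by simp
  then have "(a\<^sup>2 * n ^ 3) * (3 - 6 * \<eta>) \<le> (a\<^sup>2 * n ^ 3) * (L * a)"
    by (simp add: power_mult_distrib power2_eq_square power3_eq_cube algebra_simps)
  then have "3 - 6 * \<eta> \<le> L * a" using a n by simp
  then show ?thesis using L(1) by (simp add: divide_le_eq mult.commute)
qed

text \<open>The direction satisfies the regularised Newton equation when tested against itself. This yields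
  a model decrease of at least \<open>(a + a\<^sup>2 / 2) * e * (norm d)\<^sup>2\<close>. The second-order part pays for the required
  decrease, since \<open>\<eta> \<le> 1 / 2\<close>, and the first-order part has to be eaten up by the cubic error.\<close>

lemma newton_rejection_bound:
  assumes f: "twice_cont_diff f" and D: "convex D" "x \<in> D" "x + a *\<^sub>R d \<in> D"
    and L: "0 < L" "\<forall>x\<in>D. \<forall>y\<in>D. op_norm (hess f x - hess f y) \<le> L * norm (x - y)"
    and curv: "e * (norm d)\<^sup>2 \<le> quad (hess f x) d + 2 * e * (norm d)\<^sup>2"
      "grad f x \<bullet> d = - (quad (hess f x) d + 2 * e * (norm d)\<^sup>2)"
    and d: "d \<noteq> 0" and a: "0 < a" "a \<le> 1" and \<eta>: "\<eta> \<le> 1 / 2" and e: "0 < e"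
    and rejected: "f x - \<eta> * a\<^sup>2 * e * (norm d)\<^sup>2 \<le> f (x + a *\<^sub>R d)"
  shows "6 * e / (L * norm d) \<le> a\<^sup>2"
proof -
  define n where "n = norm d"
  define Q where "Q = quad (hess f x) d + 2 * e * n\<^sup>2"
  have n: "0 < n" using d by (simp add: n_def)
  have "f (x + a *\<^sub>R d) \<le> f x + a * (grad f x \<bullet> d) + 1 / 2 * (a\<^sup>2 * quad (hess f x) d) + L / 6 * (a * n) ^ 3"
    using cubic_taylor_bound[OF f D L(2)] a by (simp add: quad_scaleR n_def)
  then have "- (\<eta> * a\<^sup>2 * (e * n\<^sup>2)) \<le> - (a * (1 - a / 2)) * Q - a\<^sup>2 * (e * n\<^sup>2) + L / 6 * (a * n) ^ 3"
    using rejected curv(2) by (simp add: Q_def n_def algebra_simps power2_eq_square)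
  moreover have "(a * (1 - a / 2)) * (e * n\<^sup>2) \<le> (a * (1 - a / 2)) * Q"
    using a curv(1) by (intro mult_left_mono) (auto simp: Q_def n_def)
  moreover have "\<eta> * (a\<^sup>2 * (e * n\<^sup>2)) \<le> 1 / 2 * (a\<^sup>2 * (e * n\<^sup>2))"
    using \<eta> e by (intro mult_right_mono) auto
  ultimately have "a * (e * n\<^sup>2) \<le> L / 6 * (a * n) ^ 3"
    by (simp add: algebra_simps power2_eq_square)
  then have "(a * n\<^sup>2) * (6 * e) \<le> (a * n\<^sup>2) * (L * (a\<^sup>2 * n))"
    by (simp add: power_mult_distrib power2_eq_square power3_eq_cube algebra_simps)
  then have "6 * e \<le> L * (a\<^sup>2 * n)" using a n by simp
  then show ?thesis using L(1) n by (simp add: divide_le_eq mult_ac n_def)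
qed

section \<open>Decrease in each kind of step\<close>

lemma c_sol_le:
  assumes "0 \<le> \<eta>"
  shows "c_sol L \<theta> \<zeta> \<eta> \<le> \<eta> * (4 / (25 + 8 * L))" "c_sol L \<theta> \<zeta> \<eta> \<le> \<eta> * \<theta>\<^sup>2"
    "c_sol L \<theta> \<zeta> \<eta> \<le> \<eta> * (9 * (1 - \<zeta> - 2 * \<eta>)\<^sup>2 * \<theta>\<^sup>2 / L\<^sup>2)"
  unfolding c_sol_def by (rule mult_left_mono[OF Min_le assms]; simp)+

lemma c_nc_le:
  assumes "0 \<le> \<eta>"
  shows "c_nc L \<theta> \<eta> \<le> \<eta> * ((3 - 6 * \<eta>)\<^sup>2 * \<theta>\<^sup>2 / L\<^sup>2)" "c_nc L \<theta> \<eta> \<le> \<eta> * \<theta>\<^sup>2"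
  unfolding c_nc_def by (rule mult_left_mono[OF min.cobounded1 assms] mult_left_mono[OF min.cobounded2 assms])+

lemma rate_constants_pos:
  assumes "0 < Lg" "0 < LH" "0 < \<theta>" "0 < \<zeta>" "\<zeta> < 1" "0 < \<eta>" "\<eta> < (1 - \<zeta>) / 2"
  shows "0 < c_nc LH \<theta> \<eta>" "0 < c_sol LH \<theta> \<zeta> \<eta>"
    "0 < Min {c_nc LH \<theta> \<eta>, 8 * c_sol LH \<theta> \<zeta> \<eta>, 2 * \<theta> / Lg, \<eta>}"
proof -
  show nc: "0 < c_nc LH \<theta> \<eta>" using assms by (simp add: c_nc_def)
  show sol: "0 < c_sol LH \<theta> \<zeta> \<eta>" using assms by (simp add: c_sol_def)
  show "0 < Min {c_nc LH \<theta> \<eta>, 8 * c_sol LH \<theta> \<zeta> \<eta>, 2 * \<theta> / Lg, \<eta>}" using assms nc sol by simp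
qed

text \<open>The data of the problem and the parameters of the method, without a particular run. The set
  \<open>D\<close> carries the Lipschitz conditions.\<close>

locale pncg_problem =
  fixes f :: "real ^ 'n \<Rightarrow> real" and I :: "'n set" and D :: "(real ^ 'n) set"
    and Lg LH \<epsilon>g e \<theta> \<zeta> \<eta> :: real
  assumes f_C2: "twice_cont_diff f" and D_open: "open D" and D_convex: "convex D"
    and Lg: "0 < Lg" "Lg-lipschitz_on D (grad f)"
    and LH: "0 < LH" "\<forall>x\<in>D. \<forall>y\<in>D. op_norm (hess f x - hess f y) \<le> LH * norm (x - y)"
    and \<epsilon>g_pos: "0 < \<epsilon>g" and e: "0 < e" "e < 1" and \<theta>: "0 < \<theta>" "\<theta> < 1"
    and \<zeta>: "0 < \<zeta>" "\<zeta> < 1" and \<eta>: "0 < \<eta>" "\<eta> < (1 - \<zeta>) / 2"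
begin

lemma \<eta>_half: "\<eta> < 1 / 2" "0 < 3 - 6 * \<eta>"
  using \<eta> \<zeta> by auto

abbreviation "trial \<equiv> pncg_trial f I \<epsilon>g e \<theta>"
abbreviation "expo \<equiv> pncg_exponent f I \<epsilon>g e \<theta> \<eta>"

lemma trial_tendsto:
  assumes "x \<in> feas I"
  shows "trial x c v \<longlonglongrightarrow> x"
  unfolding pncg_trial_def using projected_path_tendsto[OF assms] \<theta> by simp

lemma line_search:
  assumes x: "x \<in> feas I" "x \<in> D" and b: "0 < b"
    and rejected: "\<And>m. trial x c v m \<in> D \<Longrightarrow> \<not> pncg_accept f I \<epsilon>g e \<theta> \<eta> x c v m \<Longrightarrow> b \<le> \<theta> ^ m"
    and visited: "\<And>m. m \<le> expo x c v \<Longrightarrow> trial x c v m \<in> D"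
  shows "pncg_accept f I \<epsilon>g e \<theta> \<eta> x c v (expo x c v)"
    and "expo x c v = 0 \<or> b \<le> 1 \<and> \<theta> * b \<le> \<theta> ^ expo x c v"
  using backtracking_step_bound[where acc = "pncg_accept f I \<epsilon>g e \<theta> \<eta> x c v" and tr = "trial x c v",
      OF \<theta> b rejected D_open x(2) trial_tendsto[OF x(1)] visited[unfolded pncg_exponent_def]]
  unfolding pncg_exponent_def by blast+

text \<open>By the variational inequality, the descent lemma leaves at least half of the predicted
  decrease whenever the step length is below \<open>1 / Lg\<close>.\<close>

lemma gp_step:
  assumes x: "x \<in> feas I" "x \<in> D" and gp: "gp_case f I e x"
    and visited: "\<And>m. m \<le> expo x c v \<Longrightarrow> trial x c v m \<in> D"
  shows "min 1 (\<theta> / Lg) / 2 * e ^ 3 \<le> f x - f (trial x c v (expo x c v))"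
proof -
  have tr: "trial x c v m = proj I (x - \<theta> ^ m *\<^sub>R grad f x)" for m
    using gp by (simp add: pncg_trial_def pncg_move_def meo_case_def pncg_dir_def)
  let ?q = "\<lambda>m. (x - trial x c v m) \<bullet> grad f x"
  have acc: "pncg_accept f I \<epsilon>g e \<theta> \<eta> x c v m \<longleftrightarrow> f (trial x c v m) < f x - 1/2 * ?q m" for m
    using gp by (simp add: pncg_accept_def Let_def)
  have pw: "0 < \<theta> ^ m" "\<theta> ^ m \<le> 1" for m using \<theta> by (auto intro: power_le_one)
  have q: "\<theta> ^ m * e ^ 3 \<le> ?q m" for m
    using gp_case_displacement[OF gp x(1) e pw tr] .
  have qpos: "0 < ?q m" for m using q[of m] pw(1)[of m] e by (smt (verit) mult_pos_pos zero_less_power)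
  have rejected: "1 / Lg \<le> \<theta> ^ m"
    if m: "trial x c v m \<in> D" "\<not> pncg_accept f I \<epsilon>g e \<theta> \<eta> x c v m" for m
  proof -
    let ?z = "trial x c v m"
    have "f (x + (?z - x)) \<le> f x + grad f x \<bullet> (?z - x) + Lg / 2 * (norm (?z - x))\<^sup>2"
      using m by (intro descent_lemma[OF f_C2 D_convex x(2) _ Lg(2)]) simp
    moreover have "grad f x \<bullet> (?z - x) = - ?q m"
      by (simp add: inner_diff_left inner_diff_right inner_commute)
    moreover have "Lg / 2 * (norm (?z - x))\<^sup>2 \<le> Lg / 2 * (\<theta> ^ m * ?q m)"
      using projected_gradient_displacement(3)[OF x(1) pw(1) tr] Lg(1)
      by (intro mult_left_mono) (simp_all add: norm_minus_commute)
    ultimately have "?q m * 1 \<le> ?q m * (Lg * \<theta> ^ m)" using m(2) by (simp add: acc algebra_simps)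
    then have "1 \<le> Lg * \<theta> ^ m" using qpos[of m] by simp
    then show ?thesis using Lg(1) by (simp add: divide_le_eq mult.commute)
  qed
  define M where "M = expo x c v"
  have b: "0 < 1 / Lg" using Lg by simp
  note ls = line_search[OF x b rejected visited, folded M_def]
  have "1/2 * ?q M \<le> f x - f (trial x c v M)" using ls(1) by (simp add: acc)
  moreover have "min 1 (\<theta> / Lg) \<le> \<theta> ^ M"
    using ls(2) by (auto simp: min_def)
  then have "min 1 (\<theta> / Lg) * e ^ 3 \<le> \<theta> ^ M * e ^ 3" using e by (intro mult_right_mono) auto
  ultimately show ?thesis using q[of M] by (simp add: M_def)
qed

text \<open>The three cases in which backtracking along a negative curvature direction can end: the full step, a
  step following one too long for the projection to be inactive, and a step following one rejected by
  \<open>cubic_rejection_bound\<close>. The lower bound \<open>h\<close> on the length \<open>n\<close> is \<open>e\<close> for Capped CG and \<open>e / 2\<close> for the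
  oracle.\<close>

lemma curvature_decrease:
  assumes n: "0 < n" "h \<le> n" "0 < h" and M: "a = 1 \<or> \<theta> * min (e / n) ((3 - 6 * \<eta>) / LH) \<le> a"
    and h: "h \<le> e"
  shows "c_nc LH \<theta> \<eta> * h\<^sup>2 \<le> \<eta> * a\<^sup>2 * n\<^sup>2"
proof -
  have sq: "\<eta> * s\<^sup>2 \<le> \<eta> * a\<^sup>2 * n\<^sup>2" if "0 \<le> s" "s \<le> a * n" for s
  proof -
    have "s\<^sup>2 \<le> (a * n)\<^sup>2" using that by (rule power_mono[rotated])
    then show ?thesis using \<eta> by (simp add: power_mult_distrib mult.assoc)
  qed
  have c2: "c_nc LH \<theta> \<eta> * h\<^sup>2 \<le> \<eta> * (\<theta> * h)\<^sup>2"
    using mult_right_mono[OF c_nc_le(2), of \<eta> "h\<^sup>2" LH \<theta>] \<eta> by (simp add: power_mult_distrib mult_ac)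
  have c1: "c_nc LH \<theta> \<eta> * h\<^sup>2 \<le> \<eta> * (\<theta> * ((3 - 6 * \<eta>) / LH) * h)\<^sup>2"
    using mult_right_mono[OF c_nc_le(1), of \<eta> "h\<^sup>2" LH \<theta>] \<eta> by (simp add: power_mult_distrib power_divide mult_ac)
  consider "a = 1" | "\<theta> * (e / n) \<le> a" | "\<theta> * ((3 - 6 * \<eta>) / LH) \<le> a"
    using M by (auto simp: min_def split: if_splits)
  then show ?thesis
  proof cases
    case 1
    have "\<theta> * h \<le> 1 * n" using \<theta> n by (intro mult_mono) auto
    then have "\<theta> * h \<le> a * n" using 1 by simp
    then show ?thesis using c2 sq[of "\<theta> * h"] \<theta> n by simp
  next
    case 2
    have "\<theta> * h \<le> \<theta> * (e / n) * n" using n h \<theta> by simp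
    also have "\<dots> \<le> a * n" using 2 n by (intro mult_right_mono) auto
    finally show ?thesis using c2 sq[of "\<theta> * h"] \<theta> n by simp
  next
    case 3
    have pos: "0 \<le> \<theta> * ((3 - 6 * \<eta>) / LH)" using \<theta> LH \<eta>_half by simp
    have "\<theta> * ((3 - 6 * \<eta>) / LH) * h \<le> a * n" using 3 n pos by (intro mult_mono) auto
    moreover have "0 \<le> \<theta> * ((3 - 6 * \<eta>) / LH) * h" by (rule mult_nonneg_nonneg[OF pos]) (use n in simp)
    ultimately show ?thesis using c1 sq by fastforce
  qed
qed

lemma c_nc_pos: "0 < c_nc LH \<theta> \<eta>"
  by (rule rate_constants_pos(1)[OF Lg(1) LH(1) \<theta>(1) \<zeta> \<eta>])

text \<open>Scaling by \<open>S\<close> makes each component near its bound move by a multiple of its distance to the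
  bound, so steps up to length \<open>e < 1\<close> stay feasible. Since the entries of \<open>S\<close> near the bounds are at
  most 1, the cubic error is controlled by \<open>d\<close> instead of \<open>S d\<close>.\<close>

lemma meo_step:
  assumes x: "x \<in> feas I" "x \<in> D" and meo: "meo_case f I \<epsilon>g e x"
    and v: "norm v = 1" "quad (scaled_hess f I e x) v \<le> - e / 2"
    and visited: "\<And>m. m \<le> expo x c v \<Longrightarrow> trial x c v m \<in> D"
  shows "c_nc LH \<theta> \<eta> / 8 * e ^ 3 \<le> f x - f (trial x c v (expo x c v))"
proof -
  let ?S = "Smat I e x"
  define d where "d = meo_dir f I e x v"
  define w where "w = ?S *v d"
  define n where "n = norm d"
  have ngp: "\<not> gp_case f I e x" and nncg: "\<not> ncg_case f I \<epsilon>g e x"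
    using meo by (auto simp: meo_case_def)
  have tr: "trial x c v m = proj I (x + \<theta> ^ m *\<^sub>R w)" for m
    using meo ngp nncg by (simp add: pncg_trial_def pncg_move_def pncg_dir_def w_def d_def)
  have acc: "pncg_accept f I \<epsilon>g e \<theta> \<eta> x c v m \<longleftrightarrow> f (trial x c v m) < f x - \<eta> * \<theta> ^ (2 * m) * n ^ 3" for m
    using ngp nncg by (simp add: pncg_accept_def Let_def pncg_dir_def d_def n_def)
  have pw: "0 < \<theta> ^ m" "\<theta> ^ m \<le> 1" for m using \<theta> by (auto intro: power_le_one)
  have neg: "quad (scaled_hess f I e x) v < 0" using v(2) e by simp
  have d': "d = - (sgn1 (grad f x \<bullet> (?S *v v)) * (\<bar>quad (scaled_hess f I e x) v\<bar> / (norm v)\<^sup>2)) *\<^sub>R ((1 / norm v) *\<^sub>R v)"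
    using v(1) by (simp add: d_def meo_dir_def)
  have "v \<noteq> 0" using v(1) by auto
  note dir = scaled_negative_curvature_direction[OF this neg d']
  have n: "e / 2 \<le> n" using dir(1) v neg by (simp add: n_def)
  then have npos: "0 < n" using e by linarith
  have comp: "w $ i = (if i \<in> Jplus I e x then x $ i * d $ i else d $ i)" for i
    by (simp add: w_def Smat_component)
  have di: "\<bar>d $ i\<bar> \<le> n" for i unfolding n_def by (rule component_le_norm_cart)
  have wn: "norm w \<le> n" unfolding n_def
  proof (rule norm_le_componentwise_cart)
    fix i
    show "norm (w $ i) \<le> norm (d $ i)"
    proof (cases "i \<in> Jplus I e x")
      case True
      then have "\<bar>x $ i\<bar> \<le> 1" using e by (auto simp: Jplus_def)
      then show ?thesis using True mult_right_mono[of "\<bar>x $ i\<bar>" 1 "\<bar>d $ i\<bar>"] by (simp add: comp abs_mult)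
    qed (simp add: comp)
  qed
  have gw: "grad f x \<bullet> w \<le> 0"
  proof -
    have "grad f x \<bullet> w = - (\<bar>quad (scaled_hess f I e x) v\<bar> * (sgn1 (grad f x \<bullet> (?S *v v)) * (grad f x \<bullet> (?S *v v))))"
      by (simp add: w_def d_def meo_dir_def linear_neg[OF matrix_vector_mul_linear] matrix_vector_mult_scaleR)
    then show ?thesis by (simp add: sgn1_mult_self)
  qed
  have Hw: "quad (hess f x) w = - (n ^ 3)"
    unfolding w_def quad_scaled_hess[symmetric] using dir(2) by (simp add: n_def)
  have unclamped: "proj I (x + a *\<^sub>R w) = x + a *\<^sub>R w" if a: "0 < a" "a * n \<le> e" for a
  proof (rule proj_id)
    have "0 \<le> x $ i + a * w $ i" if i: "i \<in> I" for i
    proof -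
      have "\<bar>a * d $ i\<bar> \<le> a * n" using di[of i] a by (simp add: abs_mult)
      then have ad: "\<bar>a * d $ i\<bar> \<le> e" using a by linarith
      show ?thesis
      proof (cases "i \<in> Jplus I e x")
        case True
        have "0 \<le> x $ i * (1 + a * d $ i)"
          using ad e x(1) i by (intro mult_nonneg_nonneg) (auto simp: feas_def)
        then show ?thesis using True by (simp add: comp algebra_simps)
      next
        case False
        then show ?thesis using ad i by (simp add: comp Jplus_feas[OF x(1)])
      qed
    qed
    then show "x + a *\<^sub>R w \<in> feas I" by (simp add: feas_def)
  qed
  define b where "b = min (e / n) ((3 - 6 * \<eta>) / LH)"
  have b: "0 < b" using e npos \<eta>_half LH by (simp add: b_def)
  have rejected: "b \<le> \<theta> ^ m"
    if m: "trial x c v m \<in> D" "\<not> pncg_accept f I \<epsilon>g e \<theta> \<eta> x c v m" for m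
  proof (cases "\<theta> ^ m * n \<le> e")
    case True
    have tm: "trial x c v m = x + \<theta> ^ m *\<^sub>R w" unfolding tr by (rule unclamped[OF pw(1) True])
    have "(3 - 6 * \<eta>) / LH \<le> \<theta> ^ m"
    proof (rule cubic_rejection_bound[OF f_C2 D_convex x(2) _ LH gw _ wn npos pw(1)])
      show "x + \<theta> ^ m *\<^sub>R w \<in> D" using m(1) tm by simp
      show "quad (hess f x) w \<le> - (n ^ 3)" using Hw by simp
      show "f x - \<eta> * (\<theta> ^ m)\<^sup>2 * n ^ 3 \<le> f (x + \<theta> ^ m *\<^sub>R w)"
        using m(2) tm by (simp add: acc power_mult[symmetric] mult.commute[of m])
    qed
    then show ?thesis by (simp add: b_def)
  next
    case False
    then have "e / n \<le> \<theta> ^ m" using npos by (simp add: divide_le_eq)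
    then show ?thesis by (simp add: b_def min_le_iff_disj)
  qed
  define M where "M = expo x c v"
  note ls = line_search[OF x b rejected visited, folded M_def]
  have "\<eta> * (\<theta> ^ M)\<^sup>2 * n ^ 3 \<le> f x - f (trial x c v M)"
    using ls(1) by (simp add: acc power_mult[symmetric] mult.commute[of M])
  moreover have "c_nc LH \<theta> \<eta> * (e / 2)\<^sup>2 \<le> \<eta> * (\<theta> ^ M)\<^sup>2 * n\<^sup>2"
    by (rule curvature_decrease[OF npos n]) (use ls(2) e in \<open>auto simp: b_def\<close>)
  then have "c_nc LH \<theta> \<eta> * (e / 2)\<^sup>2 * (e / 2) \<le> \<eta> * (\<theta> ^ M)\<^sup>2 * n\<^sup>2 * n"
    by (rule mult_mono) (use n e \<eta> in auto)
  ultimately show ?thesis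
    by (simp add: M_def power2_eq_square power3_eq_cube mult.assoc)
qed

text \<open>Only components further than \<open>e\<close> from their bounds, or without bounds, move.\<close>

lemma reduced_step_unclamped:
  assumes x: "x \<in> feas I" and d: "subvec (Jminus I e x) d = d" and a: "0 < a" "a * norm d \<le> e"
  shows "proj I (x + a *\<^sub>R d) = x + a *\<^sub>R d"
proof (rule proj_id)
  have "0 \<le> x $ i + a * d $ i" if i: "i \<in> I" for i
  proof (cases "i \<in> Jplus I e x")
    case True
    have "d $ i = 0" using True arg_cong[OF d, of "\<lambda>u. u $ i"] by (simp add: Jminus_def)
    then show ?thesis using x i by (simp add: feas_def)
  next
    case False
    have "\<bar>a * d $ i\<bar> \<le> a * norm d" using component_le_norm_cart[of d i] a by (simp add: abs_mult)
    then show ?thesis using a False i by (simp add: Jplus_feas[OF x])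
  qed
  then show "x + a *\<^sub>R d \<in> feas I" by (simp add: feas_def)
qed

text \<open>Frozen components stay close to their bounds. Hence the reduced gradient at the new point
  involves no new components.\<close>

lemma Jminus_decreasing:
  assumes x: "x \<in> feas I" and d: "subvec (Jminus I e x) d = d"
  shows "Jminus I e (x + a *\<^sub>R d) \<subseteq> Jminus I e x"
proof -
  have "d $ i = 0" if "i \<in> Jplus I e x" for i
    using that arg_cong[OF d, of "\<lambda>u. u $ i"] by (simp add: Jminus_def)
  then show ?thesis by (auto simp: Jminus_def Jplus_def)
qed

lemma quad_submat: "subvec J d = d \<Longrightarrow> quad (submat J A) d = quad A d"
  by (metis quad_def submat_mult subvec_inner)

lemma ncg_nc_step:
  assumes x: "x \<in> feas I" "x \<in> D" and ncg: "ncg_case f I \<epsilon>g e x"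
    and t: "subvec (Jminus I e x) t = t" "t \<noteq> 0"
      "quad (submat (Jminus I e x) (hess f x)) t < - e * (norm t)\<^sup>2"
    and visited: "\<And>m. m \<le> expo x (t, NC) v \<Longrightarrow> trial x (t, NC) v m \<in> D"
  shows "c_nc LH \<theta> \<eta> * e ^ 3 \<le> f x - f (trial x (t, NC) v (expo x (t, NC) v))"
proof -
  let ?J = "Jminus I e x" and ?c = "(t, NC)"
  define A where "A = submat ?J (hess f x)"
  define d where "d = ncg_dir f I e x ?c"
  define n where "n = norm d"
  have ngp: "\<not> gp_case f I e x" and nmeo: "\<not> meo_case f I \<epsilon>g e x"
    using ncg by (auto simp: meo_case_def ncg_case_def)
  have tr: "trial x ?c v m = proj I (x + \<theta> ^ m *\<^sub>R d)" for m
    using ncg ngp nmeo by (simp add: pncg_trial_def pncg_move_def pncg_dir_def d_def)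
  have acc: "pncg_accept f I \<epsilon>g e \<theta> \<eta> x ?c v m \<longleftrightarrow> f (trial x ?c v m) < f x - \<eta> * (\<theta> ^ m)\<^sup>2 * e * n\<^sup>2" for m
    using ngp ncg
    by (simp add: pncg_accept_def Let_def pncg_dir_def d_def n_def power_mult[symmetric] mult.commute[of m])
  have pw: "0 < \<theta> ^ m" "\<theta> ^ m \<le> 1" for m using \<theta> by (auto intro: power_le_one)
  have tpos: "0 < (norm t)\<^sup>2" using t(2) by simp
  have qt: "quad A t < - (e * (norm t)\<^sup>2)" using t(3) by (simp add: A_def)
  then have neg: "quad A t < 0" using tpos e by (smt (verit) mult_pos_pos)
  define s where "s = t \<bullet> subvec ?J (grad f x)"
  define k where "k = - (sgn1 s * (\<bar>quad A t\<bar> / (norm t)\<^sup>2)) * (1 / norm t)"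
  have dk: "d = k *\<^sub>R t"
    using linear_cmul[OF subvec_linear, of ?J] linear_neg[OF subvec_linear, of ?J] t(1)
    by (simp add: d_def ncg_dir_def A_def k_def s_def Let_def)
  then have d': "d = - (sgn1 s * (\<bar>quad A t\<bar> / (norm t)\<^sup>2)) *\<^sub>R ((1 / norm t) *\<^sub>R t)" by (simp add: k_def)
  note dir = scaled_negative_curvature_direction[OF t(2) neg d']
  have dJ: "subvec ?J d = d" by (simp add: dk linear_cmul[OF subvec_linear] t(1))
  have n: "e \<le> n" using dir(1) qt tpos by (simp add: n_def le_divide_eq)
  then have npos: "0 < n" using e by linarith
  have n3: "n ^ 3 = n\<^sup>2 * n" by (simp add: power2_eq_square power3_eq_cube)
  have gd: "grad f x \<bullet> d \<le> 0"
  proof -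
    have "grad f x \<bullet> d = k * s" by (simp add: dk s_def t(1) inner_commute subvec_inner[symmetric])
    also have "\<dots> = - ((\<bar>quad A t\<bar> / (norm t)\<^sup>2) * (1 / norm t) * (sgn1 s * s))"
      by (simp add: k_def)
    also have "\<dots> \<le> 0" by (simp add: sgn1_mult_self)
    finally show ?thesis .
  qed
  have Hd: "quad (hess f x) d \<le> - (n ^ 3)"
    using dir(2) quad_submat[OF dJ, of "hess f x"] by (simp add: A_def n_def)
  define b where "b = min (e / n) ((3 - 6 * \<eta>) / LH)"
  have b: "0 < b" using e npos \<eta>_half LH by (simp add: b_def)
  have rejected: "b \<le> \<theta> ^ m"
    if m: "trial x ?c v m \<in> D" "\<not> pncg_accept f I \<epsilon>g e \<theta> \<eta> x ?c v m" for m
  proof (cases "\<theta> ^ m * n \<le> e")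
    case True
    have tm: "trial x ?c v m = x + \<theta> ^ m *\<^sub>R d"
      unfolding tr by (rule reduced_step_unclamped[OF x(1) dJ pw(1)]) (use True in \<open>simp add: n_def\<close>)
    have "(3 - 6 * \<eta>) / LH \<le> \<theta> ^ m"
    proof (rule cubic_rejection_bound[OF f_C2 D_convex x(2) _ LH gd Hd _ npos pw(1)])
      show "x + \<theta> ^ m *\<^sub>R d \<in> D" using m(1) tm by simp
      show "norm d \<le> n" by (simp add: n_def)
      have "\<eta> * (\<theta> ^ m)\<^sup>2 * (n\<^sup>2 * e) \<le> \<eta> * (\<theta> ^ m)\<^sup>2 * (n\<^sup>2 * n)"
        using n \<eta> by (intro mult_left_mono) auto
      then show "f x - \<eta> * (\<theta> ^ m)\<^sup>2 * n ^ 3 \<le> f (x + \<theta> ^ m *\<^sub>R d)"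
        using m(2) tm unfolding n3 by (simp add: acc mult_ac)
    qed
    then show ?thesis by (simp add: b_def)
  next
    case False
    then have "e / n \<le> \<theta> ^ m" using npos by (simp add: divide_le_eq)
    then show ?thesis by (simp add: b_def min_le_iff_disj)
  qed
  define M where "M = expo x ?c v"
  note ls = line_search[OF x b rejected visited, folded M_def]
  have "\<eta> * (\<theta> ^ M)\<^sup>2 * n\<^sup>2 * e \<le> f x - f (trial x ?c v M)"
    using ls(1) by (simp add: acc mult_ac)
  moreover have "c_nc LH \<theta> \<eta> * e\<^sup>2 \<le> \<eta> * (\<theta> ^ M)\<^sup>2 * n\<^sup>2"
    by (rule curvature_decrease[OF npos n]) (use ls(2) e in \<open>auto simp: b_def\<close>)
  then have "c_nc LH \<theta> \<eta> * e\<^sup>2 * e \<le> \<eta> * (\<theta> ^ M)\<^sup>2 * n\<^sup>2 * e"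
    using e by (intro mult_right_mono) auto
  ultimately show ?thesis
    by (simp add: M_def power2_eq_square power3_eq_cube mult.assoc)
qed

text \<open>The bound solves the quadratic inequality for \<open>n / \<delta>\<close>, where \<open>\<delta>\<close> is the smaller one of \<open>\<epsilon>g / e\<close> and \<open>e\<close>. Its
  positive root is \<open>4 / (5 + sqrt (25 + 8 * LH))\<close>, at least \<open>2 / sqrt (25 + 8 * LH)\<close>.\<close>

lemma full_newton_step_size:
  assumes n: "0 \<le> n" and g: "\<epsilon>g < LH / 2 * n\<^sup>2 + 5 / 2 * e * n"
  shows "4 / (25 + 8 * LH) * min (\<epsilon>g\<^sup>2 / e\<^sup>2) (e\<^sup>2) \<le> n\<^sup>2"
proof (rule ccontr)
  define \<delta> where "\<delta> = min (\<epsilon>g / e) e"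
  define R where "R = sqrt (25 + 8 * LH)"
  assume "\<not> ?thesis"
  then have "n\<^sup>2 < 4 / (25 + 8 * LH) * min (\<epsilon>g\<^sup>2 / e\<^sup>2) (e\<^sup>2)" by simp
  also have "min (\<epsilon>g\<^sup>2 / e\<^sup>2) (e\<^sup>2) = \<delta>\<^sup>2"
    using \<epsilon>g_pos e power_mono_iff[of "\<epsilon>g / e" e 2]
    by (simp add: \<delta>_def min_def power_divide)
  also have "4 / (25 + 8 * LH) * \<delta>\<^sup>2 = (2 / R * \<delta>)\<^sup>2"
    using LH by (simp add: R_def power_mult_distrib power_divide)
  finally have sq: "n\<^sup>2 < (2 / R * \<delta>)\<^sup>2" .
  have R: "5 \<le> R" "R\<^sup>2 = 25 + 8 * LH" using LH by (auto simp: R_def intro!: real_le_rsqrt)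
  have \<delta>: "0 < \<delta>" "\<delta> \<le> e" "e * \<delta> \<le> \<epsilon>g" using e \<epsilon>g_pos by (auto simp: \<delta>_def min_def field_simps)
  have "0 \<le> 2 / R * \<delta>" using R \<delta> by (intro mult_nonneg_nonneg divide_nonneg_nonneg) linarith+
  with sq have ns: "n < 2 / R * \<delta>" by (rule power_less_imp_less_base)
  have "LH / 2 * n\<^sup>2 + 5 / 2 * e * n \<le> LH / 2 * (2 / R * \<delta>)\<^sup>2 + 5 / 2 * e * (2 / R * \<delta>)"
    using ns n LH sq e by (intro add_mono mult_left_mono) auto
  also have "\<dots> = (2 * LH / R\<^sup>2) * \<delta>\<^sup>2 + (5 / R) * (e * \<delta>)"
    by (simp add: power_mult_distrib power_divide mult_ac)
  also have "\<dots> \<le> (2 * LH / R\<^sup>2) * (e * \<delta>) + (5 / R) * (e * \<delta>)"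
    using LH R \<delta> by (intro add_mono mult_left_mono) (auto simp: power2_eq_square)
  also have "\<dots> = (2 * LH / R\<^sup>2 + 5 / R) * (e * \<delta>)" by (simp add: algebra_simps)
  also have "2 * LH / R\<^sup>2 + 5 / R \<le> 1"
  proof -
    \<comment> \<open>substituting \<open>2 * LH = (R\<^sup>2 - 25) / 4\<close> gives this factorisation\<close>
    have "0 \<le> (3 * R - 5) * (R - 5)" using R by (intro mult_nonneg_nonneg) auto
    then have "2 * LH + 5 * R \<le> R\<^sup>2" using R(2) by (simp add: power2_eq_square algebra_simps)
    then show ?thesis using R(1) by (simp add: field_simps power2_eq_square)
  qed
  then have "(2 * LH / R\<^sup>2 + 5 / R) * (e * \<delta>) \<le> 1 * (e * \<delta>)"
    using e \<delta> by (intro mult_right_mono) auto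
  finally show False using g \<delta> by simp
qed

text \<open>Either backtracking is needed or the step is long, and then the decrease is of order \<open>e ^ 3\<close>; or the
  unit step is accepted with \<open>norm t \<le> e\<close>. In the latter case the new reduced gradient is at most the
  Taylor remainder plus the CG residual plus the regularisation term, so being still larger than
  \<open>\<epsilon>g\<close> forces \<open>t\<close> to be long enough (\<open>full_newton_step_size\<close>).\<close>

lemma ncg_sol_step:
  assumes x: "x \<in> feas I" "x \<in> D" and ncg: "ncg_case f I \<epsilon>g e x"
  defines "A \<equiv> submat (Jminus I e x) (hess f x)" and "g \<equiv> subvec (Jminus I e x) (grad f x)"
  assumes t: "subvec (Jminus I e x) t = t" "t \<noteq> 0"
      "e * (norm t)\<^sup>2 \<le> quad (Hbar A e) t" "g \<bullet> t = - quad (Hbar A e) t"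
      "norm (Hbar A e *v t + g) \<le> \<zeta> / 2 * e * norm t"
    and visited: "\<And>m. m \<le> expo x (t, SOL) v \<Longrightarrow> trial x (t, SOL) v m \<in> D"
  defines "x' \<equiv> trial x (t, SOL) v (expo x (t, SOL) v)"
  shows "f x' \<le> f x"
    and "ncg_case f I \<epsilon>g e x' \<Longrightarrow> c_sol LH \<theta> \<zeta> \<eta> * min (\<epsilon>g\<^sup>2 / e) (e ^ 3) \<le> f x - f x'"
proof -
  let ?J = "Jminus I e x" and ?c = "(t, SOL)"
  define n where "n = norm t"
  have npos: "0 < n" using t(2) by (simp add: n_def)
  have ngp: "\<not> gp_case f I e x" and nmeo: "\<not> meo_case f I \<epsilon>g e x"
    using ncg by (auto simp: meo_case_def ncg_case_def)
  have tr: "trial x ?c v m = proj I (x + \<theta> ^ m *\<^sub>R t)" for m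
    using ncg ngp nmeo t(1) by (simp add: pncg_trial_def pncg_move_def pncg_dir_def ncg_dir_def Let_def)
  have acc: "pncg_accept f I \<epsilon>g e \<theta> \<eta> x ?c v m \<longleftrightarrow> f (trial x ?c v m) < f x - \<eta> * (\<theta> ^ m)\<^sup>2 * e * n\<^sup>2" for m
    using ngp ncg t(1)
    by (simp add: pncg_accept_def Let_def pncg_dir_def ncg_dir_def n_def power_mult[symmetric] mult.commute[of m])
  have pw: "0 < \<theta> ^ m" "\<theta> ^ m \<le> 1" for m using \<theta> by (auto intro: power_le_one)
  have QB: "quad (Hbar A e) t = quad (hess f x) t + 2 * e * (norm t)\<^sup>2"
    by (simp add: quad_Hbar A_def quad_submat[OF t(1)])
  have gt: "grad f x \<bullet> t = - (quad (hess f x) t + 2 * e * (norm t)\<^sup>2)"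
    using t(1,4) QB by (simp add: g_def subvec_inner)
  define b where "b = min (e / n) (sqrt (6 * e / (LH * n)))"
  have b: "0 < b" using e npos LH by (simp add: b_def)
  have rejected: "b \<le> \<theta> ^ m"
    if m: "trial x ?c v m \<in> D" "\<not> pncg_accept f I \<epsilon>g e \<theta> \<eta> x ?c v m" for m
  proof (cases "\<theta> ^ m * n \<le> e")
    case True
    have tm: "trial x ?c v m = x + \<theta> ^ m *\<^sub>R t"
      unfolding tr by (rule reduced_step_unclamped[OF x(1) t(1) pw(1)]) (use True in \<open>simp add: n_def\<close>)
    have "6 * e / (LH * norm t) \<le> (\<theta> ^ m)\<^sup>2"
    proof (rule newton_rejection_bound[OF f_C2 D_convex x(2) _ LH _ gt t(2) pw])
      show "x + \<theta> ^ m *\<^sub>R t \<in> D" using m(1) tm by simp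
      show "e * (norm t)\<^sup>2 \<le> quad (hess f x) t + 2 * e * (norm t)\<^sup>2" using t(3) QB by simp
      show "f x - \<eta> * (\<theta> ^ m)\<^sup>2 * e * (norm t)\<^sup>2 \<le> f (x + \<theta> ^ m *\<^sub>R t)"
        using m(2) tm by (simp add: acc n_def)
    qed (use \<eta>_half e in auto)
    then have "sqrt (6 * e / (LH * n)) \<le> \<theta> ^ m"
      using pw[of m] by (intro real_le_lsqrt) (auto simp: n_def)
    then show ?thesis by (simp add: b_def)
  next
    case False
    then have "e / n \<le> \<theta> ^ m" using npos by (simp add: divide_le_eq)
    then show ?thesis by (simp add: b_def min_le_iff_disj)
  qed
  define M where "M = expo x ?c v"
  have x': "x' = trial x ?c v M" by (simp add: x'_def M_def)
  note ls = line_search[OF x b rejected visited, folded M_def]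
  have dec: "\<eta> * (\<theta> ^ M)\<^sup>2 * e * n\<^sup>2 \<le> f x - f x'" using ls(1) by (simp add: acc x')
  moreover have "0 \<le> \<eta> * (\<theta> ^ M)\<^sup>2 * e * n\<^sup>2" using \<eta> e by simp
  ultimately show "f x' \<le> f x" by linarith
  let ?goal = "c_sol LH \<theta> \<zeta> \<eta> * min (\<epsilon>g\<^sup>2 / e) (e ^ 3) \<le> f x - f x'"
  have c0: "0 \<le> min (\<epsilon>g\<^sup>2 / e) (e ^ 3)" using e by simp
  have viaH: ?goal if k: "c_sol LH \<theta> \<zeta> \<eta> \<le> \<eta> * k" "k * e ^ 3 \<le> (\<theta> ^ M)\<^sup>2 * e * n\<^sup>2" "0 \<le> k" for k
  proof -
    have "c_sol LH \<theta> \<zeta> \<eta> * min (\<epsilon>g\<^sup>2 / e) (e ^ 3) \<le> (\<eta> * k) * min (\<epsilon>g\<^sup>2 / e) (e ^ 3)"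
      using k(1) c0 by (rule mult_right_mono)
    also have "\<dots> \<le> (\<eta> * k) * e ^ 3" using k \<eta> by (intro mult_left_mono) auto
    also have "\<dots> \<le> \<eta> * ((\<theta> ^ M)\<^sup>2 * e * n\<^sup>2)" using k(2) \<eta> by (simp add: mult.assoc)
    finally show ?thesis using dec by (simp add: mult.assoc)
  qed
  have cube: "\<theta>\<^sup>2 * e ^ 3 \<le> (\<theta> ^ M)\<^sup>2 * e * n\<^sup>2" if "\<theta> * e \<le> \<theta> ^ M * n"
  proof -
    have "(\<theta> * e)\<^sup>2 \<le> (\<theta> ^ M * n)\<^sup>2" using that \<theta> e by (intro power_mono) auto
    then have "(\<theta> * e)\<^sup>2 * e \<le> (\<theta> ^ M * n)\<^sup>2 * e" using e by (intro mult_right_mono) auto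
    then show ?thesis by (simp add: power_mult_distrib power2_eq_square power3_eq_cube mult_ac)
  qed
  note \<eta>0 = less_imp_le[OF \<eta>(1)]
  assume ncg': "ncg_case f I \<epsilon>g e x'"
  consider (long) "\<theta> * e \<le> \<theta> ^ M * n"
    | (short) "sqrt (6 * e / (LH * n)) \<le> 1" "\<theta> * sqrt (6 * e / (LH * n)) \<le> \<theta> ^ M"
    | (full) "M = 0" "n \<le> e"
  proof -
    have ?thesis if "M = 0"
    proof (cases "n \<le> e")
      case False
      then have "\<theta> * e \<le> 1 * n" using \<theta> e npos by (intro mult_mono) auto
      then show ?thesis using that long by simp
    qed (use that full in blast)
    moreover have ?thesis if "b \<le> 1" "\<theta> * b \<le> \<theta> ^ M"
    proof (cases "b = e / n")
      case True
      have "\<theta> * e = \<theta> * b * n" using True npos by simp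
      also have "\<dots> \<le> \<theta> ^ M * n" using that npos by (intro mult_right_mono) auto
      finally show ?thesis by (rule long)
    next
      case False
      then have "b = sqrt (6 * e / (LH * n))" by (auto simp: b_def min_def)
      then show ?thesis using short that by simp
    qed
    ultimately show ?thesis using ls(2) by blast
  qed
  then show ?goal
  proof cases
    case long
    show ?thesis by (rule viaH[OF c_sol_le(2)[OF \<eta>0] cube[OF long]]) simp
  next
    case short
    define u where "u = 6 * e / LH"
    have u: "0 < u" using e LH by (simp add: u_def)
    have un: "6 * e / (LH * n) = u / n" by (simp add: u_def)
    \<comment> \<open>the rejected step was at most 1, hence \<open>norm t\<close> is at least \<open>6 * e / LH\<close>\<close>
    have "u / n \<le> 1" using short(1) un u npos by simp
    then have "u \<le> n" using npos by simp
    have "(\<theta> * sqrt (u / n))\<^sup>2 \<le> (\<theta> ^ M)\<^sup>2"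
      using short(2) \<theta> u npos by (intro power_mono) (auto simp: un)
    then have "\<theta>\<^sup>2 * (u / n) \<le> (\<theta> ^ M)\<^sup>2" using u npos by (simp add: power_mult_distrib)
    then have "\<theta>\<^sup>2 * (u / n) * (e * n\<^sup>2) \<le> (\<theta> ^ M)\<^sup>2 * (e * n\<^sup>2)"
      using e by (intro mult_right_mono) auto
    moreover have "\<theta>\<^sup>2 * (u / n) * (e * n\<^sup>2) = \<theta>\<^sup>2 * e * u * n"
      using npos by (simp add: power2_eq_square)
    moreover have "\<theta>\<^sup>2 * e * u * u \<le> \<theta>\<^sup>2 * e * u * n" using \<open>u \<le> n\<close> u e by (intro mult_left_mono) auto
    ultimately have 1: "\<theta>\<^sup>2 * e * u * u \<le> (\<theta> ^ M)\<^sup>2 * e * n\<^sup>2" by simp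
    define k where "k = 9 * (1 - \<zeta> - 2 * \<eta>)\<^sup>2 * \<theta>\<^sup>2 / LH\<^sup>2"
    have "(1 - \<zeta> - 2 * \<eta>)\<^sup>2 \<le> 1" using \<zeta> \<eta> by (intro power_le_one) auto
    then have "9 * (1 - \<zeta> - 2 * \<eta>)\<^sup>2 * (\<theta>\<^sup>2 / LH\<^sup>2 * e ^ 3) \<le> 36 * (\<theta>\<^sup>2 / LH\<^sup>2 * e ^ 3)"
      using e by (intro mult_right_mono) auto
    also have "36 * (\<theta>\<^sup>2 / LH\<^sup>2 * e ^ 3) = \<theta>\<^sup>2 * e * u * u"
      by (simp add: u_def power2_eq_square power3_eq_cube)
    finally have 2: "k * e ^ 3 \<le> \<theta>\<^sup>2 * e * u * u" by (simp add: k_def)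
    have "c_sol LH \<theta> \<zeta> \<eta> \<le> \<eta> * k" unfolding k_def by (rule c_sol_le(3)[OF \<eta>0])
    then show ?thesis by (rule viaH[OF _ order_trans[OF 2 1]]) (simp add: k_def)
  next
    case full
    have xt: "x' = x + t"
      using reduced_step_unclamped[OF x(1) t(1), of 1] full by (simp add: x' tr n_def)
    have xD: "x + t \<in> D" using visited[of M] by (simp add: M_def xt[unfolded x', symmetric])
    have "Jminus I e x' \<subseteq> ?J" using Jminus_decreasing[OF x(1) t(1), of 1] by (simp add: xt)
    then have "norm (subvec (Jminus I e x') (grad f x')) \<le> norm (subvec ?J (grad f x'))"
      by (rule norm_subvec_mono)
    also have "subvec ?J (grad f x') = subvec ?J (grad f (x + t) - grad f x - hess f x *v t)
        + ((Hbar A e *v t + g) + (- 2 * e) *\<^sub>R t)"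
      unfolding Hbar_mult A_def g_def submat_mult t(1) xt
      by (simp add: vec_eq_iff)
    also have "norm \<dots> \<le> norm (grad f (x + t) - grad f x - hess f x *v t) + (\<zeta> / 2 * e * n + 2 * e * n)"
    proof -
      have parts: "norm (Hbar A e *v t + g) \<le> \<zeta> / 2 * e * n" "norm ((- 2 * e) *\<^sub>R t) \<le> 2 * e * n"
        using t(5) e by (simp_all add: n_def)
      have triangle: "norm (u + (v + w)) \<le> norm u + (norm v + norm w)" for u v w :: "real ^ 'n"
        using norm_triangle_ineq[of u "v + w"] norm_triangle_ineq[of v w] by linarith
      show ?thesis by (intro order_trans[OF triangle] add_mono norm_subvec_le parts)
    qed
    also have "\<dots> \<le> LH / 2 * n\<^sup>2 + (1 / 2 * e * n + 2 * e * n)"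
    proof (intro add_mono)
      show "norm (grad f (x + t) - grad f x - hess f x *v t) \<le> LH / 2 * n\<^sup>2"
        unfolding n_def by (rule grad_remainder[OF f_C2 D_convex x(2) xD LH(2)])
      show "\<zeta> / 2 * e * n \<le> 1 / 2 * e * n" using \<zeta> e npos by (intro mult_right_mono) auto
    qed simp
    finally have "norm (subvec (Jminus I e x') (grad f x')) \<le> LH / 2 * n\<^sup>2 + 5 / 2 * e * n" by simp
    then have "\<epsilon>g < LH / 2 * n\<^sup>2 + 5 / 2 * e * n" using ncg' by (simp add: ncg_case_def)
    then have "4 / (25 + 8 * LH) * min (\<epsilon>g\<^sup>2 / e\<^sup>2) (e\<^sup>2) \<le> n\<^sup>2"
      using npos by (intro full_newton_step_size) auto
    then have "4 / (25 + 8 * LH) * min (\<epsilon>g\<^sup>2 / e\<^sup>2) (e\<^sup>2) * e \<le> n\<^sup>2 * e" using e by (intro mult_right_mono) auto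
    moreover have "min (\<epsilon>g\<^sup>2 / e\<^sup>2) (e\<^sup>2) * e = min (\<epsilon>g\<^sup>2 / e) (e ^ 3)"
      using e by (simp add: min_mult_distrib_right power2_eq_square power3_eq_cube)
    ultimately have "4 / (25 + 8 * LH) * min (\<epsilon>g\<^sup>2 / e) (e ^ 3) \<le> n\<^sup>2 * e" by (simp add: mult.assoc)
    then have "\<eta> * (4 / (25 + 8 * LH) * min (\<epsilon>g\<^sup>2 / e) (e ^ 3)) \<le> \<eta> * (n\<^sup>2 * e)"
      using \<eta> by (intro mult_left_mono) auto
    moreover have "c_sol LH \<theta> \<zeta> \<eta> * min (\<epsilon>g\<^sup>2 / e) (e ^ 3) \<le> \<eta> * (4 / (25 + 8 * LH)) * min (\<epsilon>g\<^sup>2 / e) (e ^ 3)"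
      using c_sol_le(1)[OF \<eta>0] c0 by (rule mult_right_mono)
    ultimately show ?thesis using dec full by (simp add: mult_ac)
  qed
qed

end

section \<open>Iteration count\<close>

text \<open>The decrease guaranteed by one or two iterations: with \<open>\<Delta>\<close> the initial gap, the bound
  \<open>K_pncg\<close> is the integer part of \<open>2 * \<Delta> / progress\<close> plus 2. The division by 8 accounts for oracle steps, whose
  directions may be as short as \<open>e / 2\<close>, and the factor 8 at \<open>c_sol\<close> exempts Newton steps from it.\<close>

definition progress :: "real \<Rightarrow> real \<Rightarrow> real \<Rightarrow> real \<Rightarrow> real \<Rightarrow> real \<Rightarrow> real \<Rightarrow> real" where
  "progress Lg LH \<theta> \<zeta> \<eta> \<epsilon>g e =
     Min {c_nc LH \<theta> \<eta>, 8 * c_sol LH \<theta> \<zeta> \<eta>, 2 * \<theta> / Lg, \<eta>} / 8 * min (\<epsilon>g\<^sup>2 / e) (e ^ 3)"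

text \<open>Stopping is defined as stopping for the first time; this eliminates the nested reference.\<close>

lemma pncg_reaches_iff:
  "pncg_reaches f I \<epsilon>g \<epsilon> x a k \<longleftrightarrow> (\<forall>j<k. \<not> (meo_case f I \<epsilon>g (\<epsilon> j) (x j) \<and> a j = None))"
proof
  assume reach: "pncg_reaches f I \<epsilon>g \<epsilon> x a k"
  show "\<forall>j<k. \<not> (meo_case f I \<epsilon>g (\<epsilon> j) (x j) \<and> a j = None)"
  proof (intro allI impI)
    fix j assume "j < k"
    then show "\<not> (meo_case f I \<epsilon>g (\<epsilon> j) (x j) \<and> a j = None)"
    proof (induction j rule: less_induct)
      case (less j)
      then have "\<forall>l<j. \<not> (meo_case f I \<epsilon>g (\<epsilon> l) (x l) \<and> a l = None)" by (meson less_trans)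
      moreover have "\<not> pncg_stops f I \<epsilon>g \<epsilon> x a j" using reach less.prems by (simp add: pncg_reaches_def)
      ultimately show ?case unfolding pncg_stops_def by blast
    qed
  qed
qed (auto simp: pncg_reaches_def pncg_stops_def)

lemma pncg_stops_iff:
  "pncg_stops f I \<epsilon>g \<epsilon> x a k \<longleftrightarrow>
    pncg_reaches f I \<epsilon>g \<epsilon> x a k \<and> meo_case f I \<epsilon>g (\<epsilon> k) (x k) \<and> a k = None"
  by (auto simp: pncg_reaches_iff pncg_stops_def)

context pncg_problem begin

abbreviation "\<rho> \<equiv> progress Lg LH \<theta> \<zeta> \<eta> \<epsilon>g e"

lemma c_sol_pos: "0 < c_sol LH \<theta> \<zeta> \<eta>"
  by (rule rate_constants_pos(2)[OF Lg(1) LH(1) \<theta>(1) \<zeta> \<eta>])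

lemma progress_pos: "0 < \<rho>"
  using c_nc_pos c_sol_pos \<theta> Lg \<eta> \<epsilon>g_pos e by (simp add: progress_def)

lemma progress_le:
  "\<rho> \<le> c_nc LH \<theta> \<eta> / 8 * e ^ 3" "\<rho> \<le> c_sol LH \<theta> \<zeta> \<eta> * min (\<epsilon>g\<^sup>2 / e) (e ^ 3)"
  "\<rho> \<le> min 1 (\<theta> / Lg) / 2 * e ^ 3"
proof -
  let ?S = "{c_nc LH \<theta> \<eta>, 8 * c_sol LH \<theta> \<zeta> \<eta>, 2 * \<theta> / Lg, \<eta>}"
  define s where "s = Min ?S"
  define u where "u = min (\<epsilon>g\<^sup>2 / e) (e ^ 3)"
  have \<rho>: "\<rho> = s / 8 * u" by (simp add: progress_def s_def u_def)
  have le: "s \<le> c" if "c \<in> ?S" for c unfolding s_def using that by (intro Min_le) auto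
  have u: "0 \<le> u" "u \<le> e ^ 3" using e by (auto simp: u_def)
  have via: "\<rho> \<le> c * w" if "s \<le> 8 * c" "0 \<le> c" "u \<le> w" for c w
    unfolding \<rho> using that u by (intro mult_mono) auto
  show "\<rho> \<le> c_nc LH \<theta> \<eta> / 8 * e ^ 3" using c_nc_pos u by (intro via le) (auto intro: le)
  show "\<rho> \<le> c_sol LH \<theta> \<zeta> \<eta> * min (\<epsilon>g\<^sup>2 / e) (e ^ 3)"
    using c_sol_pos by (intro via le) (auto simp: u_def)
  define q where "q = \<theta> / Lg"
  have "s \<le> \<eta>" "s \<le> 2 * q" using le[of \<eta>] le[of "2 * \<theta> / Lg"] by (auto simp: q_def)
  moreover have "0 < q" using \<theta> Lg by (simp add: q_def)
  ultimately show "\<rho> \<le> min 1 (\<theta> / Lg) / 2 * e ^ 3"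
    unfolding q_def[symmetric] using u \<eta>_half \<eta> by (intro via) (auto simp: min_def)
qed

lemma ncg_case_capped_cg:
  assumes x: "x \<in> feas I" and ncg: "ncg_case f I \<epsilon>g e x"
    and Mb: "Mb = 0 \<or> op_norm (submat (Jminus I e x) (hess f x)) \<le> Mb"
  shows "cg_call (submat (Jminus I e x) (hess f x)) (subvec (Jminus I e x) (grad f x)) e \<zeta> Mb"
proof
  show "subvec (Jminus I e x) (grad f x) \<noteq> 0" using ncg \<epsilon>g_pos by (auto simp: ncg_case_def)
  have "0 \<le> op_norm (submat (Jminus I e x) (hess f x))"
    by (simp add: op_norm_def onorm_pos_le matrix_vector_mul_bounded_linear)
  then show "0 \<le> Mb" using Mb by auto
qed (use e \<zeta> in \<open>auto intro: submat_symmetric hess_symmetric[OF f_C2]\<close>)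

lemma subspace_subvec_fixed: "subspace {v. subvec J v = v}"
  by (auto simp: subspace_def linear_0[OF subvec_linear] linear_add[OF subvec_linear] linear_cmul[OF subvec_linear])

text \<open>The two alternatives of the last claim are what pairing iterations needs: an iteration without
  the guaranteed progress is followed by one of a kind that always makes it.\<close>

lemma run_step:
  assumes run: "pncg_run f I \<epsilon>g (\<lambda>_. e) \<theta> \<zeta> \<eta> x0 X Mb c a"
    and visited: "pncg_trial_points f I \<epsilon>g (\<lambda>_. e) \<theta> \<eta> X c a \<subseteq> D"
    and reach: "pncg_reaches f I \<epsilon>g (\<lambda>_. e) X a k" and go: "\<not> pncg_stops f I \<epsilon>g (\<lambda>_. e) X a k"
    and x: "X k \<in> feas I" "X k \<in> D"
  shows "X (Suc k) \<in> feas I" "X (Suc k) \<in> D" "f (X (Suc k)) \<le> f (X k)"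
    and "\<rho> \<le> f (X k) - f (X (Suc k)) \<or> ncg_case f I \<epsilon>g e (X k) \<and> \<not> ncg_case f I \<epsilon>g e (X (Suc k))"
proof -
  let ?x = "X k" and ?c = "c k" and ?v = "the (a k)"
  have next_iterate: "X (Suc k) = trial ?x ?c ?v (expo ?x ?c ?v)"
    using run reach go by (simp add: pncg_run_def)
  have vis: "trial ?x ?c ?v m \<in> D" if "m \<le> expo ?x ?c ?v" for m
    using visited reach go that unfolding pncg_trial_points_def by blast
  show "X (Suc k) \<in> feas I" unfolding next_iterate pncg_trial_def by (rule proj_feas)
  show "X (Suc k) \<in> D" unfolding next_iterate by (rule vis) simp
  have "f (X (Suc k)) \<le> f ?x \<and>
    (\<rho> \<le> f ?x - f (X (Suc k)) \<or> ncg_case f I \<epsilon>g e ?x \<and> \<not> ncg_case f I \<epsilon>g e (X (Suc k)))"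
  proof -
    consider "gp_case f I e ?x" | "ncg_case f I \<epsilon>g e ?x" | "meo_case f I \<epsilon>g e ?x"
      by (auto simp: meo_case_def)
    then show ?thesis
    proof cases
      case 1
      from gp_step[OF x this vis] progress_le(3) progress_pos show ?thesis
        by (simp add: next_iterate)
    next
      case 3
      obtain v where v: "a k = Some v" using 3 reach go by (auto simp: pncg_stops_iff)
      have "norm v = 1" "quad (scaled_hess f I e ?x) v \<le> - e / 2"
        using run reach 3 v by (auto simp: pncg_run_def)
      then have "norm ?v = 1" "quad (scaled_hess f I e ?x) ?v \<le> - e / 2" by (simp_all add: v)
      from meo_step[OF x 3 this vis] progress_le(1) progress_pos show ?thesis
        by (simp add: next_iterate)
    next
      case 2
      let ?J = "Jminus I e ?x"
      let ?H = "submat ?J (hess f ?x)" and ?g = "subvec ?J (grad f ?x)"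
      have Mb: "Mb k = 0 \<or> op_norm ?H \<le> Mb k"
        and result: "(\<exists>t ty. capped_cg ?H ?g e \<zeta> (Mb k) t ty) \<longrightarrow> capped_cg ?H ?g e \<zeta> (Mb k) (fst ?c) (snd ?c)"
        using run reach 2 by (auto simp: pncg_run_def Let_def)
      interpret cg_call ?H ?g e \<zeta> "Mb k" by (rule ncg_case_capped_cg[OF x(1) 2 Mb])
      obtain t ty where c: "?c = (t, ty)" by (cases ?c)
      have cg: "capped_cg ?H ?g e \<zeta> (Mb k) t ty" using result capped_cg_returns by (simp add: c)
      have "t \<in> {v. subvec ?J v = v}"
        by (rule capped_cg_subspace[OF subspace_subvec_fixed _ _ cg]) (auto simp: submat_mult)
      then have tJ: "subvec ?J t = t" by simp
      show ?thesis
      proof (cases ty)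
        case NC
        have "c_nc LH \<theta> \<eta> * e ^ 3 \<le> f ?x - f (X (Suc k))"
          unfolding next_iterate c NC
          by (rule ncg_nc_step[OF x 2 tJ]) (use capped_cg_NC cg vis in \<open>auto simp: c NC\<close>)
        moreover have "0 \<le> c_nc LH \<theta> \<eta> * e ^ 3" using c_nc_pos e by simp
        ultimately show ?thesis using progress_le(1) progress_pos by (simp add: field_simps)
      next
        case SOL
        note sol = capped_cg_SOL[OF cg[unfolded SOL]]
        have vis': "trial ?x (t, SOL) ?v m \<in> D" if "m \<le> expo ?x (t, SOL) ?v" for m
          using vis that by (simp add: c SOL)
        have nx: "X (Suc k) = trial ?x (t, SOL) ?v (expo ?x (t, SOL) ?v)"
          by (simp add: next_iterate c SOL)
        have "f (X (Suc k)) \<le> f ?x" unfolding nx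
          by (rule ncg_sol_step(1)[OF x 2 tJ sol(4,1,2,3)]) (rule vis')
        moreover have "c_sol LH \<theta> \<zeta> \<eta> * min (\<epsilon>g\<^sup>2 / e) (e ^ 3) \<le> f ?x - f (X (Suc k))"
          if "ncg_case f I \<epsilon>g e (X (Suc k))" using that unfolding nx
          by (intro ncg_sol_step(2)[OF x 2 tJ sol(4,1,2,3)] vis')
        ultimately show ?thesis using progress_le(2) 2 by force
      qed
    qed
  qed
  then show "f (X (Suc k)) \<le> f ?x"
    "\<rho> \<le> f ?x - f (X (Suc k)) \<or> ncg_case f I \<epsilon>g e ?x \<and> \<not> ncg_case f I \<epsilon>g e (X (Suc k))"
    by auto
qed

lemma run_invariant:
  assumes run: "pncg_run f I \<epsilon>g (\<lambda>_. e) \<theta> \<zeta> \<eta> x0 X Mb c a"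
    and visited: "pncg_trial_points f I \<epsilon>g (\<lambda>_. e) \<theta> \<eta> X c a \<subseteq> D"
    and x0: "x0 \<in> feas I" "x0 \<in> D"
    and "pncg_reaches f I \<epsilon>g (\<lambda>_. e) X a k"
  shows "X k \<in> feas I \<and> X k \<in> D"
  using assms(5)
proof (induction k)
  case 0
  then show ?case using run x0 by (simp add: pncg_run_def)
next
  case (Suc k)
  then have "pncg_reaches f I \<epsilon>g (\<lambda>_. e) X a k" "\<not> pncg_stops f I \<epsilon>g (\<lambda>_. e) X a k"
    by (auto simp: pncg_reaches_def)
  then show ?case using run_step(1,2)[OF run visited] Suc.IH by blast
qed

text \<open>Among \<open>K\<close> consecutive iterations there are \<open>K div 2\<close> disjoint pairs, each
  decreasing \<open>f\<close> by \<open>\<rho>\<close>. The value of \<open>K\<close> makes this exceed the available gap; the summand 2 compensates for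
  rounding in the floor and in the halving.\<close>

lemma run_terminates:
  assumes run: "pncg_run f I \<epsilon>g (\<lambda>_. e) \<theta> \<zeta> \<eta> x0 X Mb c a"
    and visited: "pncg_trial_points f I \<epsilon>g (\<lambda>_. e) \<theta> \<eta> X c a \<subseteq> D"
    and x0: "x0 \<in> feas I" "x0 \<in> D" and low: "\<forall>x \<in> feas I. f_low \<le> f x"
  shows "\<exists>k < K_pncg (f x0 - f_low) Lg LH \<theta> \<zeta> \<eta> \<epsilon>g e. pncg_stops f I \<epsilon>g (\<lambda>_. e) X a k \<and> X k \<in> feas I"
proof -
  define \<Delta> where "\<Delta> = f x0 - f_low"
  define K where "K = K_pncg \<Delta> Lg LH \<theta> \<zeta> \<eta> \<epsilon>g e"
  have "\<exists>k<K. pncg_stops f I \<epsilon>g (\<lambda>_. e) X a k"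
  proof (rule ccontr)
    assume "\<not> ?thesis"
    then have go: "\<not> pncg_stops f I \<epsilon>g (\<lambda>_. e) X a k" if "k < K" for k using that by blast
    then have reach: "pncg_reaches f I \<epsilon>g (\<lambda>_. e) X a k" if "k \<le> K" for k
      using that by (auto simp: pncg_reaches_def)
    note inv = run_invariant[OF run visited x0 reach]
    note step = run_step[OF run visited reach go]
    have two: "f (X (Suc (Suc k))) \<le> f (X k) - \<rho>" if "Suc (Suc k) \<le> K" for k
    proof -
      have k: "k \<le> K" "k < K" "Suc k \<le> K" "Suc k < K" using that by auto
      have "f (X (Suc k)) \<le> f (X k)" "f (X (Suc (Suc k))) \<le> f (X (Suc k))"
        using step(3)[OF k(1,2)] step(3)[OF k(3,4)] inv k by auto
      moreover have "\<rho> \<le> f (X k) - f (X (Suc k)) \<or> \<not> ncg_case f I \<epsilon>g e (X (Suc k))"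
        "\<rho> \<le> f (X (Suc k)) - f (X (Suc (Suc k))) \<or> ncg_case f I \<epsilon>g e (X (Suc k))"
        using step(4)[OF k(1,2)] step(4)[OF k(3,4)] inv k by auto
      ultimately show ?thesis by argo
    qed
    have dec: "f (X (2 * j)) \<le> f x0 - real j * \<rho>" if "2 * j \<le> K" for j using that
    proof (induction j)
      case 0
      then show ?case using run by (simp add: pncg_run_def)
    next
      case (Suc j)
      then show ?case using two[of "2 * j"] by (simp add: algebra_simps)
    qed
    define s where "s = Min {c_nc LH \<theta> \<eta>, 8 * c_sol LH \<theta> \<zeta> \<eta>, 2 * \<theta> / Lg, \<eta>}"
    have s: "0 < s" using c_nc_pos c_sol_pos \<theta> Lg \<eta> by (simp add: s_def)
    have max: "max (e / \<epsilon>g\<^sup>2) (1 / e ^ 3) = 1 / min (\<epsilon>g\<^sup>2 / e) (e ^ 3)"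
      using e \<epsilon>g_pos by (simp add: min_def max_def field_simps)
    have "16 * \<Delta> / s * max (e / \<epsilon>g\<^sup>2) (1 / e ^ 3) = 2 * \<Delta> / \<rho>"
      unfolding max progress_def s_def[symmetric] by simp
    then have K: "K = nat \<lfloor>2 * \<Delta> / \<rho>\<rfloor> + 2" by (simp add: K_def K_pncg_def s_def)
    define j where "j = K div 2"
    have j: "2 * j \<le> K" "K \<le> 2 * j + 1" by (auto simp: j_def)
    have "f_low \<le> f (X (2 * j))" using inv[OF j(1)] low by auto
    then have "real j * \<rho> \<le> \<Delta>" using dec[OF j(1)] by (simp add: \<Delta>_def)
    moreover have "2 * \<Delta> / \<rho> < 2 * real j"
    proof -
      have "2 * \<Delta> / \<rho> < real_of_int \<lfloor>2 * \<Delta> / \<rho>\<rfloor> + 1" by linarith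
      also have "\<dots> \<le> real (nat \<lfloor>2 * \<Delta> / \<rho>\<rfloor>) + 1" by linarith
      also have "\<dots> \<le> 2 * real j" using j(2) K by linarith
      finally show ?thesis .
    qed
    then have "\<Delta> < real j * \<rho>" using progress_pos by (simp add: divide_less_eq)
    ultimately show False by simp
  qed
  then obtain k where k: "k < K" "pncg_stops f I \<epsilon>g (\<lambda>_. e) X a k" by blast
  then have "pncg_reaches f I \<epsilon>g (\<lambda>_. e) X a k" by (auto simp: pncg_reaches_def pncg_stops_def)
  then show ?thesis using run_invariant[OF run visited x0] k by (auto simp: K_def \<Delta>_def)
qed

lemma meo_case_first_order:
  assumes "meo_case f I \<epsilon>g e x"
  shows "norm (Smat I e x *v grad f x) \<le> \<epsilon>g + e\<^sup>2"
    and "\<forall>i \<in> Jplus I e x. - (e powr (3/2)) \<le> grad f x $ i"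
proof -
  let ?P = "Jplus I e x" and ?M = "Jminus I e x" and ?Sg = "Smat I e x *v grad f x"
  have ngp: "\<not> gp_case f I e x" and nncg: "\<not> ncg_case f I \<epsilon>g e x"
    using assms by (auto simp: meo_case_def)
  show "\<forall>i \<in> ?P. - (e powr (3/2)) \<le> grad f x $ i" using ngp by (auto simp: gp_case_def not_less)
  have empty: "subvec {} u = 0" for u :: "real ^ 'n" by (simp add: vec_eq_iff)
  have "?Sg = subvec ?M (grad f x) + subvec ?P ?Sg"
    by (auto simp: vec_eq_iff Jminus_def Smat_component)
  then have "norm ?Sg \<le> norm (subvec ?M (grad f x)) + norm (subvec ?P ?Sg)"
    by (metis norm_triangle_ineq)
  moreover have "norm (subvec ?P ?Sg) \<le> e\<^sup>2"
    using ngp by (cases "?P = {}") (auto simp: gp_case_def empty not_less)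
  moreover have "norm (subvec ?M (grad f x)) \<le> \<epsilon>g"
    using nncg ngp \<epsilon>g_pos by (cases "?M = {}") (auto simp: ncg_case_def empty not_less)
  ultimately show "norm ?Sg \<le> \<epsilon>g + e\<^sup>2" by simp
qed

end

section \<open>Reliability of the eigenvalue oracle\<close>

text \<open>The event that the first \<open>n\<close> events have not occurred belongs to the history before the next one, so
  integrating the conditional bound over it multiplies its probability by at least \<open>1 - \<delta>\<close>.\<close>

lemma (in prob_space) prob_no_conditional_failure:
  assumes sub: "\<And>k. subalgebra M (F k)" and mono: "\<And>i j. i \<le> j \<Longrightarrow> sets (F i) \<subseteq> sets (F j)"
    and B: "\<And>k. B k \<in> sets (F (Suc k))"
    and cond: "\<And>k. AE \<omega> in M. real_cond_exp M (F k) (indicator (B k)) \<omega> \<le> \<delta>"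
    and \<delta>: "\<delta> \<le> 1"
  shows "(1 - \<delta>) ^ n \<le> prob (space M - (\<Union>k<n. B k))"
proof (induction n)
  case 0
  show ?case by (simp add: prob_space)
next
  case (Suc n)
  define E where "E = space M - (\<Union>k<n. B k)"
  have space_F: "space (F k) = space M" for k using sub[of k] by (simp add: subalgebra_def)
  have B_M: "B k \<in> sets M" for k using B[of k] sub[of "Suc k"] by (auto simp: subalgebra_def)
  have E_F: "E \<in> sets (F n)"
  proof -
    have "B k \<in> sets (F n)" if "k < n" for k using B[of k] mono[of "Suc k" n] that by auto
    then have "space (F n) - (\<Union>k<n. B k) \<in> sets (F n)" by auto
    then show ?thesis by (simp add: E_def space_F)
  qed
  then have E_M: "E \<in> sets M" using sub[of n] by (auto simp: subalgebra_def)
  have "finite_measure_subalgebra M (F n)"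
    using sub[of n] by (simp add: finite_measure_subalgebra_def finite_measure_subalgebra_axioms_def finite_measure_axioms)
  then interpret S: finite_measure_subalgebra M "F n" .
  have indicator_int: "integrable M (indicat_real S)" if "S \<in> sets M" for S
    using that by (auto simp: emeasure_eq_measure)
  note int = indicator_int[OF B_M[of n]]
  have "prob (E \<inter> B n) = (\<integral>\<omega>\<in>E. indicat_real (B n) \<omega> \<partial>M)"
    using E_M B_M[of n] by (simp add: set_lebesgue_integral_def indicator_inter_arith[symmetric])
  also have "\<dots> = (\<integral>\<omega>\<in>E. real_cond_exp M (F n) (indicat_real (B n)) \<omega> \<partial>M)"
    by (rule S.real_cond_exp_intA[OF int E_F])
  also have "\<dots> \<le> (\<integral>\<omega>\<in>E. \<delta> \<partial>M)"
  proof (rule set_integral_mono_AE)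
    show "set_integrable M E (real_cond_exp M (F n) (indicat_real (B n)))"
      unfolding set_integrable_def
      by (intro integrable_mult_indicator E_M S.real_cond_exp_int(1) int)
    show "set_integrable M E (\<lambda>_. \<delta>)" using E_M indicator_int[OF E_M] by (simp add: set_integrable_def)
    show "AE \<omega>\<in>E in M. real_cond_exp M (F n) (indicat_real (B n)) \<omega> \<le> \<delta>"
      using cond[of n] by eventually_elim simp
  qed
  also have "\<dots> = \<delta> * prob E" using E_M by (simp add: set_lebesgue_integral_def mult.commute)
  finally have fail: "prob (E \<inter> B n) \<le> \<delta> * prob E" .
  have "(1 - \<delta>) ^ Suc n \<le> (1 - \<delta>) * prob E"
    using Suc.IH \<delta> by (simp add: E_def mult_left_mono)
  also have "\<dots> \<le> prob E - prob (E \<inter> B n)" using fail by (simp add: algebra_simps)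
  also have "\<dots> = prob (E - E \<inter> B n)" using E_M B_M[of n] by (subst finite_measure_Diff) auto
  also have "E - E \<inter> B n = space M - (\<Union>k<Suc n. B k)" by (auto simp: E_def less_Suc_eq)
  finally show ?case .
qed

lemma borel_measurable_vec_component [measurable]: "(\<lambda>x :: real ^ 'n. x $ i) \<in> borel_measurable borel"
  by (intro borel_measurable_continuous_onI continuous_intros)

lemma borel_measurable_grad_component:
  assumes "twice_cont_diff f"
  shows "(\<lambda>x. grad f x $ i) \<in> borel_measurable borel"
proof -
  have "continuous_on UNIV (grad f)"
    using assms by (auto simp: twice_cont_diff_def continuous_on_eq_continuous_at
        intro: differentiable_imp_continuous_within)
  then show ?thesis by (intro borel_measurable_continuous_onI continuous_intros)
qed

lemma borel_measurable_hess_component: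
  assumes "twice_cont_diff f"
  shows "(\<lambda>x. hess f x $ i $ j) \<in> borel_measurable borel"
  using assms by (intro borel_measurable_continuous_onI continuous_intros) (auto simp: twice_cont_diff_def)

lemma norm_vec_sqrt: "norm (v :: real ^ 'n) = sqrt (\<Sum>i\<in>UNIV. (v $ i)\<^sup>2)"
  by (simp add: norm_vec_def L2_set_def)

lemma Jplus_mem: "i \<in> Jplus I e x \<longleftrightarrow> i \<in> I \<and> 0 \<le> x $ i \<and> x $ i \<le> e"
  by (simp add: Jplus_def)

text \<open>The index sets vary with \<open>x\<close>, but each membership is a closed condition on a coordinate; quantifiers over
  the finite index type and guarded sums make the test visibly measurable.\<close>

lemma sets_gp_case:
  assumes "twice_cont_diff f"
  shows "{x. gp_case f I e x} \<in> sets borel"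
proof -
  note [measurable] = borel_measurable_grad_component[OF assms]
  have eq: "gp_case f I e x \<longleftrightarrow> (\<exists>i. i \<in> I \<and> 0 \<le> x $ i \<and> x $ i \<le> e) \<and>
    ((\<exists>i. (i \<in> I \<and> 0 \<le> x $ i \<and> x $ i \<le> e) \<and> grad f x $ i < - (e powr (3/2))) \<or>
     e\<^sup>2 < sqrt (\<Sum>i\<in>UNIV. (if i \<in> I \<and> 0 \<le> x $ i \<and> x $ i \<le> e then x $ i * grad f x $ i else 0)\<^sup>2))" for x
    unfolding gp_case_def norm_vec_sqrt subvec_component Smat_component Jplus_mem[symmetric]
    by (auto cong: if_cong)
  show ?thesis unfolding eq by measurable
qed

lemma sets_ncg_case:
  assumes "twice_cont_diff f"
  shows "{x. ncg_case f I \<epsilon>g e x} \<in> sets borel"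
proof -
  note [measurable] = borel_measurable_grad_component[OF assms] sets_gp_case[OF assms, of I e]
  have eq: "ncg_case f I \<epsilon>g e x \<longleftrightarrow> x \<notin> {x. gp_case f I e x} \<and>
    (\<exists>i. \<not> (i \<in> I \<and> 0 \<le> x $ i \<and> x $ i \<le> e)) \<and>
     \<epsilon>g < sqrt (\<Sum>i\<in>UNIV. (if \<not> (i \<in> I \<and> 0 \<le> x $ i \<and> x $ i \<le> e) then grad f x $ i else 0)\<^sup>2)" for x
    unfolding ncg_case_def norm_vec_sqrt subvec_component Jminus_def Jplus_mem[symmetric] Compl_iff
    by blast
  show ?thesis unfolding eq by measurable
qed

lemma sets_meo_case:
  assumes "twice_cont_diff f"
  shows "{x. meo_case f I \<epsilon>g e x} \<in> sets borel"
proof -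
  have "{x. meo_case f I \<epsilon>g e x} = - ({x. gp_case f I e x} \<union> {x. ncg_case f I \<epsilon>g e x})"
    by (auto simp: meo_case_def)
  then show ?thesis using sets_gp_case[OF assms] sets_ncg_case[OF assms] by auto
qed

text \<open>By continuity of the quadratic form in its argument, countably many directions
  decide semidefiniteness.\<close>

lemma sets_scaled_hess_loewner:
  assumes "twice_cont_diff f"
  shows "{x. loewner_ge (scaled_hess f I e x) ((- c) *\<^sub>R mat 1)} \<in> sets borel"
proof -
  note [measurable] = borel_measurable_hess_component[OF assms]
  obtain V :: "(real ^ 'a) set" where V: "countable V" "\<And>U. open U \<Longrightarrow> U \<noteq> {} \<Longrightarrow> \<exists>d\<in>V. d \<in> U"
    using countable_dense_exists[where 'a = "real ^ 'a"] by auto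
  define Q where "Q x v = quad (scaled_hess f I e x) v + c * (norm v)\<^sup>2" for x v
  have Q: "Q x v = (\<Sum>i\<in>UNIV. (if i \<in> I \<and> 0 \<le> x $ i \<and> x $ i \<le> e then x $ i * v $ i else v $ i) *
      (\<Sum>j\<in>UNIV. hess f x $ i $ j * (if j \<in> I \<and> 0 \<le> x $ j \<and> x $ j \<le> e then x $ j * v $ j else v $ j)))
      + c * (norm v)\<^sup>2" for x v
    unfolding Q_def quad_scaled_hess unfolding quad_def inner_vec_def
      matrix_vector_mult_def[of "hess f x"] Smat_component Jplus_mem[symmetric] by simp
  have Q_meas: "{x. 0 \<le> Q x v} \<in> sets borel" for v unfolding Q by measurable
  have "loewner_ge (scaled_hess f I e x) ((- c) *\<^sub>R mat 1) \<longleftrightarrow> (\<forall>v\<in>V. 0 \<le> Q x v)" for x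
  proof
    assume dense: "\<forall>v\<in>V. 0 \<le> Q x v"
    have "open {v. Q x v < 0}"
      unfolding Q_def quad_def by (intro open_Collect_less continuous_intros)
    then have "{v. Q x v < 0} = {}" using V(2) dense by force
    then show "loewner_ge (scaled_hess f I e x) ((- c) *\<^sub>R mat 1)"
      unfolding loewner_ge_def quad_shift Q_def[symmetric] by (auto simp: not_less)
  next
    assume "loewner_ge (scaled_hess f I e x) ((- c) *\<^sub>R mat 1)"
    then show "\<forall>v\<in>V. 0 \<le> Q x v" unfolding loewner_ge_def quad_shift Q_def[symmetric] by blast
  qed
  then have "{x. loewner_ge (scaled_hess f I e x) ((- c) *\<^sub>R mat 1)} = (\<Inter>v\<in>V. {x. 0 \<le> Q x v})" by auto
  also have "\<dots> \<in> sets borel"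
    by (rule sets.countable_INT''[OF _ V(1)]) (use Q_meas in auto)
  finally show ?thesis .
qed

text \<open>The oracle fails at most at the stopping iteration, and if it does not fail there then the
  certificate is correct. So the complement of all failures before \<open>K\<close> lies in the event in question.\<close>

lemma prob_first_stop_second_order:
  fixes P :: "'w measure" and f :: "real ^ 'n \<Rightarrow> real"
  assumes f: "twice_cont_diff f" and \<delta>: "\<delta> \<le> 1"
    and run: "pncg_random_run P F \<delta> f I \<epsilon>g (\<lambda>_. e) \<theta> \<zeta> \<eta> x0 X Mb C A"
    and stop: "\<And>\<omega>. \<omega> \<in> space P \<Longrightarrow> \<exists>k<K. pncg_stops f I \<epsilon>g (\<lambda>_. e) (X \<omega>) (A \<omega>) k"
  shows "(1 - \<delta>) ^ K \<le> measure P {\<omega> \<in> space P.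
      \<exists>k<K. pncg_stops f I \<epsilon>g (\<lambda>_. e) (X \<omega>) (A \<omega>) k \<and>
        loewner_ge (scaled_hess f I e (X \<omega> k)) (- e *\<^sub>R mat 1)}"
proof -
  interpret prob_space P using run by (simp add: pncg_random_run_def)
  have sub: "subalgebra P (F k)" for k using run by (simp add: pncg_random_run_def)
  have mono: "sets (F i) \<subseteq> sets (F j)" if "i \<le> j" for i j
    using run that by (auto simp: pncg_random_run_def filtration_def)
  have X: "(\<lambda>\<omega>. X \<omega> k) \<in> borel_measurable (F k)" for k using run by (simp add: pncg_random_run_def)
  have A: "{\<omega> \<in> space P. A \<omega> k = None} \<in> sets (F (Suc k))" for k using run by (simp add: pncg_random_run_def)
  have space_F: "space (F k) = space P" for k using sub[of k] by (simp add: subalgebra_def)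
  define U where "U k = {\<omega> \<in> space P. meo_case f I \<epsilon>g e (X \<omega> k) \<and> A \<omega> k = None}" for k
  define G where "G k = {\<omega> \<in> space P. loewner_ge (scaled_hess f I e (X \<omega> k)) (- e *\<^sub>R mat 1)}" for k
  define T where "T k = {\<omega> \<in> space P. pncg_stops f I \<epsilon>g (\<lambda>_. e) (X \<omega>) (A \<omega>) k}" for k
  define B where "B k = {\<omega> \<in> space P. meo_fails f I \<epsilon>g (\<lambda>_. e) (X \<omega>) (A \<omega>) k}" for k
  have preimage: "{\<omega> \<in> space P. X \<omega> k \<in> S} \<in> sets (F j)" if "S \<in> sets borel" "k \<le> j" for S k j
    using measurable_sets[OF X[of k] that(1)] mono[OF that(2)]
    by (auto simp: space_F vimage_def Int_def conj_commute)
  have G: "G k \<in> sets (F (Suc k))" for k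
    unfolding G_def using preimage[OF sets_scaled_hess_loewner[OF f, of I e e], of k "Suc k"] by simp
  have U: "U k \<in> sets (F j)" if "k < j" for k j
  proof -
    have "{\<omega> \<in> space P. meo_case f I \<epsilon>g e (X \<omega> k)} \<in> sets (F j)"
      using preimage[OF sets_meo_case[OF f, of I \<epsilon>g e], of k j] that by simp
    moreover have "{\<omega> \<in> space P. A \<omega> k = None} \<in> sets (F j)" using A[of k] mono[of "Suc k" j] that by auto
    moreover have "U k = {\<omega> \<in> space P. meo_case f I \<epsilon>g e (X \<omega> k)} \<inter> {\<omega> \<in> space P. A \<omega> k = None}"
      by (auto simp: U_def)
    ultimately show ?thesis by auto
  qed
  have T: "T k \<in> sets (F (Suc k))" for k
  proof -
    have "T k = U k - (\<Union>j<k. U j)" by (auto simp: T_def U_def pncg_stops_def)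
    then show ?thesis using U[of k "Suc k"] U[of _ "Suc k"] by auto
  qed
  have B_eq: "B k = T k - G k" for k
    using lambda_min_less_iff[of "scaled_hess f I e _" e, OF scaled_hess_symmetric[OF f]]
    by (auto simp: B_def T_def G_def meo_fails_def pncg_stops_iff)
  have "(1 - \<delta>) ^ K \<le> prob (space P - (\<Union>k<K. B k))"
  proof (rule prob_no_conditional_failure[OF sub mono _ _ \<delta>])
    show "B k \<in> sets (F (Suc k))" for k unfolding B_eq using T G by auto
    show "AE \<omega> in P. real_cond_exp P (F k) (indicat_real (B k)) \<omega> \<le> \<delta>" for k
      using run by (simp add: pncg_random_run_def B_def)
  qed
  also have "\<dots> \<le> prob (\<Union>k<K. T k \<inter> G k)"
  proof (rule finite_measure_mono)
    show "space P - (\<Union>k<K. B k) \<subseteq> (\<Union>k<K. T k \<inter> G k)"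
    proof
      fix \<omega> assume \<omega>: "\<omega> \<in> space P - (\<Union>k<K. B k)"
      then obtain k where "k < K" "\<omega> \<in> T k" using stop[of \<omega>] by (auto simp: T_def)
      then show "\<omega> \<in> (\<Union>k<K. T k \<inter> G k)" using \<omega> B_eq by auto
    qed
    have "T k \<inter> G k \<in> sets P" for k using T[of k] G[of k] sub[of "Suc k"] by (auto simp: subalgebra_def)
    then show "(\<Union>k<K. T k \<inter> G k) \<in> events" by auto
  qed
  also have "(\<Union>k<K. T k \<inter> G k) = {\<omega> \<in> space P. \<exists>k<K. pncg_stops f I \<epsilon>g (\<lambda>_. e) (X \<omega>) (A \<omega>) k \<and>
        loewner_ge (scaled_hess f I e (X \<omega> k)) (- e *\<^sub>R mat 1)}"
    by (auto simp: T_def G_def)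
  finally show ?thesis .
qed

section \<open>Second-order points and the rate\<close>

lemma K_pncg_le_powr:
  assumes "0 \<le> \<Delta>" "0 < \<epsilon>" "\<epsilon> < 1" and s: "0 < Min {c_nc LH \<theta> \<eta>, 8 * c_sol LH \<theta> \<zeta> \<eta>, 2 * \<theta> / Lg, \<eta>}"
  shows "real (K_pncg \<Delta> Lg LH \<theta> \<zeta> \<eta> \<epsilon> (sqrt \<epsilon>))
    \<le> (16 * \<Delta> / Min {c_nc LH \<theta> \<eta>, 8 * c_sol LH \<theta> \<zeta> \<eta>, 2 * \<theta> / Lg, \<eta>} + 2) * \<epsilon> powr (-3/2)"
proof -
  define s where "s = Min {c_nc LH \<theta> \<eta>, 8 * c_sol LH \<theta> \<zeta> \<eta>, 2 * \<theta> / Lg, \<eta>}"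
  define w where "w = \<epsilon> powr (-3/2)"
  have sq: "sqrt \<epsilon> = \<epsilon> powr (1/2)" using assms by (simp add: powr_half_sqrt)
  have "\<epsilon>\<^sup>2 = \<epsilon> powr 2" using assms by (simp add: powr_numeral)
  then have 1: "sqrt \<epsilon> / \<epsilon>\<^sup>2 = w" unfolding sq w_def by (simp add: powr_diff[symmetric])
  have "sqrt \<epsilon> ^ 3 = \<epsilon> powr (3/2)" using assms by (simp add: sq powr_power)
  then have 2: "1 / sqrt \<epsilon> ^ 3 = w" by (simp add: w_def powr_minus_divide)
  have w: "1 \<le> w" using assms powr_mono'[of "-3/2" 0 \<epsilon>] by (simp add: w_def)
  have "0 \<le> 16 * \<Delta> / s * w" using assms w by (simp add: s_def)
  then have "real (nat \<lfloor>16 * \<Delta> / s * w\<rfloor>) \<le> 16 * \<Delta> / s * w" by linarith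
  then have "real (K_pncg \<Delta> Lg LH \<theta> \<zeta> \<eta> \<epsilon> (sqrt \<epsilon>)) \<le> 16 * \<Delta> / s * w + 2"
    by (simp add: K_pncg_def s_def[symmetric] 1 2)
  also have "\<dots> \<le> 16 * \<Delta> / s * w + 2 * w" using w by simp
  finally show ?thesis by (simp add: s_def w_def algebra_simps)
qed

text \<open>The exponents agree after substituting \<open>sqrt \<epsilon>\<close>, so only the semidefinite inequality
  remains open at a stopping point.\<close>

lemma second_order_point_iff:
  assumes "0 < \<epsilon>" "x \<in> feas I"
    and "norm (Smat I (sqrt \<epsilon>) x *v grad f x) \<le> \<epsilon> + (sqrt \<epsilon>)\<^sup>2"
    and "\<forall>i \<in> Jplus I (sqrt \<epsilon>) x. - (sqrt \<epsilon> powr (3/2)) \<le> grad f x $ i"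
  shows "so_point f I \<epsilon> (1/2) x \<longleftrightarrow>
    loewner_ge (scaled_hess f I (sqrt \<epsilon>) x) ((- sqrt \<epsilon>) *\<^sub>R mat 1)"
proof -
  have "sqrt \<epsilon> powr (3/2) = \<epsilon> powr (3/4)"
    using assms(1) by (simp add: powr_half_sqrt[symmetric] powr_powr)
  then show ?thesis using assms by (auto simp: so_point_def powr_half_sqrt)
qed

theorem theorem3:
  fixes f :: "real ^ 'n \<Rightarrow> real" and I :: "'n set" and x0 :: "real ^ 'n"
    and f_low L\<^sub>f L\<^sub>g L\<^sub>H \<epsilon>g \<epsilon>H \<theta> \<zeta> \<eta> \<delta> :: real
    and D :: "(real ^ 'n) set"
    and P :: "'w measure" and F :: "nat \<Rightarrow> 'w measure"
    and X :: "'w \<Rightarrow> nat \<Rightarrow> real ^ 'n" and Mb :: "'w \<Rightarrow> nat \<Rightarrow> real"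
    and C :: "'w \<Rightarrow> nat \<Rightarrow> (real ^ 'n) \<times> cg_type" and A :: "'w \<Rightarrow> nat \<Rightarrow> (real ^ 'n) option"
    and K :: nat
  assumes K: "K = K_pncg (f x0 - f_low) L\<^sub>g L\<^sub>H \<theta> \<zeta> \<eta> \<epsilon>g \<epsilon>H"
    and f_C2: "twice_cont_diff f"
    and f_bdd: "\<forall>x \<in> feas I. f_low \<le> f x"
    and params: "\<forall>i. 0 \<le> x0 $ i" "0 < \<epsilon>g" "0 < \<epsilon>H" "\<epsilon>H < 1" "0 < \<theta>" "\<theta> < 1" "0 < \<zeta>" "\<zeta> < 1"
      "0 < \<eta>" "\<eta> < (1 - \<zeta>) / 2" "0 \<le> \<delta>" "\<delta> < 1"
    and level_compact: "compact (level_set f I x0)"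
    and run: "pncg_random_run P F \<delta> f I \<epsilon>g (\<lambda>_. \<epsilon>H) \<theta> \<zeta> \<eta> x0 X Mb C A"
    and D: "open D" "convex D" "level_set f I x0 \<subseteq> D"
      "\<forall>\<omega> \<in> space P. pncg_trial_points f I \<epsilon>g (\<lambda>_. \<epsilon>H) \<theta> \<eta> (X \<omega>) (C \<omega>) (A \<omega>) \<subseteq> D"
    and lipschitz: "0 < L\<^sub>f" "0 < L\<^sub>g" "0 < L\<^sub>H"
      "L\<^sub>f-lipschitz_on D f" "L\<^sub>g-lipschitz_on D (grad f)"
      "\<forall>x\<in>D. \<forall>y\<in>D. op_norm (hess f x - hess f y) \<le> L\<^sub>H * norm (x - y)"
  shows
    "(\<forall>\<omega> \<in> space P. \<exists>k<K. pncg_stops f I \<epsilon>g (\<lambda>_. \<epsilon>H) (X \<omega>) (A \<omega>) k \<and> X \<omega> k \<in> feas I)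
   \<and> (AE \<omega> in P. \<exists>k<K. pncg_stops f I \<epsilon>g (\<lambda>_. \<epsilon>H) (X \<omega>) (A \<omega>) k \<and>
        (\<forall>i\<in>I. 0 \<le> X \<omega> k $ i) \<and>
        norm (Smat I \<epsilon>H (X \<omega> k) *v grad f (X \<omega> k)) \<le> \<epsilon>g + \<epsilon>H\<^sup>2 \<and>
        (\<forall>i \<in> Jplus I \<epsilon>H (X \<omega> k). grad f (X \<omega> k) $ i \<ge> - (\<epsilon>H powr (3/2))))
   \<and> (1 - \<delta>) ^ K \<le> measure P {\<omega> \<in> space P.
        \<exists>k<K. pncg_stops f I \<epsilon>g (\<lambda>_. \<epsilon>H) (X \<omega>) (A \<omega>) k \<and>
          loewner_ge (scaled_hess f I \<epsilon>H (X \<omega> k)) (- \<epsilon>H *\<^sub>R mat 1)}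
   \<and> (\<forall>\<epsilon>. \<epsilon>g = \<epsilon> \<and> \<epsilon>H = sqrt \<epsilon> \<longrightarrow>
        (1 - \<delta>) ^ K \<le> measure P {\<omega> \<in> space P.
          \<exists>k<K. pncg_stops f I \<epsilon>g (\<lambda>_. \<epsilon>H) (X \<omega>) (A \<omega>) k \<and> so_point f I \<epsilon> (1/2) (X \<omega> k)})
   \<and> (\<exists>Cst :: real \<Rightarrow> real \<Rightarrow> real \<Rightarrow> real \<Rightarrow> real \<Rightarrow> real \<Rightarrow> real.
        \<forall>\<Delta> Lg' LH' \<theta>' \<zeta>' \<eta>'.
          0 \<le> \<Delta> \<and> 0 < Lg' \<and> 0 < LH' \<and> 0 < \<theta>' \<and> \<theta>' < 1 \<and> 0 < \<zeta>' \<and> \<zeta>' < 1 \<and>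
          0 < \<eta>' \<and> \<eta>' < (1 - \<zeta>') / 2 \<longrightarrow>
          (\<forall>\<epsilon>. 0 < \<epsilon> \<and> \<epsilon> < 1 \<longrightarrow>
             real (K_pncg \<Delta> Lg' LH' \<theta>' \<zeta>' \<eta>' \<epsilon> (sqrt \<epsilon>)) \<le> Cst \<Delta> Lg' LH' \<theta>' \<zeta>' \<eta>' * \<epsilon> powr (-3/2)))"
proof -
  interpret pncg_problem f I D L\<^sub>g L\<^sub>H \<epsilon>g \<epsilon>H \<theta> \<zeta> \<eta>
    using f_C2 D lipschitz params by unfold_locales auto
  have prob: "prob_space P" using run by (simp add: pncg_random_run_def)
  have x0: "x0 \<in> feas I" "x0 \<in> D" using params(1) D(3) by (auto simp: feas_def level_set_def)
  let ?stops = "\<lambda>\<omega>. pncg_stops f I \<epsilon>g (\<lambda>_. \<epsilon>H) (X \<omega>) (A \<omega>)"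
  have stop: "\<exists>k<K. ?stops \<omega> k \<and> X \<omega> k \<in> feas I" if "\<omega> \<in> space P" for \<omega>
  proof -
    have "pncg_run f I \<epsilon>g (\<lambda>_. \<epsilon>H) \<theta> \<zeta> \<eta> x0 (X \<omega>) (Mb \<omega>) (C \<omega>) (A \<omega>)"
      using run that by (auto simp: pncg_random_run_def)
    then show ?thesis unfolding K using run_terminates[OF _ _ x0 f_bdd] D(4) that by blast
  qed
  have first_order: "norm (Smat I \<epsilon>H (X \<omega> k) *v grad f (X \<omega> k)) \<le> \<epsilon>g + \<epsilon>H\<^sup>2"
    "\<forall>i \<in> Jplus I \<epsilon>H (X \<omega> k). - (\<epsilon>H powr (3/2)) \<le> grad f (X \<omega> k) $ i" if "?stops \<omega> k" for \<omega> k
    using meo_case_first_order[of "X \<omega> k"] that by (auto simp: pncg_stops_def)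
  have feas: "X \<omega> k \<in> feas I" if "\<omega> \<in> space P" "?stops \<omega> k" for \<omega> k
  proof -
    have "pncg_run f I \<epsilon>g (\<lambda>_. \<epsilon>H) \<theta> \<zeta> \<eta> x0 (X \<omega>) (Mb \<omega>) (C \<omega>) (A \<omega>)"
      using run that by (auto simp: pncg_random_run_def)
    then show ?thesis using run_invariant[OF _ _ x0] D(4) that pncg_stops_iff by blast
  qed
  have second_order: "(1 - \<delta>) ^ K \<le> measure P {\<omega> \<in> space P. \<exists>k<K. ?stops \<omega> k \<and>
      loewner_ge (scaled_hess f I \<epsilon>H (X \<omega> k)) (- \<epsilon>H *\<^sub>R mat 1)}"
    using params stop by (intro prob_first_stop_second_order[OF f_C2 _ run]) auto
  have point: "(1 - \<delta>) ^ K \<le> measure P {\<omega> \<in> space P. \<exists>k<K. ?stops \<omega> k \<and> so_point f I \<epsilon> (1/2) (X \<omega> k)}"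
    if eps: "\<epsilon>g = \<epsilon>" "\<epsilon>H = sqrt \<epsilon>" for \<epsilon>
  proof -
    have "so_point f I \<epsilon> (1/2) (X \<omega> k) \<longleftrightarrow> loewner_ge (scaled_hess f I \<epsilon>H (X \<omega> k)) (- \<epsilon>H *\<^sub>R mat 1)"
      if "\<omega> \<in> space P" "?stops \<omega> k" for \<omega> k
      using second_order_point_iff[OF _ feas[OF that], of \<epsilon> f] first_order[OF that(2)] params(2)
      by (simp add: eps)
    then have "{\<omega> \<in> space P. \<exists>k<K. ?stops \<omega> k \<and> so_point f I \<epsilon> (1/2) (X \<omega> k)} =
      {\<omega> \<in> space P. \<exists>k<K. ?stops \<omega> k \<and> loewner_ge (scaled_hess f I \<epsilon>H (X \<omega> k)) (- \<epsilon>H *\<^sub>R mat 1)}"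
      by blast
    then show ?thesis using second_order by simp
  qed
  have rate: "\<exists>Cst :: real \<Rightarrow> real \<Rightarrow> real \<Rightarrow> real \<Rightarrow> real \<Rightarrow> real \<Rightarrow> real.
        \<forall>\<Delta> Lg' LH' \<theta>' \<zeta>' \<eta>'.
          0 \<le> \<Delta> \<and> 0 < Lg' \<and> 0 < LH' \<and> 0 < \<theta>' \<and> \<theta>' < 1 \<and> 0 < \<zeta>' \<and> \<zeta>' < 1 \<and>
          0 < \<eta>' \<and> \<eta>' < (1 - \<zeta>') / 2 \<longrightarrow>
          (\<forall>\<epsilon>. 0 < \<epsilon> \<and> \<epsilon> < 1 \<longrightarrow>
             real (K_pncg \<Delta> Lg' LH' \<theta>' \<zeta>' \<eta>' \<epsilon> (sqrt \<epsilon>)) \<le> Cst \<Delta> Lg' LH' \<theta>' \<zeta>' \<eta>' * \<epsilon> powr (-3/2))"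
    by (intro exI[of _ "\<lambda>\<Delta> Lg LH \<theta> \<zeta> \<eta>.
        16 * \<Delta> / Min {c_nc LH \<theta> \<eta>, 8 * c_sol LH \<theta> \<zeta> \<eta>, 2 * \<theta> / Lg, \<eta>} + 2"] allI impI
        K_pncg_le_powr rate_constants_pos(3)) auto
  show ?thesis
  proof (intro conjI)
    show "\<forall>\<omega> \<in> space P. \<exists>k<K. ?stops \<omega> k \<and> X \<omega> k \<in> feas I" using stop by blast
    show "AE \<omega> in P. \<exists>k<K. ?stops \<omega> k \<and> (\<forall>i\<in>I. 0 \<le> X \<omega> k $ i) \<and>
        norm (Smat I \<epsilon>H (X \<omega> k) *v grad f (X \<omega> k)) \<le> \<epsilon>g + \<epsilon>H\<^sup>2 \<and>
        (\<forall>i \<in> Jplus I \<epsilon>H (X \<omega> k). grad f (X \<omega> k) $ i \<ge> - (\<epsilon>H powr (3/2)))"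
    proof (rule AE_I2)
      fix \<omega> assume "\<omega> \<in> space P"
      then obtain k where k: "k < K" "?stops \<omega> k" "X \<omega> k \<in> feas I" using stop by blast
      show "\<exists>k<K. ?stops \<omega> k \<and> (\<forall>i\<in>I. 0 \<le> X \<omega> k $ i) \<and>
        norm (Smat I \<epsilon>H (X \<omega> k) *v grad f (X \<omega> k)) \<le> \<epsilon>g + \<epsilon>H\<^sup>2 \<and>
        (\<forall>i \<in> Jplus I \<epsilon>H (X \<omega> k). grad f (X \<omega> k) $ i \<ge> - (\<epsilon>H powr (3/2)))"
        using k first_order[OF k(2)] by (intro exI[of _ k]) (simp add: feas_def)
    qed
  qed (use second_order point rate in blast)+
qed

end
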